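(* Let $\psi_1,\psi_2\in H^{2}(\mathbb{R})\cap H^{1,1}(\mathbb{R})$ be $\mathbb{C}$-valued functions independent of $\varepsilon$. For sufficiently small $\varepsilon>0$, let $u=(u_1,u_2)\in C([0,\infty);H^2\cap H^{1,1})$ be the global solution of the Cauchy problem $$i\partial_t u_1+\tfrac12\partial_x^2u_1=-i|u_2|^2u_1,\qquad i\partial_t u_2+\tfrac12\partial_x^2u_2=-i|u_1|^2u_2,\qquad (t,x)\in(0,\infty)\times\mathbb{R},$$ $$u_j(0,x)=\varepsilon\psi_j(x),\quad x\in\mathbb{R},\ j=1,2,$$ and let $m=m_\varepsilon:\mathbb{R}\to\mathbb{R}$ be the function associated with this solution as defined in the context. Then $$m(\xi)=\varepsilon^2\bigl(|\hat\psi_1(\xi)|^2-|\hat\psi_2(\xi)|^2\bigr)+O(\varepsilon^4)$$ as $\varepsilon\to+0$, uniformly in $\xi\in\mathbb{R}$; that is, there exist constants $C,\varepsilon_0>0$, independent of $\varepsilon$ and $\xi$ (but possibly depending on $\psi_1,\psi_2$), such that $$\bigl|m_\varepsilon(\xi)-\varepsilon^2\bigl(|\hat\psi_1(\xi)|^2-|\hat\psi_2(\xi)|^2\bigr)\bigr|\le C\varepsilon^4\quad\text{for all }\xi\in\mathbb{R},\ 0<\varepsilon<\varepsilon_0.$$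
   Context: Notation. $H^{s,\sigma}=H^{s,\sigma}(\mathbb{R})$ is the $L^2$-based weighted Sobolev space of order $(s,\sigma)$, i.e. the space of $\phi$ with $(1+x^2)^{\sigma/2}(1-\partial_x^2)^{s/2}\phi\in L^2(\mathbb{R})$, and $H^s=H^{s,0}$. The Fourier transform is $\mathcal{F}\phi(\xi)=\hat\phi(\xi)=\frac{1}{\sqrt{2\pi}}\int_{\mathbb{R}}e^{-ix\xi}\phi(x)\,dx$, and $\mathcal{U}(t)=\exp(i\frac t2\partial_x^2)$ is the free Schrödinger group. Known result (assumed): if the initial data $\varphi^0=(\varphi_1^0,\varphi_2^0)$ have sufficiently small norm in $H^2\cap H^{1,1}$, the Cauchy problem for the system with $u_j(0)=\varphi_j^0$ has a unique global solution $u\in C([0,\infty);H^2\cap H^{1,1})$. In particular this applies to $\varphi^0_j=\varepsilon\psi_j$ for small $\varepsilon>0$. Definition of $m$. For this solution put $\alpha_j(t,\xi)=\mathcal{F}[\mathcal{U}(-t)u_j(t,\cdot)](\xi)$, $j=1,2$, and, for $t\ge 2$, $$R_1=\frac1t|\alpha_2|^2\alpha_1-\mathcal{F}\mathcal{U}(-t)\bigl[|u_2|^2u_1\bigr],\qquad R_2=\frac1t|\alpha_1|^2\alpha_2-\mathcal{F}\mathcal{U}(-t)\bigl[|u_1|^2u_2\bigr],$$ $$\rho(t,\xi)=2\,\mathrm{Re}\Bigl[\overline{\alpha_1(t,\xi)}R_1(t,\xi)-\overline{\alpha_2(t,\xi)}R_2(t,\xi)\Bigr].$$ Then $$m(\xi)=|\alpha_1(2,\xi)|^2-|\alpha_2(2,\xi)|^2+\int_2^\infty\rho(\tau,\xi)\,d\tau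 ,$$ where the integral is known to converge absolutely for every $\xi\in\mathbb{R}$ when $\varepsilon$ is small. (This is the function $m$ of a known result: writing $\varphi_j^+=\lim_{t\to+\infty}\mathcal{U}(-t)u_j(t)$ in $L^2$, for each $\xi$ one has: $m(\xi)>0$ implies $\hat\varphi_1^+(\xi)\neq0$ and $\hat\varphi_2^+(\xi)=0$; $m(\xi)<0$ implies $\hat\varphi_1^+(\xi)=0$ and $\hat\varphi_2^+(\xi)\ne0$; $m(\xi)=0$ implies $\hat\varphi_1^+(\xi)=\hat\varphi_2^+(\xi)=0$.) *)

theory Defs
  imports "HOL-Analysis.Analysis"
begin

text \<open>
  Elements of $L^2(\mathbb{R})$ are represented by Borel functions; equality in $L^2$ is equality
  almost everywhere.
\<close>

definition L2 :: "(real \<Rightarrow> complex) set" where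
  "L2 = {f \<in> borel_measurable lborel. integrable lborel (\<lambda>x. (cmod (f x))\<^sup>2)}"

definition L2_norm :: "(real \<Rightarrow> complex) \<Rightarrow> real" where
  "L2_norm f = sqrt (LINT x|lborel. (cmod (f x))\<^sup>2)"

definition L2_tendsto :: "('i \<Rightarrow> real \<Rightarrow> complex) \<Rightarrow> (real \<Rightarrow> complex) \<Rightarrow> 'i filter \<Rightarrow> bool" where
  "L2_tendsto f g F \<longleftrightarrow>
     (\<forall>\<^sub>F i in F. (\<lambda>x. f i x - g x) \<in> L2) \<and> ((\<lambda>i. L2_norm (\<lambda>x. f i x - g x)) \<longlongrightarrow> 0) F"

text \<open>The Fourier transform as an absolutely convergent integral, for integrable functions.\<close>

definition fourier :: "(real \<Rightarrow> complex) \<Rightarrow> real \<Rightarrow> complex" where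
  "fourier f \<xi> =
     complex_of_real (1 / sqrt (2 * pi)) *
       (LINT x|lborel. exp (- \<i> * complex_of_real (x * \<xi>)) * f x)"

text \<open>
  The Fourier transform on $L^2$ is the $L^2$-limit of the transforms of the truncations of $f$
  to $[-n,n]$. The limit is unique up to a null set; the choice operator picks a representative.
\<close>

definition fourier_L2 :: "(real \<Rightarrow> complex) \<Rightarrow> real \<Rightarrow> complex" where
  "fourier_L2 f =
     (SOME g. g \<in> L2 \<and>
        L2_tendsto (\<lambda>n. fourier (\<lambda>x. indicator {- real n..real n} x * f x)) g sequentially)"

definition inv_fourier_L2 :: "(real \<Rightarrow> complex) \<Rightarrow> real \<Rightarrow> complex" where
  "inv_fourier_L2 g x = fourier_L2 g (- x)"

text \<open>
  The operator with symbol \<open>a\<close>, meaningful for those \<open>f\<close> in \<open>L2\<close> for which \<open>a\<close> times the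
  transform of \<open>f\<close> is again in \<open>L2\<close>. All functions of $\partial_x^2$ below are of this form.
\<close>

definition fourier_mult :: "(real \<Rightarrow> complex) \<Rightarrow> (real \<Rightarrow> complex) \<Rightarrow> real \<Rightarrow> complex" where
  "fourier_mult a f = inv_fourier_L2 (\<lambda>\<xi>. a \<xi> * fourier_L2 f \<xi>)"

definition japanese :: "real \<Rightarrow> real \<Rightarrow> complex" where
  "japanese s x = complex_of_real ((1 + x\<^sup>2) powr (s / 2))"

definition bessel :: "real \<Rightarrow> (real \<Rightarrow> complex) \<Rightarrow> real \<Rightarrow> complex" where
  "bessel s = fourier_mult (japanese s)"    \<comment> \<open>$(1 - \partial_x^2)^{s/2}$\<close>

definition dxx :: "(real \<Rightarrow> complex) \<Rightarrow> real \<Rightarrow> complex" where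
  "dxx = fourier_mult (\<lambda>\<xi>. - complex_of_real (\<xi>\<^sup>2))"    \<comment> \<open>$\partial_x^2$\<close>

definition schroedinger :: "real \<Rightarrow> (real \<Rightarrow> complex) \<Rightarrow> real \<Rightarrow> complex" where
  "schroedinger t = fourier_mult (\<lambda>\<xi>. exp (- \<i> * complex_of_real (t * \<xi>\<^sup>2 / 2)))"

text \<open>
  $H^{s,\sigma}$ for $s, \sigma \ge 0$. In this range $H^{s,\sigma} \subseteq H^s \subseteq L^2$, and
  the second condition below, which says $\phi \in H^s$, makes \<open>bessel s \<phi>\<close> meaningful as an
  element of $L^2$.
\<close>

definition sobolev :: "real \<Rightarrow> real \<Rightarrow> (real \<Rightarrow> complex) set" where
  "sobolev s \<sigma> =
     {\<phi>. \<phi> \<in> L2 \<and> (\<lambda>\<xi>. japanese s \<xi> * fourier_L2 \<phi> \<xi>) \<in> L2 \<and>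
          (\<lambda>x. japanese \<sigma> x * bessel s \<phi> x) \<in> L2}"

definition sobolev_norm :: "real \<Rightarrow> real \<Rightarrow> (real \<Rightarrow> complex) \<Rightarrow> real" where
  "sobolev_norm s \<sigma> \<phi> = L2_norm (\<lambda>x. japanese \<sigma> x * bessel s \<phi> x)"

definition continuous_in_sobolev :: "real \<Rightarrow> real \<Rightarrow> (real \<Rightarrow> real \<Rightarrow> complex) \<Rightarrow> bool" where
  "continuous_in_sobolev s \<sigma> u \<longleftrightarrow>
     (\<forall>t\<ge>0. u t \<in> sobolev s \<sigma>) \<and>
     (\<forall>t\<ge>0. ((\<lambda>\<tau>. sobolev_norm s \<sigma> (\<lambda>x. u \<tau> x - u t x)) \<longlongrightarrow> 0) (at t within {0..}))"

definition has_L2_time_derivative ::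
  "(real \<Rightarrow> real \<Rightarrow> complex) \<Rightarrow> (real \<Rightarrow> complex) \<Rightarrow> real \<Rightarrow> bool" where
  "has_L2_time_derivative u v t \<longleftrightarrow>
     v \<in> L2 \<and> L2_tendsto (\<lambda>h x. (u (t + h) x - u t x) / complex_of_real h) v (at 0)"

definition damping :: "(real \<Rightarrow> complex) \<Rightarrow> (real \<Rightarrow> complex) \<Rightarrow> real \<Rightarrow> complex" where
  "damping v u x = complex_of_real ((cmod (v x))\<^sup>2) * u x"

text \<open>
  $i \partial_t u + \frac12 \partial_x^2 u = -i |v|^2 u$ for $t > 0$, as an equation in $L^2$.
\<close>

definition solves_equation ::
  "(real \<Rightarrow> real \<Rightarrow> complex) \<Rightarrow> (real \<Rightarrow> real \<Rightarrow> complex) \<Rightarrow> bool" where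
  "solves_equation v u \<longleftrightarrow>
     (\<forall>t>0. \<exists>ut. has_L2_time_derivative u ut t \<and>
        (AE x in lborel. \<i> * ut x + 1 / 2 * dxx (u t) x = - \<i> * damping (v t) (u t) x))"

definition global_solution ::
  "(real \<Rightarrow> complex) \<Rightarrow> (real \<Rightarrow> complex) \<Rightarrow>
   (real \<Rightarrow> real \<Rightarrow> complex) \<Rightarrow> (real \<Rightarrow> real \<Rightarrow> complex) \<Rightarrow> bool" where
  "global_solution \<phi>1 \<phi>2 u1 u2 \<longleftrightarrow>
     continuous_in_sobolev 2 0 u1 \<and> continuous_in_sobolev 1 1 u1 \<and>
     continuous_in_sobolev 2 0 u2 \<and> continuous_in_sobolev 1 1 u2 \<and>
     solves_equation u2 u1 \<and> solves_equation u1 u2 \<and>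
     (AE x in lborel. u1 0 x = \<phi>1 x) \<and> (AE x in lborel. u2 0 x = \<phi>2 x)"

text \<open>
  Both $\mathcal{U}(-t) u_j(t)$ and $\mathcal{U}(-t)[|u_k|^2 u_j](t)$ lie in $H^{1,1} \subseteq L^1$,
  so the integral \<open>fourier\<close> gives their transforms at every point $\xi$, independently of the
  chosen representatives.
\<close>

definition profile :: "(real \<Rightarrow> real \<Rightarrow> complex) \<Rightarrow> real \<Rightarrow> real \<Rightarrow> complex" where
  "profile u t = fourier (schroedinger (- t) (u t))"    \<comment> \<open>$\alpha$\<close>

definition remainder ::
  "(real \<Rightarrow> real \<Rightarrow> complex) \<Rightarrow> (real \<Rightarrow> real \<Rightarrow> complex) \<Rightarrow> real \<Rightarrow> real \<Rightarrow> complex" where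
  "remainder v u t \<xi> =
     complex_of_real (1 / t * (cmod (profile v t \<xi>))\<^sup>2) * profile u t \<xi>
     - fourier (schroedinger (- t) (damping (v t) (u t))) \<xi>"    \<comment> \<open>$R_1$ is \<open>remainder u2 u1\<close>\<close>

definition rho ::
  "(real \<Rightarrow> real \<Rightarrow> complex) \<Rightarrow> (real \<Rightarrow> real \<Rightarrow> complex) \<Rightarrow> real \<Rightarrow> real \<Rightarrow> real" where
  "rho u1 u2 t \<xi> =
     2 * Re (cnj (profile u1 t \<xi>) * remainder u2 u1 t \<xi>
             - cnj (profile u2 t \<xi>) * remainder u1 u2 t \<xi>)"

definition m_fun ::
  "(real \<Rightarrow> real \<Rightarrow> complex) \<Rightarrow> (real \<Rightarrow> real \<Rightarrow> complex) \<Rightarrow> real \<Rightarrow> real" where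
  "m_fun u1 u2 \<xi> =
     (cmod (profile u1 2 \<xi>))\<^sup>2 - (cmod (profile u2 2 \<xi>))\<^sup>2
     + (LINT \<tau>:{2..}|lborel. rho u1 u2 \<tau> \<xi>)"

end

theory Submission
  imports Defs "HOL-Probability.Probability" "HOL-Real_Asymp.Real_Asymp"
begin

text \<open>
  In the interaction picture $v_j = \mathcal{U}(-t)u_j$ the equations read
  $\partial_t v_1 = -\mathcal{U}(-t)[|u_2|^2u_1]$, so that $\alpha_j = \hat v_j$ obeys
  $\partial_t\alpha_1 = -\frac1t|\alpha_2|^2\alpha_1 + R_1$. In $\partial_t(|\alpha_1|^2-|\alpha_2|^2)$ the
  two cubic main terms cancel, and $m$ differs from $|\alpha_1(0)|^2-|\alpha_2(0)|^2$ only by the increments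
  over $[0,2]$ and by $\int_2^\infty\rho$. All of these are quartic once one knows the decay
  $|u_j| \le K\varepsilon(1+t)^{-1/2}$, which follows from a bootstrap: the decay makes the weighted norms of
  $v_j$ grow at most like $(1+t)^{1/24}$; the factorization $\mathcal{U}(t) = MDFM$ then gives
  $R_j = O(\varepsilon^3t^{-29/24})$; and since the main term is dissipative, $|\alpha_j|$ and hence
  $t^{1/2}|u_j|$ stay below $K\varepsilon/2$. Derivatives of the nonlinearity are avoided
  throughout: $\|x f\|_{L^2}$ is the best Lipschitz constant of $h \mapsto \hat f(\cdot+h)$ in $L^2$, and
  Lipschitz bounds pass to $|u_2|^2u_1$ directly.
\<close>

subsection \<open>Square integrable functions\<close>

text \<open>Two obstacles shape the argument. First, \<open>m_fun\<close> is evaluated at every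
  single frequency, while solutions are L2 classes with arbitrary representatives. So the transforms
  of \<open>V t\<close> and \<open>n t\<close> must be integrals of integrable functions, which one
  weight x secures, and almost everywhere statements are upgraded to all frequencies by continuity.
  Second, only that one weight is available: removing the factor M costs t^(-1/4), so growth t^p of
  the weighted norms leaves a remainder of order t^(-5/4+p). This is integrable for every p < 1/4; p
  = 1/24 produces the exponent 29/24. Since p need only exceed a multiple of the square of the decay
  constant, small data make such a p admissible. All sizes are measured by one parameter \<delta>
  with explicit constants, so that the bootstrap closes numerically: assuming decay with 100
  \<delta>, the transforms relevant at times beyond 1 stay below 33 \<delta>, and sqrt 2 < 3/2
  returns 50 \<delta>. The L2 Fourier theory is derived from complex Gaussians because the
  multiplier of the free group is itself a limit of Gaussians.\<close>

lemma L2_measurable: "f \<in> L2 \<Longrightarrow> f \<in> borel_measurable borel"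
  by (simp add: L2_def)

lemma L2_integrable: "f \<in> L2 \<Longrightarrow> integrable lborel (\<lambda>x. (cmod (f x))\<^sup>2)"
  by (simp add: L2_def)

lemma L2_norm_nonneg [simp]: "0 \<le> L2_norm f"
  by (simp add: L2_norm_def)

lemma L2_norm_sq: "(L2_norm f)\<^sup>2 = (LINT x|lborel. (cmod (f x))\<^sup>2)"
  by (simp add: L2_norm_def)

lemma L2_nn_integral:
  "f \<in> L2 \<Longrightarrow> (\<integral>\<^sup>+x. ennreal ((cmod (f x))\<^sup>2) \<partial>lborel) = ennreal ((L2_norm f)\<^sup>2)"
  by (simp add: L2_norm_sq nn_integral_eq_integral L2_integrable)

text \<open>The nonnegative integral exists without any integrability, so a single estimate yields
  membership and the norm bound together. Domination, Fatou and the contraction property of the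
  transform all end with this criterion.\<close>

lemma L2_nn_integralI:
  assumes "f \<in> borel_measurable borel" "0 \<le> C"
    and "(\<integral>\<^sup>+x. ennreal ((cmod (f x))\<^sup>2) \<partial>lborel) \<le> ennreal (C\<^sup>2)"
  shows "f \<in> L2" "L2_norm f \<le> C"
proof -
  have [measurable]: "f \<in> borel_measurable borel" by fact
  show f: "f \<in> L2"
    unfolding L2_def using assms le_less_trans[OF assms(3)]
    by (auto simp: integrable_iff_bounded)
  have "ennreal ((L2_norm f)\<^sup>2) \<le> ennreal (C\<^sup>2)"
    using assms(3) L2_nn_integral[OF f] by simp
  then show "L2_norm f \<le> C"
    using assms(2) by (simp add: power2_le_iff_abs_le)
qed

lemma L2_dominated:
  assumes f: "f \<in> L2" and [measurable]: "g \<in> borel_measurable borel" and "0 \<le> c"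
    and le: "AE x in lborel. cmod (g x) \<le> c * cmod (f x)"
  shows "g \<in> L2" "L2_norm g \<le> c * L2_norm f"
proof -
  have [measurable]: "f \<in> borel_measurable borel" using f by (rule L2_measurable)
  have "(\<integral>\<^sup>+x. ennreal ((cmod (g x))\<^sup>2) \<partial>lborel)
      \<le> (\<integral>\<^sup>+x. ennreal (c\<^sup>2) * ennreal ((cmod (f x))\<^sup>2) \<partial>lborel)"
  proof (rule nn_integral_mono_AE, use le in eventually_elim)
    fix x assume "cmod (g x) \<le> c * cmod (f x)"
    then have "(cmod (g x))\<^sup>2 \<le> c\<^sup>2 * (cmod (f x))\<^sup>2"
      by (metis norm_ge_zero power_mono power_mult_distrib)
    then show "ennreal ((cmod (g x))\<^sup>2) \<le> ennreal (c\<^sup>2) * ennreal ((cmod (f x))\<^sup>2)"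
      by (simp add: ennreal_mult[symmetric])
  qed
  also have "\<dots> = ennreal (c\<^sup>2) * ennreal ((L2_norm f)\<^sup>2)"
    by (subst nn_integral_cmult) (auto simp: L2_nn_integral[OF f])
  also have "\<dots> = ennreal ((c * L2_norm f)\<^sup>2)"
    by (simp add: ennreal_mult[symmetric] power_mult_distrib)
  finally show "g \<in> L2" "L2_norm g \<le> c * L2_norm f"
    using L2_nn_integralI[of g "c * L2_norm f"] \<open>0 \<le> c\<close> by auto
qed

lemma L2_norm_cong:
  assumes [measurable]: "f \<in> borel_measurable borel" "g \<in> borel_measurable borel"
    and "AE x in lborel. cmod (f x) = cmod (g x)"
  shows "L2_norm f = L2_norm g"
  unfolding L2_norm_def using assms(3)
  by (intro arg_cong[where f=sqrt] integral_cong_AE) auto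

lemma L2_cong:
  assumes f: "f \<in> L2" and g: "g \<in> borel_measurable borel"
    and eq: "AE x in lborel. g x = f x"
  shows "g \<in> L2" "L2_norm g = L2_norm f"
proof -
  have "AE x in lborel. cmod (g x) \<le> 1 * cmod (f x)" using eq by eventually_elim simp
  then show "g \<in> L2" using L2_dominated(1)[OF f g, of 1] by simp
  show "L2_norm g = L2_norm f"
    using eq by (intro L2_norm_cong[OF g L2_measurable[OF f]]) (auto elim: eventually_mono)
qed

lemma L2_zero [simp]: "(\<lambda>x. 0) \<in> L2" "L2_norm (\<lambda>x. 0) = 0"
  by (auto simp: L2_def L2_norm_def)

lemma L2_norm_minus_commute: "L2_norm (\<lambda>x. f x - g x) = L2_norm (\<lambda>x. g x - f x)"
  by (simp add: L2_norm_def norm_minus_commute)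

lemma L2_mult_bounded:
  assumes f: "f \<in> L2" and [measurable]: "a \<in> borel_measurable borel"
    and "0 \<le> c" "\<And>x. cmod (a x) \<le> c"
  shows "(\<lambda>x. a x * f x) \<in> L2" "L2_norm (\<lambda>x. a x * f x) \<le> c * L2_norm f"
proof -
  have [measurable]: "f \<in> borel_measurable borel" using f by (rule L2_measurable)
  have "AE x in lborel. cmod (a x * f x) \<le> c * cmod (f x)"
    using assms by (auto simp: norm_mult intro!: mult_right_mono)
  then show "(\<lambda>x. a x * f x) \<in> L2" "L2_norm (\<lambda>x. a x * f x) \<le> c * L2_norm f"
    using L2_dominated[OF f _ \<open>0 \<le> c\<close>, of "\<lambda>x. a x * f x"] by auto
qed

lemma L2_cmult [simp, intro]: "f \<in> L2 \<Longrightarrow> (\<lambda>x. c * f x) \<in> L2"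
  using L2_mult_bounded(1)[of f "\<lambda>x. c" "cmod c"] by auto

lemma L2_norm_cmult: "L2_norm (\<lambda>x. c * f x) = cmod c * L2_norm f"
  by (simp add: L2_norm_def norm_mult power_mult_distrib real_sqrt_mult)

lemma L2_uminus [simp, intro]: "f \<in> L2 \<Longrightarrow> (\<lambda>x. - f x) \<in> L2"
  using L2_cmult[of f "-1"] by simp

lemma L2_norm_uminus [simp]: "L2_norm (\<lambda>x. - f x) = L2_norm f"
  by (simp add: L2_norm_def)

lemma borel_measurable_cnj [measurable (raw)]:
  "f \<in> borel_measurable M \<Longrightarrow> (\<lambda>x. cnj (f x)) \<in> borel_measurable M"
  by (rule borel_measurable_continuous_on[OF continuous_on_cnj[OF continuous_on_id]])

lemma L2_cnj [simp, intro]: "f \<in> L2 \<Longrightarrow> (\<lambda>x. cnj (f x)) \<in> L2"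
  by (auto simp: L2_def)

lemma L2_norm_cnj [simp]: "L2_norm (\<lambda>x. cnj (f x)) = L2_norm f"
  by (simp add: L2_norm_def)

lemma L2_add [simp, intro]:
  assumes "f \<in> L2" "g \<in> L2"
  shows "(\<lambda>x. f x + g x) \<in> L2"
proof -
  have [measurable]: "f \<in> borel_measurable borel" "g \<in> borel_measurable borel"
    using assms by (auto intro: L2_measurable)
  have "integrable lborel (\<lambda>x. (cmod (f x + g x))\<^sup>2)"
  proof (rule Bochner_Integration.integrable_bound)
    show "integrable lborel (\<lambda>x. 2 * (cmod (f x))\<^sup>2 + 2 * (cmod (g x))\<^sup>2)"
      by (intro Bochner_Integration.integrable_add integrable_mult_right L2_integrable assms)
    show "AE x in lborel. norm ((cmod (f x + g x))\<^sup>2)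
        \<le> norm (2 * (cmod (f x))\<^sup>2 + 2 * (cmod (g x))\<^sup>2)"
    proof (intro AE_I2)
      fix x
      have "(cmod (f x + g x))\<^sup>2 \<le> (cmod (f x) + cmod (g x))\<^sup>2"
        by (intro power_mono norm_triangle_ineq) auto
      also have "\<dots> \<le> 2 * (cmod (f x))\<^sup>2 + 2 * (cmod (g x))\<^sup>2"
        using sum_squares_ge_zero[of "cmod (f x) - cmod (g x)" 0]
        by (simp add: power2_eq_square algebra_simps)
      finally show "norm ((cmod (f x + g x))\<^sup>2)
        \<le> norm (2 * (cmod (f x))\<^sup>2 + 2 * (cmod (g x))\<^sup>2)" by simp
    qed
  qed measurable
  then show ?thesis by (simp add: L2_def)
qed

lemma L2_diff [simp, intro]:
  assumes "f \<in> L2" "g \<in> L2"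
  shows "(\<lambda>x. f x - g x) \<in> L2"
  using L2_add[OF assms(1) L2_uminus[OF assms(2)]] by simp

lemma L2_Cauchy_Schwarz:
  assumes f: "f \<in> L2" and g: "g \<in> L2"
  shows "integrable lborel (\<lambda>x. f x * g x)"
    and "(LINT x|lborel. cmod (f x) * cmod (g x)) \<le> L2_norm f * L2_norm g"
    and "cmod (LINT x|lborel. f x * g x) \<le> L2_norm f * L2_norm g"
proof -
  have [measurable]: "f \<in> borel_measurable borel" "g \<in> borel_measurable borel"
    using assms by (auto intro: L2_measurable)
  have *: "(\<integral>\<^sup>+x. ennreal (cmod (f x) * cmod (g x)) \<partial>lborel)\<^sup>2
      \<le> ennreal ((L2_norm f * L2_norm g)\<^sup>2)"
    using Cauchy_Schwarz_nn_integral[of "\<lambda>x. ennreal (cmod (f x))" lborel "\<lambda>x. ennreal (cmod (g x))"]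
    by (simp add: ennreal_power L2_nn_integral f g ennreal_mult power_mult_distrib)
  show int: "integrable lborel (\<lambda>x. f x * g x)"
  proof (rule integrableI_bounded)
    have "(\<integral>\<^sup>+x. ennreal (cmod (f x) * cmod (g x)) \<partial>lborel) \<noteq> \<infinity>"
    proof
      assume "(\<integral>\<^sup>+x. ennreal (cmod (f x) * cmod (g x)) \<partial>lborel) = \<infinity>"
      with * show False by (auto simp: power2_eq_square top_unique ennreal_mult_top)
    qed
    then show "(\<integral>\<^sup>+x. ennreal (norm (f x * g x)) \<partial>lborel) < \<infinity>"
      by (simp add: norm_mult less_top)
  qed measurable
  have int': "integrable lborel (\<lambda>x. cmod (f x) * cmod (g x))"
    using integrable_norm[OF int] by (simp add: norm_mult)
  have "ennreal ((LINT x|lborel. cmod (f x) * cmod (g x))\<^sup>2) \<le> ennreal ((L2_norm f * L2_norm g)\<^sup>2)"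
    using * by (simp add: nn_integral_eq_integral[OF int'] ennreal_power)
  then show 1: "(LINT x|lborel. cmod (f x) * cmod (g x)) \<le> L2_norm f * L2_norm g"
    by (auto simp: power2_le_iff_abs_le)
  show "cmod (LINT x|lborel. f x * g x) \<le> L2_norm f * L2_norm g"
    using integral_norm_bound[of lborel "\<lambda>x. f x * g x"] 1 by (simp add: norm_mult)
qed

lemma L2_triangle:
  assumes f: "f \<in> L2" and g: "g \<in> L2"
  shows "L2_norm (\<lambda>x. f x + g x) \<le> L2_norm f + L2_norm g"
proof -
  have [measurable]: "f \<in> borel_measurable borel" "g \<in> borel_measurable borel"
    using assms by (auto intro: L2_measurable)
  have int': "integrable lborel (\<lambda>x. cmod (f x) * cmod (g x))"
    using integrable_norm[OF L2_Cauchy_Schwarz(1)[OF f g]] by (simp add: norm_mult)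
  have "(L2_norm (\<lambda>x. f x + g x))\<^sup>2 = (LINT x|lborel. (cmod (f x + g x))\<^sup>2)"
    by (rule L2_norm_sq)
  also have "\<dots> \<le> (LINT x|lborel. (cmod (f x))\<^sup>2 + 2 * (cmod (f x) * cmod (g x)) + (cmod (g x))\<^sup>2)"
  proof (rule integral_mono)
    fix x
    have "(cmod (f x + g x))\<^sup>2 \<le> (cmod (f x) + cmod (g x))\<^sup>2"
      by (intro power_mono norm_triangle_ineq) auto
    then show "(cmod (f x + g x))\<^sup>2 \<le> (cmod (f x))\<^sup>2 + 2 * (cmod (f x) * cmod (g x)) + (cmod (g x))\<^sup>2"
      by (simp add: power2_eq_square algebra_simps)
  qed (use L2_integrable[OF L2_add[OF f g]] L2_integrable[OF f] L2_integrable[OF g] int' in auto)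
  also have "\<dots> = (L2_norm f)\<^sup>2 + 2 * (LINT x|lborel. cmod (f x) * cmod (g x)) + (L2_norm g)\<^sup>2"
    using int' by (simp add: L2_norm_sq L2_integrable f g)
  also have "\<dots> \<le> (L2_norm f + L2_norm g)\<^sup>2"
    using L2_Cauchy_Schwarz(2)[OF f g] by (simp add: power2_eq_square algebra_simps)
  finally show ?thesis by (rule power2_le_imp_le) simp
qed

lemma L2_triangle_diff:
  assumes f: "f \<in> L2" and g: "g \<in> L2"
  shows "L2_norm (\<lambda>x. f x - g x) \<le> L2_norm f + L2_norm g"
  using L2_triangle[OF f L2_uminus[OF g]] by simp

lemma L2_triangle_via:
  assumes f: "f \<in> L2" and g: "g \<in> L2" and h: "h \<in> L2"
  shows "L2_norm (\<lambda>x. f x - h x) \<le> L2_norm (\<lambda>x. f x - g x) + L2_norm (\<lambda>x. g x - h x)"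
  using L2_triangle[OF L2_diff[OF f g] L2_diff[OF g h]] by simp

lemma L2_norm_le_diff:
  assumes f: "f \<in> L2" and g: "g \<in> L2"
  shows "L2_norm f \<le> L2_norm g + L2_norm (\<lambda>x. f x - g x)"
  using L2_triangle[OF g L2_diff[OF f g]] by simp

lemma L2_norm_eq_0D:
  assumes f: "f \<in> L2" and "L2_norm f = 0"
  shows "AE x in lborel. f x = 0"
proof -
  have "(LINT x|lborel. (cmod (f x))\<^sup>2) = 0" using L2_norm_sq[of f] assms(2) by simp
  then have "AE x in lborel. (cmod (f x))\<^sup>2 = 0"
    using integral_nonneg_eq_0_iff_AE[OF L2_integrable[OF f]] by simp
  then show ?thesis by simp
qed

text \<open>Turns a uniform norm bound and pointwise convergence into a bound for the limit, without
  norm convergence. Difference quotients, truncated weights and Gaussian regularizations are all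
  passed to the limit in this way.\<close>

lemma L2_fatou:
  assumes s: "\<And>n::nat. s n \<in> L2" and [measurable]: "f \<in> borel_measurable borel" and "0 \<le> C"
    and le: "eventually (\<lambda>n. L2_norm (s n) \<le> C) sequentially"
    and lim: "AE x in lborel. (\<lambda>n. s n x) \<longlonglongrightarrow> f x"
  shows "f \<in> L2" "L2_norm f \<le> C"
proof -
  have [measurable]: "\<And>n. s n \<in> borel_measurable borel" using s by (auto intro: L2_measurable)
  have "(\<integral>\<^sup>+x. ennreal ((cmod (f x))\<^sup>2) \<partial>lborel)
      = (\<integral>\<^sup>+x. liminf (\<lambda>n. ennreal ((cmod (s n x))\<^sup>2)) \<partial>lborel)"
  proof (rule nn_integral_cong_AE, use lim in eventually_elim)
    fix x assume "(\<lambda>n. s n x) \<longlonglongrightarrow> f x"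
    then have "(\<lambda>n. ennreal ((cmod (s n x))\<^sup>2)) \<longlonglongrightarrow> ennreal ((cmod (f x))\<^sup>2)"
      by (intro tendsto_intros)
    then show "ennreal ((cmod (f x))\<^sup>2) = liminf (\<lambda>n. ennreal ((cmod (s n x))\<^sup>2))"
      by (intro lim_imp_Liminf[symmetric]) auto
  qed
  also have "\<dots> \<le> liminf (\<lambda>n. (\<integral>\<^sup>+x. ennreal ((cmod (s n x))\<^sup>2) \<partial>lborel))"
    by (rule nn_integral_liminf) measurable
  also have "\<dots> = liminf (\<lambda>n. ennreal ((L2_norm (s n))\<^sup>2))"
    by (simp add: L2_nn_integral s)
  also have "\<dots> \<le> liminf (\<lambda>n::nat. ennreal (C\<^sup>2))"
    by (rule Liminf_mono, use le in eventually_elim) (auto intro!: ennreal_leI power_mono)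
  also have "\<dots> = ennreal (C\<^sup>2)" by (simp add: Liminf_const)
  finally show "f \<in> L2" "L2_norm f \<le> C"
    using L2_nn_integralI[of f C] \<open>0 \<le> C\<close> by auto
qed

lemma L2_dominated_convergence:
  assumes [measurable]: "\<And>n::nat. s n \<in> borel_measurable borel" "f \<in> borel_measurable borel"
    and w: "w \<in> L2"
    and le: "\<And>n. AE x in lborel. cmod (s n x - f x) \<le> cmod (w x)"
    and lim: "AE x in lborel. (\<lambda>n. s n x) \<longlonglongrightarrow> f x"
  shows "(\<lambda>n. L2_norm (\<lambda>x. s n x - f x)) \<longlonglongrightarrow> 0"
proof -
  have [measurable]: "w \<in> borel_measurable borel" using w by (rule L2_measurable)
  have "(\<lambda>n. LINT x|lborel. (cmod (s n x - f x))\<^sup>2) \<longlonglongrightarrow> (LINT (x::real)|lborel. (0::real))"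
  proof (rule integral_dominated_convergence[of _ _ _ "\<lambda>x. (cmod (w x))\<^sup>2"])
    show "AE x in lborel. (\<lambda>n. (cmod (s n x - f x))\<^sup>2) \<longlonglongrightarrow> 0"
      using lim
    proof eventually_elim
      fix x assume "(\<lambda>n. s n x) \<longlonglongrightarrow> f x"
      then have "(\<lambda>n. (cmod (s n x - f x))\<^sup>2) \<longlonglongrightarrow> (cmod (f x - f x))\<^sup>2"
        by (intro tendsto_intros)
      then show "(\<lambda>n. (cmod (s n x - f x))\<^sup>2) \<longlonglongrightarrow> 0" by simp
    qed
    show "AE x in lborel. norm ((cmod (s n x - f x))\<^sup>2) \<le> (cmod (w x))\<^sup>2" for n
      using le[of n] by eventually_elim (auto intro!: power_mono)
  qed (use L2_integrable[OF w] in auto)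
  then have "(\<lambda>n. sqrt (LINT x|lborel. (cmod (s n x - f x))\<^sup>2)) \<longlonglongrightarrow> sqrt 0"
    by (intro tendsto_intros) simp
  then show ?thesis by (simp add: L2_norm_def)
qed

text \<open>By Cauchy-Schwarz this weight converts weighted L2 bounds into L1 bounds at the price of
  sqrt pi.\<close>

lemma cauchy_weight_L2:
  "(\<lambda>x. complex_of_real (1 / sqrt (1 + x\<^sup>2))) \<in> L2"
  "L2_norm (\<lambda>x. complex_of_real (1 / sqrt (1 + x\<^sup>2))) = sqrt pi"
proof -
  have eq: "(cmod (complex_of_real (1 / sqrt (1 + x\<^sup>2))))\<^sup>2 = 1 / (1 + x\<^sup>2)" for x :: real
    by (simp add: norm_divide power_divide)
  have int: "integrable lborel (\<lambda>x::real. 1 / (1 + x\<^sup>2))"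
    using integrable_inverse_1_plus_square
    by (simp add: set_integrable_def einterval_def inverse_eq_divide)
  have "(LINT x|lborel. 1 / (1 + x\<^sup>2)) = (pi::real)"
    using LBINT_inverse_1_plus_square
    by (simp add: interval_lebesgue_integral_def set_lebesgue_integral_def einterval_def inverse_eq_divide)
  then show "L2_norm (\<lambda>x. complex_of_real (1 / sqrt (1 + x\<^sup>2))) = sqrt pi"
    unfolding L2_norm_def eq by simp
  show "(\<lambda>x. complex_of_real (1 / sqrt (1 + x\<^sup>2))) \<in> L2"
    unfolding L2_def mem_Collect_eq eq using int by auto
qed

text \<open>Multiplying by a fixed square integrable weight turns an \<open>L2\<close>-Cauchy sequence into an
  $L^1$-Cauchy sequence, for which an almost everywhere convergent subsequence is available.\<close>

lemma L2_complete:
  assumes s: "\<And>n::nat. s n \<in> L2"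
    and cauchy: "\<And>e. 0 < e \<Longrightarrow> \<exists>N. \<forall>i\<ge>N. \<forall>j\<ge>N. L2_norm (\<lambda>x. s i x - s j x) < e"
  obtains g where "g \<in> L2" "L2_tendsto s g sequentially"
proof -
  have m[measurable]: "\<And>n. s n \<in> borel_measurable borel" using s by (auto intro: L2_measurable)
  define w where "w = (\<lambda>x::real. complex_of_real (1 / sqrt (1 + x\<^sup>2)))"
  have w: "w \<in> L2" "L2_norm w = sqrt pi" using cauchy_weight_L2 by (auto simp: w_def)
  have w0: "w x \<noteq> 0" for x
    using add_pos_nonneg[of 1 "x\<^sup>2"] by (simp add: w_def)
  obtain r where r: "strict_mono r" "AE x in lborel. Cauchy (\<lambda>i. s (r i) x * w x)"
  proof (rule cauchy_L1_AE_cauchy_subseq[of lborel "\<lambda>n x. s n x * w x"])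
    show "integrable lborel (\<lambda>x. s n x * w x)" for n by (rule L2_Cauchy_Schwarz[OF s w(1)])
    fix e :: real assume "0 < e"
    then obtain N where N: "\<forall>i\<ge>N. \<forall>j\<ge>N. L2_norm (\<lambda>x. s i x - s j x) < e / sqrt pi"
      using cauchy[of "e / sqrt pi"] by auto
    show "\<exists>N. \<forall>i\<ge>N. \<forall>j\<ge>N. (LINT x|lborel. norm (s i x * w x - s j x * w x)) < e"
    proof (intro exI[of _ N] allI impI)
      fix i j assume "N \<le> i" "N \<le> j"
      have "(LINT x|lborel. norm (s i x * w x - s j x * w x))
          = (LINT x|lborel. cmod (s i x - s j x) * cmod (w x))"
        by (simp add: norm_mult[symmetric] left_diff_distrib)
      also have "\<dots> \<le> L2_norm (\<lambda>x. s i x - s j x) * sqrt pi"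
        using L2_Cauchy_Schwarz(2)[OF L2_diff[OF s s] w(1), of i j] w by simp
      also have "\<dots> < e" using N \<open>N \<le> i\<close> \<open>N \<le> j\<close> by (auto simp: pos_less_divide_eq)
      finally show "(LINT x|lborel. norm (s i x * w x - s j x * w x)) < e" .
    qed
  qed blast
  define g where "g = (\<lambda>x. lim (\<lambda>i. s (r i) x))"
  have [measurable]: "g \<in> borel_measurable borel"
    unfolding g_def by measurable
  have lim: "AE x in lborel. (\<lambda>i. s (r i) x) \<longlonglongrightarrow> g x"
    using r(2)
  proof eventually_elim
    fix x assume "Cauchy (\<lambda>i. s (r i) x * w x)"
    then have "convergent (\<lambda>i. s (r i) x * w x)" by (simp add: Cauchy_convergent_iff)
    then obtain l where "(\<lambda>i. s (r i) x * w x) \<longlonglongrightarrow> l" by (auto simp: convergent_def)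
    then have "(\<lambda>i. s (r i) x * w x / w x) \<longlonglongrightarrow> l / w x"
      using w0 by (intro tendsto_intros) auto
    then have "(\<lambda>i. s (r i) x) \<longlonglongrightarrow> l / w x" using w0 by simp
    then show "(\<lambda>i. s (r i) x) \<longlonglongrightarrow> g x" by (simp add: g_def limI)
  qed
  \<comment> \<open>With m fixed, the Cauchy bound survives the limit along the subsequence by
    Fatou. Hence the whole sequence converges to g, not only the subsequence.\<close>
  have bound: "\<exists>N. \<forall>m\<ge>N. (\<lambda>x. g x - s m x) \<in> L2 \<and> L2_norm (\<lambda>x. g x - s m x) \<le> e" if "0 < e" for e
  proof -
    obtain N where N: "\<And>i j. i \<ge> N \<Longrightarrow> j \<ge> N \<Longrightarrow> L2_norm (\<lambda>x. s i x - s j x) < e"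
      using cauchy[OF \<open>0 < e\<close>] by blast
    have "(\<lambda>x. g x - s m x) \<in> L2 \<and> L2_norm (\<lambda>x. g x - s m x) \<le> e" if "m \<ge> N" for m
    proof -
      have ev: "eventually (\<lambda>n. L2_norm (\<lambda>x. s (r n) x - s m x) \<le> e) sequentially"
        using eventually_ge_at_top[of N]
      proof eventually_elim
        case (elim n)
        then have "N \<le> r n" using seq_suble[OF r(1), of n] by linarith
        then show ?case using N[of "r n" m] \<open>m \<ge> N\<close> by simp
      qed
      have lim': "AE x in lborel. (\<lambda>n. s (r n) x - s m x) \<longlonglongrightarrow> g x - s m x"
        using lim by eventually_elim (intro tendsto_intros)
      show ?thesis
        using L2_fatou[OF L2_diff[OF s s] _ _ ev lim'] \<open>0 < e\<close> by auto
    qed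
    then show ?thesis by blast
  qed
  obtain N where "(\<lambda>x. g x - s N x) \<in> L2" using bound[of 1] by auto
  then have "(\<lambda>x. (g x - s N x) + s N x) \<in> L2" by (intro L2_add s)
  then have g: "g \<in> L2" by simp
  have "(\<lambda>n. L2_norm (\<lambda>x. s n x - g x)) \<longlonglongrightarrow> 0"
  proof (rule LIMSEQ_I)
    fix e :: real assume "0 < e"
    then obtain N where N: "\<And>m. m\<ge>N \<Longrightarrow> L2_norm (\<lambda>x. g x - s m x) \<le> e/2"
      using bound[of "e/2"] by auto
    have "norm (L2_norm (\<lambda>x. s m x - g x) - 0) < e" if "m \<ge> N" for m
      using N[OF that] \<open>0 < e\<close> L2_norm_minus_commute[of g "s m"] by simp
    then show "\<exists>N. \<forall>m\<ge>N. norm (L2_norm (\<lambda>x. s m x - g x) - 0) < e" by blast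
  qed
  then have "L2_tendsto s g sequentially" using g s by (auto simp: L2_tendsto_def)
  with g show ?thesis by (rule that)
qed

lemma L2_tendsto_unique:
  assumes "F \<noteq> bot" "L2_tendsto s f F" "L2_tendsto s g F"
    and fg: "f \<in> L2" "g \<in> L2"
  shows "AE x in lborel. f x = g x"
proof -
  have "L2_norm (\<lambda>x. f x - g x) \<le> 0"
  proof (rule tendsto_lowerbound[OF _ _ \<open>F \<noteq> bot\<close>])
    show "((\<lambda>i. L2_norm (\<lambda>x. s i x - f x) + L2_norm (\<lambda>x. s i x - g x)) \<longlongrightarrow> 0) F"
      using tendsto_add[of "\<lambda>i. L2_norm (\<lambda>x. s i x - f x)" 0 F "\<lambda>i. L2_norm (\<lambda>x. s i x - g x)" 0]
        assms(2,3) by (simp add: L2_tendsto_def)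
    show "eventually (\<lambda>i. L2_norm (\<lambda>x. f x - g x)
        \<le> L2_norm (\<lambda>x. s i x - f x) + L2_norm (\<lambda>x. s i x - g x)) F"
      using conjunct1[OF assms(2)[unfolded L2_tendsto_def]] conjunct1[OF assms(3)[unfolded L2_tendsto_def]]
    proof eventually_elim
      case (elim i)
      then show ?case using L2_triangle_diff[of "\<lambda>x. s i x - g x" "\<lambda>x. s i x - f x"] by simp
    qed
  qed
  then have "L2_norm (\<lambda>x. f x - g x) = 0" using L2_norm_nonneg[of "\<lambda>x. f x - g x"] by linarith
  then show ?thesis using L2_norm_eq_0D[OF L2_diff[OF fg]] by simp
qed

lemma L2_norm_tendsto:
  assumes "L2_tendsto s f F" "f \<in> L2"
  shows "((\<lambda>i. L2_norm (s i)) \<longlongrightarrow> L2_norm f) F"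
proof -
  have "((\<lambda>i. L2_norm (s i) - L2_norm f) \<longlongrightarrow> 0) F"
  proof (rule Lim_null_comparison)
    show "((\<lambda>i. L2_norm (\<lambda>x. s i x - f x)) \<longlongrightarrow> 0) F" using assms by (simp add: L2_tendsto_def)
    have "eventually (\<lambda>i. (\<lambda>x. s i x - f x) \<in> L2) F" using assms by (simp add: L2_tendsto_def)
    then show "\<forall>\<^sub>F i in F. norm (L2_norm (s i) - L2_norm f) \<le> L2_norm (\<lambda>x. s i x - f x)"
    proof eventually_elim
      case (elim i)
      have si: "s i \<in> L2" using L2_add[OF elim assms(2)] by simp
      show ?case
        using L2_norm_le_diff[OF si assms(2)] L2_norm_le_diff[OF assms(2) si]
          L2_norm_minus_commute[of f "s i"] by simp
    qed
  qed
  then show ?thesis by (simp add: LIM_zero_iff)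
qed

section \<open>Translations, reflections and affine images of null sets\<close>

lemma L2_affine:
  assumes f: "f \<in> L2" and c: "\<bar>c\<bar> = 1"
  shows "(\<lambda>x. f (t + c * x)) \<in> L2" "L2_norm (\<lambda>x. f (t + c * x)) = L2_norm f"
proof -
  have "f \<in> borel_measurable borel" using f by (rule L2_measurable)
  then show "(\<lambda>x. f (t + c * x)) \<in> L2"
    using lborel_integrable_real_affine[OF L2_integrable[OF f], of c t] c
    by (auto simp: L2_def)
  show "L2_norm (\<lambda>x. f (t + c * x)) = L2_norm f"
    using lborel_integral_real_affine[of c "\<lambda>x. (cmod (f x))\<^sup>2" t] c
    unfolding L2_norm_def by auto
qed

lemma L2_shift:
  assumes "f \<in> L2"
  shows "(\<lambda>x. f (x + h)) \<in> L2" "L2_norm (\<lambda>x. f (x + h)) = L2_norm f"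
  using L2_affine[OF assms, of 1 h] by (auto simp: add.commute)

lemma L2_reflect:
  assumes "f \<in> L2"
  shows "(\<lambda>x. f (- x)) \<in> L2" "L2_norm (\<lambda>x. f (- x)) = L2_norm f"
  using L2_affine[OF assms, of "-1" 0] by auto

text \<open>Lebesgue measure is |c| times its own image under x \<mapsto> t + c * x, so affine maps
  preserve null sets.\<close>

lemma AE_lborel_affine:
  fixes P :: "real \<Rightarrow> bool"
  assumes "AE x in lborel. P x" "c \<noteq> 0"
  shows "AE x in lborel. P (t + c * x)"
proof -
  have "AE x in distr lborel borel (\<lambda>x. t + c * x). P x"
  proof -
    have "AE x in density (distr lborel borel (\<lambda>x. t + c * x)) (\<lambda>_. ennreal \<bar>c\<bar>). P x"
      using assms(1) by (subst lborel_real_affine[OF assms(2), of t, symmetric])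
    then show ?thesis
      using assms(2) by (subst (asm) AE_density) auto
  qed
  then show ?thesis
    by (rule AE_distrD[rotated]) simp
qed

text \<open>Cauchy-Schwarz for \<open>sqrt (1 + x^2) * f\<close> against its reciprocal weight. One
  weight x thus makes the transform an absolutely convergent integral, defined at every
  frequency.\<close>

lemma weighted_imp_integrable:
  assumes f: "f \<in> L2" and xf: "(\<lambda>x. complex_of_real x * f x) \<in> L2"
  shows "integrable lborel f"
    "(LINT x|lborel. cmod (f x)) \<le> sqrt pi * (L2_norm f + L2_norm (\<lambda>x. complex_of_real x * f x))"
proof -
  have [measurable]: "f \<in> borel_measurable borel" using f by (rule L2_measurable)
  define g where "g = (\<lambda>x. complex_of_real (sqrt (1 + x\<^sup>2)) * f x)"
  define w where "w = (\<lambda>x::real. complex_of_real (1 / sqrt (1 + x\<^sup>2)))"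
  have w: "w \<in> L2" "L2_norm w = sqrt pi" using cauchy_weight_L2 by (auto simp: w_def)
  define h where "h = (\<lambda>x. complex_of_real (cmod (f x)) + complex_of_real (cmod (of_real x * f x)))"
  have n1: "(\<lambda>x. complex_of_real (cmod (k x))) \<in> L2" "L2_norm (\<lambda>x. complex_of_real (cmod (k x))) = L2_norm k"
    if "k \<in> L2" for k
    using that by (auto simp: L2_def L2_norm_def)
  have h: "h \<in> L2" unfolding h_def using n1 f xf by auto
  have hn: "L2_norm h \<le> L2_norm f + L2_norm (\<lambda>x. complex_of_real x * f x)"
    unfolding h_def using L2_triangle[OF n1(1)[OF f] n1(1)[OF xf]] n1(2)[OF f] n1(2)[OF xf] by simp
  have [measurable]: "g \<in> borel_measurable borel" unfolding g_def by measurable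
  have "sqrt (1 + x\<^sup>2) \<le> 1 + \<bar>x\<bar>" for x :: real
    by (rule real_le_lsqrt) (auto simp: power2_eq_square algebra_simps)
  then have "sqrt (1 + x\<^sup>2) * cmod (f x) \<le> (1 + \<bar>x\<bar>) * cmod (f x)" for x
    by (intro mult_right_mono) auto
  then have le: "cmod (g x) \<le> 1 * cmod (h x)" for x
    unfolding g_def h_def by (simp add: norm_mult algebra_simps flip: of_real_add of_real_mult)
  have g: "g \<in> L2" "L2_norm g \<le> L2_norm h"
    using L2_dominated[OF h, of g 1] le by auto
  have eq: "w x * g x = f x" for x
    using add_pos_nonneg[of 1 "x\<^sup>2"] by (simp add: w_def g_def)
  show "integrable lborel f" using L2_Cauchy_Schwarz(1)[OF w(1) g(1)] by (simp add: eq)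
  have "(LINT x|lborel. cmod (f x)) = (LINT x|lborel. cmod (w x) * cmod (g x))"
    by (simp add: eq norm_mult[symmetric])
  also have "\<dots> \<le> sqrt pi * L2_norm g" using L2_Cauchy_Schwarz(2)[OF w(1) g(1)] w by simp
  also have "\<dots> \<le> sqrt pi * (L2_norm f + L2_norm (\<lambda>x. complex_of_real x * f x))"
    using g hn by (intro mult_left_mono) auto
  finally show "(LINT x|lborel. cmod (f x)) \<le> sqrt pi * (L2_norm f + L2_norm (\<lambda>x. complex_of_real x * f x))" .
qed

subsection \<open>The Fourier transform of integrable functions\<close>

lemma exp_minus_ii_eq_cis: "exp (- \<i> * complex_of_real a) = cis (- a)"
  by (simp add: cis_conv_exp)

lemma borel_measurable_cis [measurable (raw)]:
  "f \<in> borel_measurable M \<Longrightarrow> (\<lambda>x. cis (f x)) \<in> borel_measurable M"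
  by (rule borel_measurable_continuous_on[OF continuous_on_cis[OF continuous_on_id]])

lemma fourier_eq_cis:
  "fourier f \<xi> = complex_of_real (1 / sqrt (2 * pi)) * (LINT x|lborel. cis (- (x * \<xi>)) * f x)"
  by (simp only: fourier_def exp_minus_ii_eq_cis)

lemma integrable_cis_mult:
  assumes "integrable lborel f" and [measurable]: "g \<in> borel_measurable borel"
  shows "integrable lborel (\<lambda>x::real. cis (g x) * f x)"
  using assms(1) by (rule Bochner_Integration.integrable_bound) (use assms in \<open>auto simp: norm_mult\<close>)

lemma fourier_measurable [measurable]:
  assumes [measurable]: "f \<in> borel_measurable borel"
  shows "fourier f \<in> borel_measurable borel"
  unfolding fourier_eq_cis[abs_def] by measurable

lemma fourier_norm_le:
  assumes "integrable lborel f"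
  shows "cmod (fourier f \<xi>) \<le> (1 / sqrt (2 * pi)) * (LINT x|lborel. cmod (f x))"
proof -
  have "cmod (LINT x|lborel. cis (- (x * \<xi>)) * f x) \<le> (LINT x|lborel. cmod (f x))"
    using integral_norm_bound[of lborel "\<lambda>x. cis (- (x * \<xi>)) * f x"] by (simp add: norm_mult)
  then show ?thesis
    unfolding fourier_eq_cis norm_mult by (auto simp: norm_divide divide_right_mono)
qed

lemma fourier_cong_AE:
  assumes [measurable]: "f \<in> borel_measurable borel" "g \<in> borel_measurable borel"
    and "AE x in lborel. f x = g x"
  shows "fourier f = fourier g"
proof
  fix \<xi>
  have "(LINT x|lborel. cis (- (x * \<xi>)) * f x) = (LINT x|lborel. cis (- (x * \<xi>)) * g x)"
    using assms(3) by (intro integral_cong_AE) auto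
  then show "fourier f \<xi> = fourier g \<xi>" by (simp add: fourier_eq_cis)
qed

lemma fourier_add:
  assumes "integrable lborel f" "integrable lborel g"
  shows "fourier (\<lambda>x. f x + g x) \<xi> = fourier f \<xi> + fourier g \<xi>"
  using integrable_cis_mult[OF assms(1)] integrable_cis_mult[OF assms(2)]
  by (simp add: fourier_eq_cis distrib_left)

lemma fourier_diff:
  assumes "integrable lborel f" "integrable lborel g"
  shows "fourier (\<lambda>x. f x - g x) \<xi> = fourier f \<xi> - fourier g \<xi>"
  using integrable_cis_mult[OF assms(1)] integrable_cis_mult[OF assms(2)]
  by (simp add: fourier_eq_cis right_diff_distrib)

lemma fourier_cmult: "fourier (\<lambda>x. c * f x) \<xi> = c * fourier f \<xi>"
  by (simp add: fourier_eq_cis mult.left_commute)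

lemma fourier_cis_mult: "fourier (\<lambda>x. cis (h * x) * f x) \<xi> = fourier f (\<xi> - h)"
proof -
  have "cis (- (x * \<xi>)) * (cis (h * x) * f x) = cis (- (x * (\<xi> - h))) * f x" for x
    unfolding mult.assoc[symmetric] cis_mult by (simp add: right_diff_distrib mult.commute)
  then show ?thesis by (simp only: fourier_eq_cis)
qed

lemma fourier_reflect: "fourier (\<lambda>x. f (- x)) \<xi> = fourier f (- \<xi>)"
  using lborel_integral_real_affine[of "-1" "\<lambda>x. cis (x * \<xi>) * f x" 0]
  by (simp add: fourier_eq_cis)

lemma fourier_cnj: "fourier (\<lambda>x. cnj (f x)) \<xi> = cnj (fourier f (- \<xi>))"
proof -
  have "cnj (LINT x|lborel. cis (x * \<xi>) * f x) = (LINT x|lborel. cnj (cis (x * \<xi>) * f x))"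
    by (rule Bochner_Integration.integral_cnj[symmetric])
  then show ?thesis by (simp add: fourier_eq_cis cis_cnj)
qed

lemma integrable_kernel:
  fixes f g :: "real \<Rightarrow> complex"
  assumes f: "integrable lborel f" and g: "integrable lborel g"
    and k[measurable]: "(\<lambda>(x, y). k x y) \<in> borel_measurable (borel \<Otimes>\<^sub>M borel)"
    and bound: "\<And>x y. cmod (k x y) \<le> 1"
  shows "integrable (lborel \<Otimes>\<^sub>M lborel) (\<lambda>(x::real, y::real). k x y * f x * g y)"
proof (rule Bochner_Integration.integrable_bound)
  have [measurable]: "f \<in> borel_measurable borel" "g \<in> borel_measurable borel"
    using f g by auto
  show "integrable (lborel \<Otimes>\<^sub>M lborel) (\<lambda>(x, y). f x * g y)"
  proof (rule lborel_pair.Fubini_integrable)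
    show "integrable lborel (\<lambda>x. LINT y|lborel. norm (case (x, y) of (x, y) \<Rightarrow> f x * g y))"
      using f by (simp add: norm_mult)
    show "AE x in lborel. integrable lborel (\<lambda>y. case (x, y) of (x, y) \<Rightarrow> f x * g y)"
      using g by simp
  qed measurable
  show "(\<lambda>(x, y). k x y * f x * g y) \<in> borel_measurable (lborel \<Otimes>\<^sub>M lborel)"
    by measurable
  show "AE xy in lborel \<Otimes>\<^sub>M lborel. norm (case xy of (x, y) \<Rightarrow> k x y * f x * g y)
      \<le> norm (case xy of (x, y) \<Rightarrow> f x * g y)"
    using bound by (auto simp: norm_mult mult.assoc mult_left_le_one_le)
qed

text \<open>Fubini for the bounded kernel. With Gaussians as one factor, this symmetry replaces a
  direct treatment of the inversion integral, which need not converge.\<close>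

lemma fourier_multiplication_formula:
  assumes f: "integrable lborel f" and g: "integrable lborel g"
  shows "(LINT \<xi>|lborel. fourier f \<xi> * g \<xi>) = (LINT x|lborel. f x * fourier g x)"
proof -
  let ?c = "complex_of_real (1 / sqrt (2 * pi))"
  have int: "integrable (lborel \<Otimes>\<^sub>M lborel) (\<lambda>(x, y). cis (- (x * y)) * f x * g y)"
    using f g by (rule integrable_kernel) auto
  have "(LINT \<xi>|lborel. fourier f \<xi> * g \<xi>)
      = ?c * (LINT \<xi>|lborel. LINT x|lborel. cis (- (x * \<xi>)) * f x * g \<xi>)"
  proof -
    have "fourier f \<xi> * g \<xi> = ?c * (LINT x|lborel. cis (- (x * \<xi>)) * f x * g \<xi>)" for \<xi>
      unfolding fourier_eq_cis integral_mult_left_zero by simp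
    then show ?thesis by simp
  qed
  also have "\<dots> = ?c * (LINT x|lborel. LINT \<xi>|lborel. cis (- (x * \<xi>)) * f x * g \<xi>)"
    using lborel_pair.Fubini_integral[OF int] by simp
  also have "(\<lambda>x. LINT \<xi>|lborel. cis (- (x * \<xi>)) * f x * g \<xi>)
      = (\<lambda>x. f x * (LINT \<xi>|lborel. cis (- (\<xi> * x)) * g \<xi>))"
  proof
    fix x
    have "(\<lambda>\<xi>. cis (- (x * \<xi>)) * f x * g \<xi>) = (\<lambda>\<xi>. f x * (cis (- (\<xi> * x)) * g \<xi>))"
      by (auto simp: ac_simps)
    then show "(LINT \<xi>|lborel. cis (- (x * \<xi>)) * f x * g \<xi>)
        = f x * (LINT \<xi>|lborel. cis (- (\<xi> * x)) * g \<xi>)" by simp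
  qed
  also have "?c * (LINT x|lborel. f x * (LINT \<xi>|lborel. cis (- (\<xi> * x)) * g \<xi>))
      = (LINT x|lborel. f x * fourier g x)"
    by (simp add: fourier_eq_cis mult.left_commute flip: integral_mult_right_zero)
  finally show ?thesis .
qed

subsection \<open>Gaussians\<close>

lemma integrable_gaussian_moment:
  assumes "0 < a"
  shows "integrable lborel (\<lambda>x::real. exp (- (a * x\<^sup>2 / 2)) * x ^ k)"
proof -
  have *: "exp (- (a * x\<^sup>2 / 2)) * x ^ k
      = (sqrt (2 * pi) / sqrt a) * (normal_density 0 (1 / sqrt a) x * (x - 0) ^ k)" for x
    using assms by (simp add: normal_density_def power_divide real_sqrt_divide real_sqrt_mult field_simps)
  show ?thesis
    unfolding * using assms by (intro integrable_mult_right integrable_normal_moment) simp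
qed

text \<open>The complex quotient has the shape used in \<open>has_L2_time_derivative\<close>, so
  pairings of an L2 derivative with a fixed function can be differentiated directly.\<close>

lemma has_vector_derivative_iff_quotient:
  fixes f :: "real \<Rightarrow> complex"
  shows "(f has_vector_derivative D) (at t)
    \<longleftrightarrow> ((\<lambda>h. (f (t + h) - f t) / complex_of_real h) \<longlongrightarrow> D) (at 0)"
proof -
  have "cmod (f (t + h) - f t - h *\<^sub>R D) / norm h
        = cmod ((f (t + h) - f t) / complex_of_real h - D)" if "h \<noteq> 0" for h
  proof -
    have "(f (t + h) - f t - h *\<^sub>R D) = complex_of_real h * ((f (t + h) - f t) / complex_of_real h - D)"
      using that by (simp add: field_simps scaleR_conv_of_real)
    then show ?thesis using that by (simp add: norm_mult)
  qed
  then have *: "\<forall>\<^sub>F h in at 0. cmod (f (t + h) - f t - h *\<^sub>R D) / norm h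
        = cmod ((f (t + h) - f t) / complex_of_real h - D)"
    by (simp add: eventually_at_filter)
  have "(f has_vector_derivative D) (at t)
    \<longleftrightarrow> ((\<lambda>h. cmod (f (t + h) - f t - h *\<^sub>R D) / norm h) \<longlongrightarrow> 0) (at 0)"
    by (simp add: has_vector_derivative_def has_derivative_at bounded_linear_scaleR_left)
  also have "\<dots> \<longleftrightarrow> ((\<lambda>h. cmod ((f (t + h) - f t) / complex_of_real h - D)) \<longlongrightarrow> 0) (at 0)"
    by (rule tendsto_cong[OF *])
  also have "\<dots> \<longleftrightarrow> ((\<lambda>h. (f (t + h) - f t) / complex_of_real h - D) \<longlongrightarrow> 0) (at 0)"
    by (rule tendsto_norm_zero_iff)
  also have "\<dots> \<longleftrightarrow> ((\<lambda>h. (f (t + h) - f t) / complex_of_real h) \<longlongrightarrow> D) (at 0)"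
    by (rule LIM_zero_iff)
  finally show ?thesis .
qed

text \<open>Dominated convergence for the difference quotients; the Lipschitz majorant w dominates
  all of them at once.\<close>

lemma has_vector_derivative_integral:
  fixes F :: "real \<Rightarrow> real \<Rightarrow> complex"
  assumes int: "\<And>s. integrable lborel (F s)" and [measurable]: "F' \<in> borel_measurable borel"
    and w: "integrable lborel w"
    and lip: "\<And>h x. cmod (F (t + h) x - F t x) \<le> \<bar>h\<bar> * w x"
    and deriv: "\<And>x. ((\<lambda>h. (F (t + h) x - F t x) / complex_of_real h) \<longlongrightarrow> F' x) (at 0)"
  shows "((\<lambda>s. LINT x|lborel. F s x) has_vector_derivative (LINT x|lborel. F' x)) (at t)"
  unfolding has_vector_derivative_iff_quotient
proof -
  have [measurable]: "\<And>s. F s \<in> borel_measurable borel" using int by auto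
  show "((\<lambda>h. ((LINT x|lborel. F (t + h) x) - (LINT x|lborel. F t x)) / complex_of_real h)
      \<longlongrightarrow> (LINT x|lborel. F' x)) (at 0)"
    unfolding tendsto_at_iff_sequentially
  proof (intro allI impI, unfold comp_def)
    fix X :: "nat \<Rightarrow> real" assume X: "\<forall>i. X i \<in> UNIV - {0}" "X \<longlonglongrightarrow> 0"
    have "(\<lambda>i. LINT x|lborel. (F (t + X i) x - F t x) / complex_of_real (X i)) \<longlonglongrightarrow> (LINT x|lborel. F' x)"
    proof (rule integral_dominated_convergence[where w=w])
      show "AE x in lborel. (\<lambda>i. (F (t + X i) x - F t x) / complex_of_real (X i)) \<longlonglongrightarrow> F' x"
        using deriv X unfolding tendsto_at_iff_sequentially comp_def by auto
      show "AE x in lborel. norm ((F (t + X i) x - F t x) / complex_of_real (X i)) \<le> w x" for i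
        using lip[of "X i"] X(1) by (auto simp: norm_divide divide_le_eq mult.commute)
    qed (use w in auto)
    then show "(\<lambda>i. ((LINT x|lborel. F (t + X i) x) - (LINT x|lborel. F t x)) / complex_of_real (X i))
        \<longlonglongrightarrow> (LINT x|lborel. F' x)"
      by (simp add: int)
  qed
qed

lemma integral_derivative_eq_0:
  fixes F F' :: "real \<Rightarrow> complex"
  assumes F: "\<And>x. (F has_vector_derivative F' x) (at x)"
    and cont: "\<And>x. isCont F' x" and int: "integrable lborel F'"
    and "(F \<longlongrightarrow> 0) at_top" "(F \<longlongrightarrow> 0) at_bot"
  shows "(LINT x|lborel. F' x) = 0"
proof -
  have "(LBINT x=-\<infinity>..\<infinity>. F' x) = 0 - 0"
    by (rule interval_integral_FTC_integrable[where F=F])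
      (use assms in \<open>auto simp: ereal_tendsto_simps set_integrable_def einterval_def\<close>)
  then show ?thesis
    by (simp add: interval_lebesgue_integral_def set_lebesgue_integral_def einterval_def)
qed

text \<open>Rescaling by 1 / sqrt a reduces the integral to the characteristic function of the
  standard normal law.\<close>

lemma real_gaussian_transform:
  assumes "0 < a"
  shows "(LINT x|lborel. cis (- (x * \<xi>)) * complex_of_real (exp (- (a * x\<^sup>2 / 2))))
      = complex_of_real (sqrt (2 * pi) / sqrt a * exp (- (\<xi>\<^sup>2 / (2 * a))))"
proof -
  let ?b = "1 / sqrt a"
  have "(LINT x|lborel. cis (- (x * \<xi>)) * complex_of_real (exp (- (a * x\<^sup>2 / 2))))
    = \<bar>?b\<bar> *\<^sub>R (LINT x|lborel. cis (- ((0 + ?b * x) * \<xi>)) * complex_of_real (exp (- (a * (0 + ?b * x)\<^sup>2 / 2))))"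
    by (rule lborel_integral_real_affine) (use assms in auto)
  also have "\<dots> = ?b *\<^sub>R (LINT x|lborel. cis (- (x * (\<xi> / sqrt a))) * complex_of_real (exp (- (x\<^sup>2 / 2))))"
    using assms by (simp add: power_divide)
  also have "(LINT x|lborel. cis (- (x * (\<xi> / sqrt a))) * complex_of_real (exp (- (x\<^sup>2 / 2))))
      = sqrt (2 * pi) * char std_normal_distribution (- (\<xi> / sqrt a))"
  proof -
    have "char std_normal_distribution (- (\<xi> / sqrt a))
        = (LINT x|lborel. std_normal_density x *\<^sub>R cis (- (x * (\<xi> / sqrt a))))"
      unfolding char_def
      by (subst integral_density) (auto simp: cis_conv_exp mult_ac normal_density_nonneg)
    also have "\<dots> = (LINT x|lborel. complex_of_real (1 / sqrt (2 * pi)) *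
        (cis (- (x * (\<xi> / sqrt a))) * complex_of_real (exp (- (x\<^sup>2 / 2)))))"
      by (intro Bochner_Integration.integral_cong)
        (auto simp: std_normal_density_def scaleR_conv_of_real)
    also have "\<dots> = complex_of_real (1 / sqrt (2 * pi)) * (LINT x|lborel.
        (cis (- (x * (\<xi> / sqrt a))) * complex_of_real (exp (- (x\<^sup>2 / 2)))))"
      by (rule integral_mult_right_zero)
    finally show ?thesis by (simp del: of_real_mult flip: of_real_mult)
  qed
  also have "?b *\<^sub>R (sqrt (2 * pi) * char std_normal_distribution (- (\<xi> / sqrt a)))
     = complex_of_real (sqrt (2 * pi) / sqrt a * exp (- (\<xi>\<^sup>2 / (2 * a))))"
    using assms by (simp add: char_std_normal_distribution scaleR_conv_of_real power_divide mult.commute)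
  finally show ?thesis .
qed

text \<open>One complex parameter covers both the heat factor (z real) and the Schrodinger
  multiplier (z = it). The half in the exponent makes \<open>gauss 1\<close> its own Fourier
  transform.\<close>

definition gauss :: "complex \<Rightarrow> real \<Rightarrow> complex" where
  "gauss z x = exp (- (z * complex_of_real (x\<^sup>2) / 2))"

lemma norm_gauss: "cmod (gauss z x) = exp (- (Re z * x\<^sup>2 / 2))"
  by (simp add: gauss_def del: of_real_power)

lemma gauss_measurable [measurable (raw)]:
  "f \<in> borel_measurable M \<Longrightarrow> (\<lambda>x. gauss z (f x)) \<in> borel_measurable M"
  unfolding gauss_def
  by (rule borel_measurable_continuous_on[of "\<lambda>x. exp (- (z * complex_of_real (x\<^sup>2) / 2))"])
    (intro continuous_intros, auto)

lemma gauss_add: "gauss (z + w) x = gauss z x * gauss w x"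
  by (simp add: gauss_def exp_add[symmetric] algebra_simps add_divide_distrib)

lemma gauss_imaginary: "gauss (\<i> * complex_of_real s) x = cis (- (s * x\<^sup>2 / 2))"
  by (simp add: gauss_def cis_conv_exp mult.assoc)

lemma gauss_integrable_moment:
  assumes "0 < Re z"
  shows "integrable lborel (\<lambda>x. complex_of_real (x ^ k) * (cis (- (x * \<xi>)) * gauss z x))"
proof (rule Bochner_Integration.integrable_bound)
  show "integrable lborel (\<lambda>x. exp (- (Re z * x\<^sup>2 / 2)) * x ^ k)"
    by (rule integrable_gaussian_moment) fact
  show "AE x in lborel. norm (complex_of_real (x ^ k) * (cis (- (x * \<xi>)) * gauss z x))
      \<le> norm (exp (- (Re z * x\<^sup>2 / 2)) * x ^ k)"
    by (auto simp: norm_mult norm_gauss norm_power abs_mult power_abs)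
qed measurable

lemma gauss_integrable:
  assumes "0 < Re z"
  shows "integrable lborel (\<lambda>x. cis (- (x * \<xi>)) * gauss z x)" "integrable lborel (gauss z)"
  using gauss_integrable_moment[OF assms, of 0] gauss_integrable_moment[OF assms, of 0 0] by auto

text \<open>Differentiating the transform in the imaginary part of z brings down a factor x^2.
  Expressing that moment through the transform itself yields a closed differential equation in the
  parameter.\<close>

lemma gauss_parts:
  assumes "0 < Re z"
  shows "(LINT x|lborel. complex_of_real (x\<^sup>2) * (cis (- (x * \<xi>)) * gauss z x))
    = (1 / z - complex_of_real (\<xi>\<^sup>2) / z\<^sup>2) * (LINT x|lborel. cis (- (x * \<xi>)) * gauss z x)"
proof -
  have z: "z \<noteq> 0" using assms by auto
  let ?E = "\<lambda>x. exp (- \<i> * complex_of_real (x * \<xi>) - z * complex_of_real (x\<^sup>2) / 2)"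
  have E: "cis (- (x * \<xi>)) * gauss z x = ?E x" for x
    by (simp add: gauss_def cis_conv_exp exp_add[symmetric] algebra_simps)
  \<comment> \<open>In the derivative of (a + b x) E the x^2 coefficient -b z should be -1 and the
    linear coefficient -a z - i \<xi> b should vanish; this determines b and then a.\<close>
  define b where "b = 1 / z"
  define a where "a = - (\<i> * \<xi>) / z\<^sup>2"
  define F where "F = (\<lambda>x::real. (a + b * x) * ?E x)"
  define F' where "F' = (\<lambda>x::real. ((1 / z - complex_of_real (\<xi>\<^sup>2) / z\<^sup>2) - complex_of_real (x\<^sup>2)) * ?E x)"
  have "(F has_vector_derivative F' x) (at x)" for x
  proof -
    let ?G = "\<lambda>w. (a + b * w) * exp (- \<i> * (w * complex_of_real \<xi>) - z * w\<^sup>2 / 2)"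
    have *: "(?G has_field_derivative
        (b + (a + b * complex_of_real x) * (- \<i> * complex_of_real \<xi> - z * complex_of_real x)) * ?E x)
        (at (complex_of_real x))"
      by (auto intro!: derivative_eq_intros simp: algebra_simps power2_eq_square)
    have "b + (a + b * complex_of_real x) * (- \<i> * complex_of_real \<xi> - z * complex_of_real x)
      = (1 / z - complex_of_real (\<xi>\<^sup>2) / z\<^sup>2) - complex_of_real (x\<^sup>2)"
      using z unfolding a_def b_def by (simp add: field_simps power2_eq_square)
    then show ?thesis
      using has_vector_derivative_real_field[OF *] by (simp add: F_def F'_def o_def)
  qed
  moreover have "isCont F' x" for x unfolding F'_def by (intro continuous_intros) auto
  moreover have int: "integrable lborel (\<lambda>x. complex_of_real (x\<^sup>2) * ?E x)" "integrable lborel ?E"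
    using gauss_integrable_moment[OF assms, of 2 \<xi>] gauss_integrable(1)[OF assms, of \<xi>]
    by (simp_all only: E)
  then have "integrable lborel F'"
    unfolding F'_def left_diff_distrib by (intro Bochner_Integration.integrable_diff integrable_mult_right)
  moreover
  have nF: "norm (F x) \<le> (cmod a + cmod b * \<bar>x\<bar>) * exp (- (Re z * x\<^sup>2 / 2))" for x
    unfolding F_def E[symmetric] norm_mult norm_gauss
    using norm_triangle_ineq[of a "b * x"] by (auto simp: norm_mult intro!: mult_right_mono)
  have "((\<lambda>x. (cmod a + cmod b * \<bar>x\<bar>) * exp (- (Re z * x\<^sup>2 / 2))) \<longlongrightarrow> 0) at_top"
    "((\<lambda>x. (cmod a + cmod b * \<bar>x\<bar>) * exp (- (Re z * x\<^sup>2 / 2))) \<longlongrightarrow> 0) at_bot"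
    using assms by real_asymp+
  then have "(F \<longlongrightarrow> 0) at_top" "(F \<longlongrightarrow> 0) at_bot"
    by (auto intro: Lim_null_comparison[OF always_eventually[OF allI[OF nF]]])
  ultimately have "(LINT x|lborel. F' x) = 0"
    by (intro integral_derivative_eq_0[of F F'])
  then show ?thesis
    unfolding E F'_def left_diff_distrib
    by (subst (asm) Bochner_Integration.integral_diff) (use int in \<open>auto simp: left_diff_distrib\<close>)
qed

text \<open>Along the path $z = a + is$ the quotient of both sides has derivative zero in \<open>s\<close>,
  and at $s = 0$ the formula is the characteristic function of a normal distribution.\<close>

lemma gauss_transform:
  assumes "0 < Re z"
  shows "(LINT x|lborel. cis (- (x * \<xi>)) * gauss z x)
    = complex_of_real (sqrt (2 * pi)) * gauss (1 / z) \<xi> / csqrt z"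
proof -
  define a where "a = Re z"
  have a: "0 < a" using assms by (simp add: a_def)
  \<comment> \<open>On this vertical line the real part is always a > 0, so the path avoids 0 and
    the branch cut of \<open>csqrt\<close>, and one real Gaussian dominates every integrand.\<close>
  define Z where "Z = (\<lambda>s::real. complex_of_real a + \<i> * complex_of_real s)"
  have Z0: "Z s \<noteq> 0" and ReZ: "Re (Z s) = a" and ZnR: "Z s \<notin> \<real>\<^sub>\<le>\<^sub>0" for s
    using a by (auto simp: Z_def complex_eq_iff complex_nonpos_Reals_iff)
  define H where "H = (\<lambda>s. LINT x|lborel. cis (- (x * \<xi>)) * gauss (Z s) x)"
  have gZ: "gauss (Z s) x = complex_of_real (exp (- (a * x\<^sup>2 / 2))) * cis (- (s * x\<^sup>2 / 2))" for s x
    unfolding Z_def gauss_add gauss_imaginary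
    by (simp add: gauss_def exp_of_real[symmetric])
  have dH: "(H has_vector_derivative
      (LINT x|lborel. (- \<i> / 2) * (complex_of_real (x\<^sup>2) * (cis (- (x * \<xi>)) * gauss (Z s) x)))) (at s)" for s
    unfolding H_def
  proof (rule has_vector_derivative_integral[where w = "\<lambda>x. exp (- (a * x\<^sup>2 / 2)) * x\<^sup>2"])
    show "integrable lborel (\<lambda>x. cis (- (x * \<xi>)) * gauss (Z s) x)" for s
      using gauss_integrable(1)[of "Z s"] a by (simp add: ReZ)
    show "integrable lborel (\<lambda>x. exp (- (a * x\<^sup>2 / 2)) * x\<^sup>2)"
      by (rule integrable_gaussian_moment[OF a])
  next
    fix h x :: real
    have "cmod (cis (- ((s + h) * x\<^sup>2 / 2)) - cis (- (s * x\<^sup>2 / 2))) \<le> \<bar>h\<bar> * x\<^sup>2 / 2"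
    proof -
      have "cis (- ((s + h) * x\<^sup>2 / 2)) - cis (- (s * x\<^sup>2 / 2))
          = cis (- (s * x\<^sup>2 / 2)) * (cis (- (h * x\<^sup>2 / 2)) - 1)"
        by (simp add: right_diff_distrib cis_mult algebra_simps add_divide_distrib)
      moreover have "cmod (iexp (- (h * x\<^sup>2 / 2)) - (\<Sum>k\<le>0. (\<i> * complex_of_real (- (h * x\<^sup>2 / 2)))^k / fact k)) \<le> \<bar>- (h * x\<^sup>2 / 2)\<bar>^(Suc 0) / fact (Suc 0)"
        by (rule iexp_approx1)
      ultimately show ?thesis by (simp add: norm_mult cis_conv_exp abs_mult)
    qed
    also have "\<dots> \<le> \<bar>h\<bar> * x\<^sup>2" by simp
    finally have "exp (- (a * x\<^sup>2 / 2)) * cmod (cis (- ((s + h) * x\<^sup>2 / 2)) - cis (- (s * x\<^sup>2 / 2)))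
        \<le> exp (- (a * x\<^sup>2 / 2)) * (\<bar>h\<bar> * x\<^sup>2)" by (intro mult_left_mono) auto
    then show "cmod (cis (- (x * \<xi>)) * gauss (Z (s + h)) x - cis (- (x * \<xi>)) * gauss (Z s) x)
        \<le> \<bar>h\<bar> * (exp (- (a * x\<^sup>2 / 2)) * x\<^sup>2)"
      unfolding gZ right_diff_distrib[symmetric] norm_mult by (simp add: mult_ac)
  next
    fix x :: real
    have "((\<lambda>s. cis (- (s * x\<^sup>2 / 2))) has_vector_derivative
       (- (x\<^sup>2 / 2)) *\<^sub>R (\<i> * cis (- (s * x\<^sup>2 / 2)))) (at s)"
      unfolding has_vector_derivative_def by (auto intro!: derivative_eq_intros simp: scaleR_conv_of_real)
    then have "((\<lambda>h. (cis (- ((s + h) * x\<^sup>2 / 2)) - cis (- (s * x\<^sup>2 / 2))) / complex_of_real h)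
        \<longlongrightarrow> (- (x\<^sup>2 / 2)) *\<^sub>R (\<i> * cis (- (s * x\<^sup>2 / 2)))) (at 0)"
      unfolding has_vector_derivative_iff_quotient .
    from tendsto_mult_left[OF this, of "cis (- (x * \<xi>)) * complex_of_real (exp (- (a * x\<^sup>2 / 2)))"]
    show "((\<lambda>h. (cis (- (x * \<xi>)) * gauss (Z (s + h)) x - cis (- (x * \<xi>)) * gauss (Z s) x) / complex_of_real h)
      \<longlongrightarrow> (- \<i> / 2) * (complex_of_real (x\<^sup>2) * (cis (- (x * \<xi>)) * gauss (Z s) x))) (at 0)"
      unfolding gZ by (simp add: scaleR_conv_of_real right_diff_distrib mult.assoc mult.left_commute)
  qed measurable
  define h where "h = (\<lambda>s. H s * (csqrt (Z s) * exp (complex_of_real (\<xi>\<^sup>2) / (2 * Z s))))"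
  have dh: "(h has_vector_derivative 0) (at s)" for s
  proof -
    let ?G = "\<lambda>w. csqrt w * exp (complex_of_real (\<xi>\<^sup>2) / (2 * w))"
    let ?P = "exp (complex_of_real (\<xi>\<^sup>2) / (2 * Z s))"
    have G: "(?G has_field_derivative (inverse (2 * csqrt (Z s)) * ?P
        - csqrt (Z s) * (?P * (complex_of_real (\<xi>\<^sup>2) / (2 * (Z s)\<^sup>2))))) (at (Z s))"
      using Z0[of s] ZnR[of s]
      by (auto intro!: derivative_eq_intros simp: power2_eq_square field_simps)
    have alg: "(inverse (2 * q) * P - q * (P * (c / (2 * d)))) * \<i> = \<i> / (2 * q) * P - q * (P * (\<i> * c / (2 * d)))"
      for q P c d :: complex
      by (simp only: inverse_eq_divide left_diff_distrib) (simp add: mult_ac)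
    have "((\<lambda>w. complex_of_real a + \<i> * w) has_field_derivative \<i>) (at (complex_of_real s))"
      by (auto intro!: derivative_eq_intros)
    from DERIV_chain2[OF G[unfolded Z_def] this]
    have "((\<lambda>w. csqrt (complex_of_real a + \<i> * w) * exp (complex_of_real (\<xi>\<^sup>2) / (2 * (complex_of_real a + \<i> * w))))
      has_field_derivative (\<i> / (2 * csqrt (Z s)) * ?P
        - csqrt (Z s) * (?P * (\<i> * complex_of_real (\<xi>\<^sup>2) / (2 * (Z s)\<^sup>2))))) (at (complex_of_real s))"
      unfolding Z_def by (rule DERIV_cong) (rule alg)
    from has_vector_derivative_real_field[OF this]
    have 1: "((\<lambda>s. ?G (Z s)) has_vector_derivative (\<i> / (2 * csqrt (Z s)) * ?P
        - csqrt (Z s) * (?P * (\<i> * complex_of_real (\<xi>\<^sup>2) / (2 * (Z s)\<^sup>2))))) (at s)"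
      by (simp add: Z_def)
    have 2: "(H has_vector_derivative (- \<i> / 2) * ((1 / Z s - complex_of_real (\<xi>\<^sup>2) / (Z s)\<^sup>2) * H s)) (at s)"
      using dH[of s] gauss_parts[of "Z s" \<xi>] a unfolding integral_mult_right_zero by (simp add: ReZ H_def)
    have cs: "csqrt (Z s) * csqrt (Z s) = Z s" by (metis power2_csqrt power2_eq_square)
    have cs0: "csqrt (Z s) \<noteq> 0" using Z0 by simp
    have "H s * (\<i> / (2 * csqrt (Z s)) * ?P - csqrt (Z s) * (?P * (\<i> * complex_of_real (\<xi>\<^sup>2) / (2 * (Z s)\<^sup>2))))
       + (- \<i> / 2) * ((1 / Z s - complex_of_real (\<xi>\<^sup>2) / (Z s)\<^sup>2) * H s) * (csqrt (Z s) * ?P) = 0"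
    proof -
      have e: "1 / csqrt (Z s) = csqrt (Z s) / Z s" using cs cs0 Z0[of s] by (simp add: field_simps)
      have "\<i> / (2 * csqrt (Z s)) = \<i> * (1 / csqrt (Z s)) / 2" by simp
      then show ?thesis unfolding e using Z0[of s] by (simp add: field_simps power2_eq_square)
    qed
    with has_vector_derivative_mult[OF 2 1] show ?thesis
      unfolding h_def by (simp only:)
  qed
  have "h (Im z) = h 0"
    using has_vector_derivative_zero_constant[of UNIV h] dh
    by (metis UNIV_I convex_UNIV)
  moreover have "Z (Im z) = z" "Z 0 = a" by (auto simp: Z_def a_def complex_eq_iff)
  moreover have "H 0 = complex_of_real (sqrt (2 * pi) / sqrt a * exp (- (\<xi>\<^sup>2 / (2 * a))))"
    unfolding H_def gZ using real_gaussian_transform[OF a, of \<xi>] by simp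
  moreover have "csqrt (complex_of_real a) = complex_of_real (sqrt a)"
    "exp (complex_of_real (\<xi>\<^sup>2) / (2 * complex_of_real a)) = complex_of_real (exp (\<xi>\<^sup>2 / (2 * a)))"
    using a by (simp_all flip: exp_of_real)
  ultimately have "H (Im z) * (csqrt z * exp (complex_of_real (\<xi>\<^sup>2) / (2 * z)))
    = complex_of_real (sqrt (2 * pi) / sqrt a * exp (- (\<xi>\<^sup>2 / (2 * a))))
      * (complex_of_real (sqrt a) * complex_of_real (exp (\<xi>\<^sup>2 / (2 * a))))"
    by (simp only: h_def)
  also have "\<dots> = complex_of_real (sqrt (2 * pi) / sqrt a * exp (- (\<xi>\<^sup>2 / (2 * a))) * (sqrt a * exp (\<xi>\<^sup>2 / (2 * a))))"
    by (simp only: of_real_mult)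
  also have "sqrt (2 * pi) / sqrt a * exp (- (\<xi>\<^sup>2 / (2 * a))) * (sqrt a * exp (\<xi>\<^sup>2 / (2 * a))) = sqrt (2 * pi)"
    using a by (simp add: exp_minus)
  finally have 1: "H (Im z) * (csqrt z * exp (complex_of_real (\<xi>\<^sup>2) / (2 * z))) = complex_of_real (sqrt (2 * pi))" .
  have 2: "gauss (1 / z) \<xi> * exp (complex_of_real (\<xi>\<^sup>2) / (2 * z)) = 1"
    by (simp add: gauss_def exp_minus mult.commute)
  have "complex_of_real (sqrt (2 * pi)) * gauss (1 / z) \<xi>
      = H (Im z) * csqrt z * (gauss (1 / z) \<xi> * exp (complex_of_real (\<xi>\<^sup>2) / (2 * z)))"
    unfolding 1[symmetric] by (simp only: mult_ac)
  then have "H (Im z) = complex_of_real (sqrt (2 * pi)) * gauss (1 / z) \<xi> / csqrt z"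
    unfolding 2 using assms by auto
  moreover have "H (Im z) = (LINT x|lborel. cis (- (x * \<xi>)) * gauss z x)"
    by (simp add: H_def \<open>Z (Im z) = z\<close>)
  ultimately show ?thesis by simp
qed

lemma fourier_gauss: "0 < Re z \<Longrightarrow> fourier (gauss z) \<xi> = gauss (1 / z) \<xi> / csqrt z"
  by (simp add: fourier_eq_cis gauss_transform)

text \<open>Multiplication formula with a modulated Gaussian: a Gaussian-damped inversion integral
  becomes an explicit kernel integral. Real z serves the L2 contraction, z close to it serves the
  Schrodinger kernel.\<close>

lemma fourier_gauss_mult_fourier:
  assumes f: "integrable lborel f" and z: "0 < Re z"
  shows "fourier (\<lambda>\<xi>. gauss z \<xi> * fourier f \<xi>) x
    = complex_of_real (1 / sqrt (2 * pi)) * (LINT y|lborel. f y * (gauss (1 / z) (x + y) / csqrt z))"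
proof -
  have "(LINT \<xi>|lborel. cis (- (\<xi> * x)) * (gauss z \<xi> * fourier f \<xi>))
      = (LINT \<xi>|lborel. fourier f \<xi> * (cis (- (\<xi> * x)) * gauss z \<xi>))"
    by (simp add: mult_ac)
  also have "\<dots> = (LINT y|lborel. f y * fourier (\<lambda>\<xi>. cis (- (\<xi> * x)) * gauss z \<xi>) y)"
    by (rule fourier_multiplication_formula[OF f gauss_integrable(1)[OF z]])
  also have "(\<lambda>y. fourier (\<lambda>\<xi>. cis (- (\<xi> * x)) * gauss z \<xi>) y) = (\<lambda>y. gauss (1 / z) (x + y) / csqrt z)"
    using fourier_cis_mult[of "- x" "gauss z"] fourier_gauss[OF z] by (auto simp: mult.commute add.commute)
  finally show ?thesis by (simp add: fourier_eq_cis)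
qed

subsection \<open>The Fourier transform on \<open>L2\<close>\<close>

lemma fourier_bounded:
  assumes "integrable lborel f"
  obtains C where "0 \<le> C" "\<And>\<xi>. cmod (fourier f \<xi>) \<le> C"
  using fourier_norm_le[OF assms] by (intro that[of "(1 / sqrt (2 * pi)) * (LINT x|lborel. cmod (f x))"]) auto

lemma gauss_real: "gauss (complex_of_real d) x = complex_of_real (exp (- (d * x\<^sup>2 / 2)))"
  by (simp add: gauss_def flip: exp_of_real)

text \<open>Expanding the square of the transform gives the quadratic form of f with a heat kernel
  of total mass 1 in each variable; a Schur-type estimate bounds it by the squared norm. The damping
  makes every integral finite before square integrability of the transform is known.\<close>

lemma fourier_damped_contraction:
  assumes f: "integrable lborel f" "f \<in> L2" and d: "0 < d"
  shows "(\<integral>\<^sup>+\<xi>. ennreal (exp (- (d * \<xi>\<^sup>2 / 2)) * (cmod (fourier f \<xi>))\<^sup>2) \<partial>lborel)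
    \<le> ennreal ((L2_norm f)\<^sup>2)"
proof -
  have [measurable]: "f \<in> borel_measurable borel" using f by auto
  \<comment> \<open>Conjugation and reflection together turn the transform into its complex
    conjugate, so the product with \<open>fourier f\<close> is a squared modulus.\<close>
  let ?F = "\<lambda>y. cnj (f (- y))"
  have F: "integrable lborel ?F"
    using lborel_integrable_real_affine[OF f(1), of "-1" 0] by simp
  have Ff: "fourier ?F \<xi> = cnj (fourier f \<xi>)" for \<xi>
    using fourier_reflect[of "\<lambda>y. cnj (f y)"] fourier_cnj[of f] by simp
  \<comment> \<open>The kernel produced by \<open>fourier_gauss_mult_fourier\<close> is the normal
    density of variance d, whose total mass 1 does not depend on d.\<close>
  define k where "k = (\<lambda>x::real. normal_density 0 (sqrt d) x)"
  have [measurable]: "k \<in> borel_measurable borel" by (simp add: k_def)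
  have k0: "0 \<le> k x" for x by (simp add: k_def normal_density_nonneg)
  have kgauss: "complex_of_real (1 / sqrt (2 * pi)) * (gauss (1 / complex_of_real d) x / csqrt d) = k x" for x
    using d gauss_real[of "1 / d" x]
    by (simp add: k_def normal_density_def real_sqrt_mult)
  define g where "g = (\<lambda>\<xi>. gauss d \<xi> * fourier ?F \<xi>)"
  obtain C where C: "0 \<le> C" "\<And>\<xi>. cmod (fourier ?F \<xi>) \<le> C" using fourier_bounded[OF F] by blast
  obtain C' where C': "0 \<le> C'" "\<And>\<xi>. cmod (fourier f \<xi>) \<le> C'" using fourier_bounded[OF f(1)] by blast
  have int_g: "integrable lborel g"
  proof (rule Bochner_Integration.integrable_bound)
    show "integrable lborel (\<lambda>\<xi>. gauss d \<xi> * complex_of_real C)"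
      using gauss_integrable(2)[of d] d by simp
    show "AE \<xi> in lborel. norm (g \<xi>) \<le> norm (gauss d \<xi> * complex_of_real C)"
      unfolding g_def norm_mult
      using C by (auto intro!: mult_left_mono)
  qed (auto simp: g_def)
  have fg: "fourier g x = (LINT y|lborel. cnj (f y) * k (x - y))" for x
  proof -
    have "fourier g x = complex_of_real (1 / sqrt (2 * pi)) * (LINT y|lborel. ?F y * (gauss (1 / complex_of_real d) (x + y) / csqrt d))"
      unfolding g_def using fourier_gauss_mult_fourier[OF F, of d x] d by simp
    also have "\<dots> = (LINT y|lborel. ?F y * k (x + y))"
      unfolding kgauss[symmetric] integral_mult_right_zero[symmetric] by (simp only: mult_ac)
    also have "\<dots> = (LINT y|lborel. cnj (f y) * k (x - y))"
      using lborel_integral_real_affine[of "-1" "\<lambda>y. ?F y * k (x + y)" 0] by simp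
    finally show ?thesis .
  qed
  have K1: "(\<integral>\<^sup>+y. ennreal (k (x - y)) \<partial>lborel) = 1" for x
  proof -
    have "(\<integral>\<^sup>+y. ennreal (k y) \<partial>lborel) = 1"
      using d k0 by (subst nn_integral_eq_integral) (auto simp: k_def)
    then show ?thesis
      using nn_integral_real_affine[of "\<lambda>y. ennreal (k y)" "-1" x] by simp
  qed
  have K2: "(\<integral>\<^sup>+x. ennreal (k (x - y)) \<partial>lborel) = 1" for y
  proof -
    have "k (x - y) = k (y - x)" for x by (simp add: k_def normal_density_def power2_commute)
    then show ?thesis using K1[of y] by simp
  qed
  have nnf: "(\<integral>\<^sup>+x. ennreal ((cmod (f x))\<^sup>2) \<partial>lborel) = ennreal ((L2_norm f)\<^sup>2)"
    by (rule L2_nn_integral[OF f(2)])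
  have dbl: "(\<integral>\<^sup>+x. (\<integral>\<^sup>+y. ennreal (cmod (f x) * cmod (f y) * k (x - y)) \<partial>lborel) \<partial>lborel) \<le> ennreal ((L2_norm f)\<^sup>2)"
  proof -
    have half: "ennreal (1/2) * (ennreal a + ennreal a) = ennreal a" if "0 \<le> a" for a
    proof -
      have "ennreal a + ennreal a = ennreal (2 * a)" using that by (simp flip: ennreal_plus)
      moreover have "ennreal (1/2) * ennreal (2 * a) = ennreal (1/2 * (2 * a))"
        by (rule ennreal_mult[symmetric]) (use that in auto)
      ultimately show ?thesis by simp
    qed
    have "(\<integral>\<^sup>+x. (\<integral>\<^sup>+y. ennreal (cmod (f x) * cmod (f y) * k (x - y)) \<partial>lborel) \<partial>lborel)
      \<le> (\<integral>\<^sup>+x. (\<integral>\<^sup>+y. ennreal (1/2) * (ennreal ((cmod (f x))\<^sup>2) * ennreal (k (x - y)) + ennreal ((cmod (f y))\<^sup>2) * ennreal (k (x - y))) \<partial>lborel) \<partial>lborel)"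
    proof (intro nn_integral_mono)
      fix x y
      \<comment> \<open>The inequality ab \<le> (a^2 + b^2)/2 decouples f x from f y; in each half
        the kernel then integrates to 1 in the free variable.\<close>
      have "cmod (f x) * cmod (f y) \<le> 1/2 * ((cmod (f x))\<^sup>2 + (cmod (f y))\<^sup>2)"
        using sum_squares_ge_zero[of "cmod (f x) - cmod (f y)" 0] by (simp add: power2_eq_square algebra_simps)
      then have "cmod (f x) * cmod (f y) * k (x - y) \<le> 1/2 * ((cmod (f x))\<^sup>2 + (cmod (f y))\<^sup>2) * k (x - y)"
        using k0 by (intro mult_right_mono) auto
      also have "\<dots> = 1/2 * ((cmod (f x))\<^sup>2 * k (x - y) + (cmod (f y))\<^sup>2 * k (x - y))"
        by (simp add: algebra_simps)
      finally have "ennreal (cmod (f x) * cmod (f y) * k (x - y))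
        \<le> ennreal (1/2 * ((cmod (f x))\<^sup>2 * k (x - y) + (cmod (f y))\<^sup>2 * k (x - y)))"
        by (rule ennreal_leI)
      also have "\<dots> = ennreal (1/2) * ennreal ((cmod (f x))\<^sup>2 * k (x - y) + (cmod (f y))\<^sup>2 * k (x - y))"
        using k0 by (intro ennreal_mult) auto
      also have "ennreal ((cmod (f x))\<^sup>2 * k (x - y) + (cmod (f y))\<^sup>2 * k (x - y))
        = ennreal ((cmod (f x))\<^sup>2) * ennreal (k (x - y)) + ennreal ((cmod (f y))\<^sup>2) * ennreal (k (x - y))"
        using k0 by (simp add: ennreal_mult)
      finally show "ennreal (cmod (f x) * cmod (f y) * k (x - y))
        \<le> ennreal (1/2) * (ennreal ((cmod (f x))\<^sup>2) * ennreal (k (x - y)) + ennreal ((cmod (f y))\<^sup>2) * ennreal (k (x - y)))" .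
    qed
    also have "\<dots> = ennreal (1/2) * ((\<integral>\<^sup>+x. (\<integral>\<^sup>+y. ennreal ((cmod (f x))\<^sup>2) * ennreal (k (x - y)) \<partial>lborel) \<partial>lborel)
        + (\<integral>\<^sup>+x. (\<integral>\<^sup>+y. ennreal ((cmod (f y))\<^sup>2) * ennreal (k (x - y)) \<partial>lborel) \<partial>lborel))"
      by (simp add: nn_integral_cmult nn_integral_add)
    also have "(\<integral>\<^sup>+x. (\<integral>\<^sup>+y. ennreal ((cmod (f x))\<^sup>2) * ennreal (k (x - y)) \<partial>lborel) \<partial>lborel) = ennreal ((L2_norm f)\<^sup>2)"
      by (simp add: nn_integral_cmult K1 nnf)
    also have "(\<integral>\<^sup>+x. (\<integral>\<^sup>+y. ennreal ((cmod (f y))\<^sup>2) * ennreal (k (x - y)) \<partial>lborel) \<partial>lborel)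
        = (\<integral>\<^sup>+y. (\<integral>\<^sup>+x. ennreal ((cmod (f y))\<^sup>2) * ennreal (k (x - y)) \<partial>lborel) \<partial>lborel)"
      by (rule lborel_pair.Fubini') measurable
    also have "\<dots> = ennreal ((L2_norm f)\<^sup>2)"
      by (simp add: nn_integral_cmult K2 nnf)
    also have "ennreal (1/2) * (ennreal ((L2_norm f)\<^sup>2) + ennreal ((L2_norm f)\<^sup>2)) = ennreal ((L2_norm f)\<^sup>2)"
      by (rule half) simp
    finally show ?thesis .
  qed
  have eqp: "fourier f \<xi> * g \<xi> = complex_of_real (exp (- (d * \<xi>\<^sup>2 / 2)) * (cmod (fourier f \<xi>))\<^sup>2)" for \<xi>
    unfolding g_def Ff gauss_real complex_norm_square of_real_mult by (simp add: mult_ac)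
  have "integrable lborel (\<lambda>\<xi>. fourier f \<xi> * g \<xi>)"
  proof (rule Bochner_Integration.integrable_bound)
    show "integrable lborel (\<lambda>\<xi>. complex_of_real C' * g \<xi>)"
      using int_g by simp
    show "AE \<xi> in lborel. norm (fourier f \<xi> * g \<xi>) \<le> norm (complex_of_real C' * g \<xi>)"
      unfolding norm_mult
      using C' by (auto intro!: mult_right_mono)
  qed (use int_g in auto)
  then have int: "integrable lborel (\<lambda>\<xi>. exp (- (d * \<xi>\<^sup>2 / 2)) * (cmod (fourier f \<xi>))\<^sup>2)"
    by (simp only: eqp complex_of_real_integrable_eq)
  have "(LINT \<xi>|lborel. exp (- (d * \<xi>\<^sup>2 / 2)) * (cmod (fourier f \<xi>))\<^sup>2)
      = cmod (LINT \<xi>|lborel. complex_of_real (exp (- (d * \<xi>\<^sup>2 / 2)) * (cmod (fourier f \<xi>))\<^sup>2))"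
    by (simp only: integral_complex_of_real norm_of_real) (simp add: integral_nonneg_AE)
  also have "\<dots> = cmod (LINT x|lborel. f x * fourier g x)"
    using fourier_multiplication_formula[OF f(1) int_g] by (simp only: eqp)
  finally have "ennreal (LINT \<xi>|lborel. exp (- (d * \<xi>\<^sup>2 / 2)) * (cmod (fourier f \<xi>))\<^sup>2)
      = ennreal (cmod (LINT x|lborel. f x * fourier g x))" by simp
  \<comment> \<open>If the product is not integrable, its integral is 0 by convention and the bound
    is trivial; the same case split recurs for the inner integral.\<close>
  also have "\<dots> \<le> (\<integral>\<^sup>+x. ennreal (cmod (f x * fourier g x)) \<partial>lborel)"
  proof (cases "integrable lborel (\<lambda>x. f x * fourier g x)")
    case True then show ?thesis by (rule integral_norm_bound_ennreal)
  qed (simp add: not_integrable_integral_eq)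
  also have "\<dots> \<le> (\<integral>\<^sup>+x. (\<integral>\<^sup>+y. ennreal (cmod (f x) * cmod (f y) * k (x - y)) \<partial>lborel) \<partial>lborel)"
  proof (rule nn_integral_mono)
    fix x
    have "ennreal (cmod (fourier g x)) \<le> (\<integral>\<^sup>+y. ennreal (cmod (cnj (f y) * k (x - y))) \<partial>lborel)"
    proof (cases "integrable lborel (\<lambda>y. cnj (f y) * complex_of_real (k (x - y)))")
      case True then show ?thesis unfolding fg by (rule integral_norm_bound_ennreal)
    qed (simp add: fg not_integrable_integral_eq)
    then have "ennreal (cmod (f x)) * ennreal (cmod (fourier g x))
        \<le> ennreal (cmod (f x)) * (\<integral>\<^sup>+y. ennreal (cmod (f y) * k (x - y)) \<partial>lborel)"
      using k0 by (intro mult_left_mono) (auto simp: norm_mult)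
    also have "\<dots> = (\<integral>\<^sup>+y. ennreal (cmod (f x) * cmod (f y) * k (x - y)) \<partial>lborel)"
      using k0 by (subst nn_integral_cmult[symmetric]) (auto simp: ennreal_mult mult.assoc)
    finally show "ennreal (cmod (f x * fourier g x)) \<le> (\<integral>\<^sup>+y. ennreal (cmod (f x) * cmod (f y) * k (x - y)) \<partial>lborel)"
      by (simp add: norm_mult ennreal_mult)
  qed
  also note dbl
  finally show ?thesis
    by (subst nn_integral_eq_integral[OF int]) auto
qed

text \<open>Removing the damping by Fatou gives only an inequality; equality is recovered later for
  \<open>fourier_L2\<close> by applying the transform twice.\<close>

lemma fourier_contraction:
  assumes f: "integrable lborel f" "f \<in> L2"
  shows "fourier f \<in> L2" "L2_norm (fourier f) \<le> L2_norm f"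
proof -
  have [measurable]: "f \<in> borel_measurable borel" using f by auto
  have "(\<integral>\<^sup>+\<xi>. ennreal ((cmod (fourier f \<xi>))\<^sup>2) \<partial>lborel)
    = (\<integral>\<^sup>+\<xi>. liminf (\<lambda>n. ennreal (exp (- (1 / real (Suc n) * \<xi>\<^sup>2 / 2)) * (cmod (fourier f \<xi>))\<^sup>2)) \<partial>lborel)"
  proof (rule nn_integral_cong)
    fix \<xi> :: real
    have "(\<lambda>n. 1 / real (Suc n)) \<longlonglongrightarrow> 0"
      using LIMSEQ_inverse_real_of_nat by (simp add: inverse_eq_divide)
    then have "(\<lambda>n. exp (- (1 / real (Suc n) * \<xi>\<^sup>2 / 2)) * (cmod (fourier f \<xi>))\<^sup>2)
        \<longlonglongrightarrow> exp (- (0 * \<xi>\<^sup>2 / 2)) * (cmod (fourier f \<xi>))\<^sup>2"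
      by (intro tendsto_intros) auto
    then have "(\<lambda>n. ennreal (exp (- (1 / real (Suc n) * \<xi>\<^sup>2 / 2)) * (cmod (fourier f \<xi>))\<^sup>2))
        \<longlonglongrightarrow> ennreal ((cmod (fourier f \<xi>))\<^sup>2)" by (intro tendsto_ennrealI) simp
    then show "ennreal ((cmod (fourier f \<xi>))\<^sup>2)
      = liminf (\<lambda>n. ennreal (exp (- (1 / real (Suc n) * \<xi>\<^sup>2 / 2)) * (cmod (fourier f \<xi>))\<^sup>2))"
      by (intro lim_imp_Liminf[symmetric]) auto
  qed
  also have "\<dots> \<le> liminf (\<lambda>n. \<integral>\<^sup>+\<xi>. ennreal (exp (- (1 / real (Suc n) * \<xi>\<^sup>2 / 2)) * (cmod (fourier f \<xi>))\<^sup>2) \<partial>lborel)"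
    by (rule nn_integral_liminf) measurable
  also have "\<dots> \<le> liminf (\<lambda>n::nat. ennreal ((L2_norm f)\<^sup>2))"
    by (intro Liminf_mono always_eventually allI fourier_damped_contraction f) simp
  also have "\<dots> = ennreal ((L2_norm f)\<^sup>2)" by (simp add: Liminf_const)
  finally show "fourier f \<in> L2" "L2_norm (fourier f) \<le> L2_norm f"
    using L2_nn_integralI[of "fourier f" "L2_norm f"] by auto
qed

section \<open>Extension of the transform from truncations to all of L2\<close>

definition trunc :: "nat \<Rightarrow> (real \<Rightarrow> complex) \<Rightarrow> real \<Rightarrow> complex" where
  "trunc n f x = indicator {- real n..real n} x * f x"

lemma trunc_eq: "trunc n f = (\<lambda>x. indicator {- real n..real n} x * f x)"
  by (simp add: trunc_def fun_eq_iff)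

lemma trunc_measurable [measurable]: "f \<in> borel_measurable borel \<Longrightarrow> trunc n f \<in> borel_measurable borel"
  unfolding trunc_eq by measurable

lemma indicator_interval_L2: "(\<lambda>x. indicator {- real n..real n} x) \<in> L2"
proof -
  have "(\<lambda>x::real. (cmod (indicator {- real n..real n} x))\<^sup>2) = indicator {- real n..real n}"
    by (auto simp: indicator_def)
  then show ?thesis by (simp add: L2_def)
qed

lemma trunc_L2:
  assumes "f \<in> L2"
  shows "trunc n f \<in> L2" "integrable lborel (trunc n f)"
  unfolding trunc_eq
  using L2_mult_bounded(1)[OF assms, of "indicator {- real n..real n}" 1]
    L2_Cauchy_Schwarz(1)[OF indicator_interval_L2 assms]
  by (auto simp: indicator_def)

lemma trunc_tendsto: "(\<lambda>n. trunc n f x) \<longlonglongrightarrow> f x"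
proof (rule tendsto_eventually)
  obtain N :: nat where N: "\<bar>x\<bar> \<le> real N" using real_arch_simple by blast
  show "\<forall>\<^sub>F n in sequentially. trunc n f x = f x"
    using eventually_ge_at_top[of N] by eventually_elim (use N in \<open>auto simp: trunc_def indicator_def\<close>)
qed

lemma trunc_L2_tendsto:
  assumes f: "f \<in> L2"
  shows "(\<lambda>n. L2_norm (\<lambda>x. trunc n f x - f x)) \<longlonglongrightarrow> 0"
proof (rule L2_dominated_convergence[OF _ _ f])
  show "AE x in lborel. cmod (trunc n f x - f x) \<le> cmod (f x)" for n
    by (auto simp: trunc_def indicator_def)
qed (use f trunc_tendsto L2_measurable in auto)

lemma trunc_add: "trunc n (\<lambda>x. f x + g x) = (\<lambda>x. trunc n f x + trunc n g x)"
  by (simp add: trunc_def fun_eq_iff algebra_simps)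

lemma trunc_cmult: "trunc n (\<lambda>x. c * f x) = (\<lambda>x. c * trunc n f x)"
  by (simp add: trunc_def fun_eq_iff)

text \<open>By the contraction property the transforms of the truncations are Cauchy, hence converge
  by completeness. So the choice in \<open>fourier_L2\<close> ranges over a nonempty set.\<close>

lemma fourier_L2_spec:
  assumes f: "f \<in> L2"
  shows "fourier_L2 f \<in> L2" "L2_tendsto (\<lambda>n. fourier (trunc n f)) (fourier_L2 f) sequentially"
proof -
  have diff: "L2_norm (\<lambda>x. fourier (trunc i f) x - fourier (trunc j f) x)
      \<le> L2_norm (\<lambda>x. trunc i f x - f x) + L2_norm (\<lambda>x. trunc j f x - f x)" for i j
  proof -
    have "L2_norm (\<lambda>x. fourier (trunc i f) x - fourier (trunc j f) x)
        = L2_norm (fourier (\<lambda>x. trunc i f x - trunc j f x))"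
      by (rule arg_cong[where f=L2_norm], rule ext) (simp add: fourier_diff trunc_L2 f)
    also have "\<dots> \<le> L2_norm (\<lambda>x. trunc i f x - trunc j f x)"
      by (intro fourier_contraction L2_diff Bochner_Integration.integrable_diff trunc_L2 f)
    also have "\<dots> \<le> L2_norm (\<lambda>x. trunc i f x - f x) + L2_norm (\<lambda>x. f x - trunc j f x)"
      by (intro L2_triangle_via trunc_L2 f)
    finally show ?thesis using L2_norm_minus_commute[of f "trunc j f"] by simp
  qed
  obtain g where g: "g \<in> L2" "L2_tendsto (\<lambda>n. fourier (trunc n f)) g sequentially"
  proof (rule L2_complete[of "\<lambda>n. fourier (trunc n f)"])
    show "fourier (trunc n f) \<in> L2" for n
      by (intro fourier_contraction trunc_L2 f)
    fix e :: real assume "0 < e"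
    then have "\<forall>\<^sub>F n in sequentially. L2_norm (\<lambda>x. trunc n f x - f x) < e / 2"
      using order_tendstoD(2)[OF trunc_L2_tendsto[OF f], of "e/2"] by simp
    then obtain N where N: "\<And>n. n \<ge> N \<Longrightarrow> L2_norm (\<lambda>x. trunc n f x - f x) < e / 2"
      by (auto simp: eventually_sequentially)
    have "L2_norm (\<lambda>x. fourier (trunc i f) x - fourier (trunc j f) x) < e" if "i \<ge> N" "j \<ge> N" for i j
      using diff[of i j] N[OF that(1)] N[OF that(2)] by linarith
    then show "\<exists>N. \<forall>i\<ge>N. \<forall>j\<ge>N. L2_norm (\<lambda>x. fourier (trunc i f) x - fourier (trunc j f) x) < e" by blast
  qed blast
  have "fourier_L2 f \<in> L2 \<and> L2_tendsto (\<lambda>n. fourier (trunc n f)) (fourier_L2 f) sequentially"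
    unfolding fourier_L2_def trunc_eq
    by (rule someI[where x = g]) (use g in \<open>simp add: trunc_eq\<close>)
  then show "fourier_L2 f \<in> L2" "L2_tendsto (\<lambda>n. fourier (trunc n f)) (fourier_L2 f) sequentially"
    by auto
qed

lemmas fourier_L2_in_L2 = fourier_L2_spec(1)

lemma fourier_L2_measurable: "f \<in> L2 \<Longrightarrow> fourier_L2 f \<in> borel_measurable borel"
  by (intro L2_measurable fourier_L2_in_L2)

lemma fourier_L2_unique:
  assumes "f \<in> L2" "g \<in> L2" "L2_tendsto (\<lambda>n. fourier (trunc n f)) g sequentially"
  shows "AE \<xi> in lborel. fourier_L2 f \<xi> = g \<xi>"
  using L2_tendsto_unique[OF _ fourier_L2_spec(2) assms(3) fourier_L2_spec(1) assms(2)] assms(1) by simp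

text \<open>The conclusion is equality of functions, not merely almost everywhere: the truncated
  transforms coincide as integrals, so the choice operator is applied to the same predicate.\<close>

lemma fourier_L2_cong_AE:
  assumes "f \<in> borel_measurable borel" "g \<in> borel_measurable borel" "AE x in lborel. f x = g x"
  shows "fourier_L2 f = fourier_L2 g"
proof -
  have "fourier (trunc n f) = fourier (trunc n g)" for n
  proof (rule fourier_cong_AE)
    show "AE x in lborel. trunc n f x = trunc n g x"
      using assms(3) by eventually_elim (simp add: trunc_def)
  qed (use assms in measurable)
  then show ?thesis unfolding fourier_L2_def trunc_eq by simp
qed

lemma fourier_L2_contraction:
  assumes f: "f \<in> L2"
  shows "L2_norm (fourier_L2 f) \<le> L2_norm f"
proof (rule LIMSEQ_le)
  show "(\<lambda>n. L2_norm (fourier (trunc n f))) \<longlonglongrightarrow> L2_norm (fourier_L2 f)"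
    by (rule L2_norm_tendsto[OF fourier_L2_spec(2,1)[OF f]])
  show "(\<lambda>n. L2_norm (trunc n f)) \<longlonglongrightarrow> L2_norm f"
    by (rule L2_norm_tendsto) (use f trunc_L2_tendsto[OF f] in \<open>auto simp: L2_tendsto_def trunc_L2\<close>)
  show "\<exists>N. \<forall>n\<ge>N. L2_norm (fourier (trunc n f)) \<le> L2_norm (trunc n f)"
    by (intro exI[of _ 0] allI impI fourier_contraction trunc_L2 f)
qed

lemma L2_tendsto_add:
  assumes "L2_tendsto s f F" "L2_tendsto t g F"
  shows "L2_tendsto (\<lambda>i x. s i x + t i x) (\<lambda>x. f x + g x) F"
  unfolding L2_tendsto_def
proof
  have ev: "\<forall>\<^sub>F i in F. (\<lambda>x. s i x - f x) \<in> L2" "\<forall>\<^sub>F i in F. (\<lambda>x. t i x - g x) \<in> L2"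
    and lim: "((\<lambda>i. L2_norm (\<lambda>x. s i x - f x)) \<longlongrightarrow> 0) F" "((\<lambda>i. L2_norm (\<lambda>x. t i x - g x)) \<longlongrightarrow> 0) F"
    using assms by (auto simp: L2_tendsto_def)
  have eq: "s i x + t i x - (f x + g x) = (s i x - f x) + (t i x - g x)" for i x by simp
  show "\<forall>\<^sub>F i in F. (\<lambda>x. s i x + t i x - (f x + g x)) \<in> L2"
    using ev unfolding eq by eventually_elim (rule L2_add)
  show "((\<lambda>i. L2_norm (\<lambda>x. s i x + t i x - (f x + g x))) \<longlongrightarrow> 0) F"
  proof (rule Lim_null_comparison)
    show "\<forall>\<^sub>F i in F. norm (L2_norm (\<lambda>x. s i x + t i x - (f x + g x)))
        \<le> L2_norm (\<lambda>x. s i x - f x) + L2_norm (\<lambda>x. t i x - g x)"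
      using ev unfolding eq by eventually_elim (simp add: L2_triangle)
    show "((\<lambda>i. L2_norm (\<lambda>x. s i x - f x) + L2_norm (\<lambda>x. t i x - g x)) \<longlongrightarrow> 0) F"
      using tendsto_add[OF lim] by simp
  qed
qed

lemma L2_tendsto_cmult:
  assumes "L2_tendsto s f F"
  shows "L2_tendsto (\<lambda>i x. c * s i x) (\<lambda>x. c * f x) F"
proof -
  have "\<forall>\<^sub>F i in F. (\<lambda>x. s i x - f x) \<in> L2"
    and lim: "((\<lambda>i. L2_norm (\<lambda>x. s i x - f x)) \<longlongrightarrow> 0) F"
    using assms by (auto simp: L2_tendsto_def)
  then show ?thesis
    unfolding L2_tendsto_def right_diff_distrib[symmetric] L2_norm_cmult
    using tendsto_mult_left[OF lim, of "cmod c"] by (auto elim: eventually_mono)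
qed

lemma fourier_L2_add:
  assumes f: "f \<in> L2" and g: "g \<in> L2"
  shows "AE \<xi> in lborel. fourier_L2 (\<lambda>x. f x + g x) \<xi> = fourier_L2 f \<xi> + fourier_L2 g \<xi>"
proof (rule fourier_L2_unique)
  show "L2_tendsto (\<lambda>n. fourier (trunc n (\<lambda>x. f x + g x))) (\<lambda>\<xi>. fourier_L2 f \<xi> + fourier_L2 g \<xi>) sequentially"
    using L2_tendsto_add[OF fourier_L2_spec(2)[OF f] fourier_L2_spec(2)[OF g]]
    by (simp add: trunc_add fourier_add[OF trunc_L2(2)[OF f] trunc_L2(2)[OF g], abs_def])
qed (use f g in \<open>auto simp: fourier_L2_in_L2\<close>)

lemma fourier_L2_cmult:
  assumes f: "f \<in> L2"
  shows "AE \<xi> in lborel. fourier_L2 (\<lambda>x. c * f x) \<xi> = c * fourier_L2 f \<xi>"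
proof (rule fourier_L2_unique)
  show "L2_tendsto (\<lambda>n. fourier (trunc n (\<lambda>x. c * f x))) (\<lambda>\<xi>. c * fourier_L2 f \<xi>) sequentially"
    using L2_tendsto_cmult[OF fourier_L2_spec(2)[OF f]]
    by (simp add: trunc_cmult fourier_cmult[abs_def])
qed (use f in \<open>auto simp: fourier_L2_in_L2\<close>)

lemma fourier_L2_diff:
  assumes f: "f \<in> L2" and g: "g \<in> L2"
  shows "AE \<xi> in lborel. fourier_L2 (\<lambda>x. f x - g x) \<xi> = fourier_L2 f \<xi> - fourier_L2 g \<xi>"
  using fourier_L2_add[OF f L2_cmult[OF g, of "-1"]] fourier_L2_cmult[OF g, of "-1"]
  by (auto elim!: eventually_elim2)

lemma fourier_L2_eq_fourier:
  assumes f: "f \<in> L2" "integrable lborel f"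
  shows "AE \<xi> in lborel. fourier_L2 f \<xi> = fourier f \<xi>"
proof (rule fourier_L2_unique)
  have d: "(\<lambda>\<xi>. fourier (trunc n f) \<xi> - fourier f \<xi>) = fourier (\<lambda>x. trunc n f x - f x)" for n
    by (rule ext) (simp add: fourier_diff trunc_L2 f)
  have "\<forall>\<^sub>F n in sequentially. norm (L2_norm (\<lambda>\<xi>. fourier (trunc n f) \<xi> - fourier f \<xi>)) \<le> L2_norm (\<lambda>x. trunc n f x - f x)"
    unfolding d using fourier_contraction(2)[of "\<lambda>x. trunc _ f x - f x"]
    by (intro always_eventually allI) (auto simp: trunc_L2 f)
  from Lim_null_comparison[OF this trunc_L2_tendsto[OF f(1)]]
  show "L2_tendsto (\<lambda>n. fourier (trunc n f)) (fourier f) sequentially"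
    unfolding L2_tendsto_def using fourier_contraction(1) f trunc_L2 by auto
qed (use f fourier_contraction in auto)

lemma L2_integral_tendsto:
  assumes "L2_tendsto s f F" "L2_tendsto t g F" and f: "f \<in> L2" and g: "g \<in> L2"
  shows "((\<lambda>i. LINT x|lborel. s i x * t i x) \<longlongrightarrow> (LINT x|lborel. f x * g x)) F"
proof -
  have ev: "\<forall>\<^sub>F i in F. (\<lambda>x. s i x - f x) \<in> L2" "\<forall>\<^sub>F i in F. (\<lambda>x. t i x - g x) \<in> L2"
    and lim: "((\<lambda>i. L2_norm (\<lambda>x. s i x - f x)) \<longlongrightarrow> 0) F" "((\<lambda>i. L2_norm (\<lambda>x. t i x - g x)) \<longlongrightarrow> 0) F"
    using assms by (auto simp: L2_tendsto_def)
  let ?a = "\<lambda>i. L2_norm (\<lambda>x. s i x - f x)" and ?b = "\<lambda>i. L2_norm (\<lambda>x. t i x - g x)"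
  have "((\<lambda>i. (LINT x|lborel. s i x * t i x) - (LINT x|lborel. f x * g x)) \<longlongrightarrow> 0) F"
  proof (rule Lim_null_comparison)
    show "((\<lambda>i. ?a i * ?b i + L2_norm f * ?b i + ?a i * L2_norm g) \<longlongrightarrow> 0) F"
      using tendsto_add[OF tendsto_add[OF tendsto_mult[OF lim] tendsto_mult_left[OF lim(2), of "L2_norm f"]]
          tendsto_mult_right[OF lim(1), of "L2_norm g"]] by simp
    show "\<forall>\<^sub>F i in F. norm ((LINT x|lborel. s i x * t i x) - (LINT x|lborel. f x * g x))
        \<le> ?a i * ?b i + L2_norm f * ?b i + ?a i * L2_norm g"
      using ev
    proof eventually_elim
      case (elim i)
      let ?A = "\<lambda>x. s i x - f x" and ?B = "\<lambda>x. t i x - g x"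
      have int: "integrable lborel (\<lambda>x. ?A x * ?B x)" "integrable lborel (\<lambda>x. f x * ?B x)"
        "integrable lborel (\<lambda>x. ?A x * g x)" "integrable lborel (\<lambda>x. f x * g x)"
        using L2_Cauchy_Schwarz(1) elim f g by blast+
      have "s i x * t i x = ?A x * ?B x + f x * ?B x + ?A x * g x + f x * g x" for x
        by (simp add: algebra_simps)
      then have "(LINT x|lborel. s i x * t i x) - (LINT x|lborel. f x * g x)
          = (LINT x|lborel. ?A x * ?B x) + (LINT x|lborel. f x * ?B x) + (LINT x|lborel. ?A x * g x)"
        using int by (simp only: Bochner_Integration.integral_add Bochner_Integration.integrable_add add_diff_cancel_right')
      moreover have "cmod (LINT x|lborel. ?A x * ?B x) \<le> ?a i * ?b i"
        "cmod (LINT x|lborel. f x * ?B x) \<le> L2_norm f * ?b i"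
        "cmod (LINT x|lborel. ?A x * g x) \<le> ?a i * L2_norm g"
        using L2_Cauchy_Schwarz(3) elim f g by blast+
      ultimately show ?case
        using norm_triangle_ineq[of "(LINT x|lborel. ?A x * ?B x) + (LINT x|lborel. f x * ?B x)" "LINT x|lborel. ?A x * g x"]
          norm_triangle_ineq[of "LINT x|lborel. ?A x * ?B x" "LINT x|lborel. f x * ?B x"]
        by (simp only:)
    qed
  qed
  then show ?thesis by (simp add: LIM_zero_iff)
qed

lemma trunc_tendsto_L2: "f \<in> L2 \<Longrightarrow> L2_tendsto (\<lambda>n. trunc n f) f sequentially"
  unfolding L2_tendsto_def using trunc_L2_tendsto trunc_L2 by auto

lemma fourier_L2_multiplication_formula:
  assumes f: "f \<in> L2" and g: "g \<in> L2"
  shows "(LINT \<xi>|lborel. fourier_L2 f \<xi> * g \<xi>) = (LINT x|lborel. f x * fourier_L2 g x)"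
proof (rule LIMSEQ_unique)
  show "(\<lambda>n. LINT \<xi>|lborel. fourier (trunc n f) \<xi> * trunc n g \<xi>) \<longlonglongrightarrow> (LINT \<xi>|lborel. fourier_L2 f \<xi> * g \<xi>)"
    by (intro L2_integral_tendsto fourier_L2_spec trunc_tendsto_L2 f g)
  have "(\<lambda>n. LINT \<xi>|lborel. trunc n f \<xi> * fourier (trunc n g) \<xi>) \<longlonglongrightarrow> (LINT x|lborel. f x * fourier_L2 g x)"
    by (intro L2_integral_tendsto fourier_L2_spec trunc_tendsto_L2 f g)
  then show "(\<lambda>n. LINT \<xi>|lborel. fourier (trunc n f) \<xi> * trunc n g \<xi>) \<longlonglongrightarrow> (LINT x|lborel. f x * fourier_L2 g x)"
    by (simp add: fourier_multiplication_formula trunc_L2 f g)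
qed

text \<open>The positive and negative parts of k have equal transforms. Normalized to probability
  densities they have the same characteristic function, so Levy's uniqueness theorem identifies
  them.\<close>

lemma real_zero_if_transform_zero:
  fixes k :: "real \<Rightarrow> real"
  assumes k: "integrable lborel k"
    and zero: "\<And>\<xi>. (LINT x|lborel. cis (\<xi> * x) * complex_of_real (k x)) = 0"
  shows "AE x in lborel. k x = 0"
proof -
  have [measurable]: "k \<in> borel_measurable borel" using k by auto
  define P where "P = (\<lambda>x. max (k x) 0)"
  define Q where "Q = (\<lambda>x. max (- k x) 0)"
  have kPQ: "k x = P x - Q x" and P0: "0 \<le> P x" and Q0: "0 \<le> Q x" for x by (auto simp: P_def Q_def)
  have P: "integrable lborel P" and Q: "integrable lborel Q"
    unfolding P_def Q_def by (rule Bochner_Integration.integrable_bound[OF k]; auto)+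
  have Pm[measurable]: "P \<in> borel_measurable borel" "Q \<in> borel_measurable borel" using P Q by auto
  define m where "m = (LINT x|lborel. P x)"
  have m0: "0 \<le> m" using P0 by (simp add: m_def integral_nonneg_AE)
  have int: "integrable lborel (\<lambda>x. cis (\<xi> * x) * complex_of_real (P x))"
    "integrable lborel (\<lambda>x. cis (\<xi> * x) * complex_of_real (Q x))" for \<xi>
    using P Q by (auto intro!: integrable_cis_mult)
  have PQ: "(LINT x|lborel. cis (\<xi> * x) * complex_of_real (P x)) = (LINT x|lborel. cis (\<xi> * x) * complex_of_real (Q x))" for \<xi>
    using zero[of \<xi>] int[of \<xi>] by (simp add: kPQ right_diff_distrib)
  \<comment> \<open>At frequency 0 the transforms are the total masses, so both parts are normalized
    by the same m.\<close>
  have mQ: "m = (LINT x|lborel. Q x)"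
    using PQ[of 0] by (simp add: m_def)
  show ?thesis
  proof (cases "m = 0")
    case True
    then have "AE x in lborel. P x = 0" "AE x in lborel. Q x = 0"
      using integral_nonneg_eq_0_iff_AE[OF P] integral_nonneg_eq_0_iff_AE[OF Q] P0 Q0 mQ by (auto simp: m_def)
    then show ?thesis by eventually_elim (simp add: kPQ)
  next
    case False
    with m0 have m: "0 < m" by simp
    have dist: "real_distribution (density lborel (\<lambda>x. ennreal (R x / m)))"
      if R: "integrable lborel R" "\<And>x. 0 \<le> R x" "(LINT x|lborel. R x) = m" for R :: "real \<Rightarrow> real"
    proof -
      have [measurable]: "R \<in> borel_measurable borel" using R by auto
      have "(\<integral>\<^sup>+x. ennreal (R x / m) \<partial>lborel) = ennreal (LINT x|lborel. R x / m)"
        using R m by (intro nn_integral_eq_integral) auto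
      then have "prob_space (density lborel (\<lambda>x. ennreal (R x / m)))"
        using R m by (intro prob_spaceI) (auto simp: emeasure_density)
      then show ?thesis
        by (simp add: real_distribution_def real_distribution_axioms_def)
    qed
    have ch: "char (density lborel (\<lambda>x. ennreal (R x / m))) t
        = (LINT x|lborel. cis (t * x) * complex_of_real (R x)) / m"
      if R: "integrable lborel R" "\<And>x. 0 \<le> R x" for R :: "real \<Rightarrow> real" and t
    proof -
      have [measurable]: "R \<in> borel_measurable borel" using R by auto
      have "char (density lborel (\<lambda>x. ennreal (R x / m))) t = (LINT x|lborel. (R x / m) *\<^sub>R cis (t * x))"
        unfolding char_def using R m by (subst integral_density) (auto simp: cis_conv_exp)
      also have "\<dots> = (LINT x|lborel. cis (t * x) * complex_of_real (R x) / m)"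
        by (simp add: scaleR_conv_of_real mult_ac)
      finally show ?thesis by simp
    qed
    have "density lborel (\<lambda>x. ennreal (P x / m)) = density lborel (\<lambda>x. ennreal (Q x / m))"
    proof (rule Levy_uniqueness)
      show "char (density lborel (\<lambda>x. ennreal (P x / m))) = char (density lborel (\<lambda>x. ennreal (Q x / m)))"
        using PQ by (intro ext) (simp add: ch P Q P0 Q0)
    qed (use dist P Q P0 Q0 mQ m_def in auto)
    then have "AE x in lborel. ennreal (P x / m) = ennreal (Q x / m)"
      by (subst (asm) sigma_finite_measure.density_unique_iff[OF sigma_finite_lborel]) auto
    then show ?thesis
      by eventually_elim (use m P0 Q0 in \<open>simp add: kPQ\<close>)
  qed
qed

text \<open>The transform of the conjugate is the conjugate at the reflected frequency, hence
  vanishes too. This splits the claim into real and imaginary parts.\<close>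

lemma zero_if_fourier_zero:
  assumes k: "integrable lborel k" and zero: "\<And>\<xi>. fourier k \<xi> = 0"
  shows "AE x in lborel. k x = 0"
proof -
  have [measurable]: "k \<in> borel_measurable borel" using k by auto
  have z: "(LINT x|lborel. cis (\<xi> * x) * k x) = 0" for \<xi>
    using zero[of "- \<xi>"] by (simp add: fourier_eq_cis mult.commute)
  have zc: "(LINT x|lborel. cis (\<xi> * x) * cnj (k x)) = 0" for \<xi>
  proof -
    have "(LINT x|lborel. cis (\<xi> * x) * cnj (k x)) = (LINT x|lborel. cnj (cis (- \<xi> * x) * k x))"
      by (simp add: cis_cnj)
    also have "\<dots> = 0" using z[of "- \<xi>"] unfolding Bochner_Integration.integral_cnj by simp
    finally show ?thesis .
  qed
  have int: "integrable lborel (\<lambda>x. cis (\<xi> * x) * k x)" "integrable lborel (\<lambda>x. cis (\<xi> * x) * cnj (k x))" for \<xi>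
    using k by (auto intro!: integrable_cis_mult)
  have "AE x in lborel. Re (k x) = 0"
  proof (rule real_zero_if_transform_zero)
    fix \<xi>
    have "cis (\<xi> * x) * complex_of_real (Re (k x)) = (1/2) * (cis (\<xi> * x) * k x + cis (\<xi> * x) * cnj (k x))" for x
      unfolding distrib_left[symmetric] complex_add_cnj by simp
    then show "(LINT x|lborel. cis (\<xi> * x) * complex_of_real (Re (k x))) = 0"
      using z zc int by (simp only: integral_mult_right_zero Bochner_Integration.integral_add) simp
  qed (use k in auto)
  moreover have "AE x in lborel. Im (k x) = 0"
  proof (rule real_zero_if_transform_zero)
    fix \<xi>
    have "cis (\<xi> * x) * complex_of_real (Im (k x)) = (1 / (2 * \<i>)) * (cis (\<xi> * x) * k x - cis (\<xi> * x) * cnj (k x))" for x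
      unfolding right_diff_distrib[symmetric] complex_diff_cnj by (simp add: complex_eq_iff)
    then show "(LINT x|lborel. cis (\<xi> * x) * complex_of_real (Im (k x))) = 0"
      using z zc int by (simp only: integral_mult_right_zero Bochner_Integration.integral_diff) simp
  qed (use k in auto)
  ultimately show ?thesis by eventually_elim (simp add: complex_eq_iff)
qed

lemma gauss_L2: "gauss 1 \<in> L2"
proof -
  have "integrable lborel (\<lambda>x::real. exp (- (2 * x\<^sup>2 / 2)) * x ^ 0)"
    by (rule integrable_gaussian_moment) simp
  moreover have "(cmod (gauss 1 x))\<^sup>2 = exp (- (2 * x\<^sup>2 / 2)) * x ^ 0" for x
    unfolding norm_gauss power2_eq_square[of "exp _"] by (simp flip: exp_add)
  ultimately show ?thesis unfolding L2_def by simp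
qed

text \<open>The pairings are the Fourier integrals of the integrable function h *
  \<open>gauss 1\<close>, and the Gaussian factor never vanishes.\<close>

lemma modulated_gauss_orthogonal_imp_zero:
  assumes h: "h \<in> L2"
    and zero: "\<And>b. (LINT y|lborel. h y * (cis (- (b * y)) * gauss 1 y)) = 0"
  shows "AE x in lborel. h x = 0"
proof -
  have "AE x in lborel. h x * gauss 1 x = 0"
  proof (rule zero_if_fourier_zero)
    show "integrable lborel (\<lambda>x. h x * gauss 1 x)" by (rule L2_Cauchy_Schwarz[OF h gauss_L2])
    show "fourier (\<lambda>x. h x * gauss 1 x) \<xi> = 0" for \<xi>
      using zero[of \<xi>] by (simp add: fourier_eq_cis mult_ac)
  qed
  then show ?thesis by eventually_elim (simp add: gauss_def)
qed

lemma fourier_shift: "fourier (\<lambda>x. f (x + b)) \<xi> = cis (b * \<xi>) * fourier f \<xi>"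
proof -
  have "(LINT x|lborel. cis (- (x * \<xi>)) * f x) = (LINT x|lborel. cis (- ((b + x) * \<xi>)) * f (b + x))"
    using lborel_integral_real_affine[of 1 "\<lambda>x. cis (- (x * \<xi>)) * f x" b] by simp
  also have "(\<lambda>x. cis (- ((b + x) * \<xi>)) * f (b + x)) = (\<lambda>x. cis (- (b * \<xi>)) * (cis (- (x * \<xi>)) * f (x + b)))"
    by (simp add: fun_eq_iff mult.assoc[symmetric] cis_mult distrib_right add.commute)
  finally have "(LINT x|lborel. cis (- (x * \<xi>)) * f x) = cis (- (b * \<xi>)) * (LINT x|lborel. cis (- (x * \<xi>)) * f (x + b))"
    by simp
  then show ?thesis
    by (simp add: fourier_eq_cis mult.left_commute[of "cis _" "complex_of_real _"] mult.assoc[symmetric] cis_mult)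
qed

text \<open>On these functions both transforms are absolutely convergent integrals: modulation
  becomes a shift, the shift becomes a modulation, and the Gaussian is fixed.\<close>

lemma fourier_L2_twice_modulated_gauss:
  "AE x in lborel. fourier_L2 (fourier_L2 (\<lambda>y. cis (- (b * y)) * gauss 1 y)) x = cis (- (b * (- x))) * gauss 1 (- x)"
proof -
  let ?g = "\<lambda>y. cis (- (b * y)) * gauss 1 y"
  have g: "?g \<in> L2" "integrable lborel ?g"
    using L2_mult_bounded(1)[OF gauss_L2, of "\<lambda>y. cis (- (b * y))" 1] integrable_cis_mult[OF gauss_integrable(2)[of 1]]
    by auto
  have Fg: "fourier ?g = (\<lambda>\<xi>. gauss 1 (\<xi> + b))"
    using fourier_cis_mult[of "- b" "gauss 1"] fourier_gauss[of 1] by (simp add: fun_eq_iff)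
  have s: "(\<lambda>\<xi>. gauss 1 (\<xi> + b)) \<in> L2" "integrable lborel (\<lambda>\<xi>. gauss 1 (\<xi> + b))"
    using L2_shift(1)[OF gauss_L2, of b] lborel_integrable_real_affine[OF gauss_integrable(2)[of 1], of 1 b]
    by (auto simp: add.commute)
  have "fourier_L2 (fourier_L2 ?g) = fourier_L2 (\<lambda>\<xi>. gauss 1 (\<xi> + b))"
    using fourier_L2_eq_fourier[OF g] unfolding Fg
    by (intro fourier_L2_cong_AE fourier_L2_measurable g) auto
  moreover have "AE x in lborel. fourier_L2 (\<lambda>\<xi>. gauss 1 (\<xi> + b)) x = fourier (\<lambda>\<xi>. gauss 1 (\<xi> + b)) x"
    by (rule fourier_L2_eq_fourier[OF s])
  ultimately show ?thesis
    by (simp add: fourier_shift fourier_gauss) (simp add: gauss_def)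
qed

text \<open>Applying the transform twice is the reflection, because both sides have the same pairings
  with the modulated Gaussians.\<close>

lemma fourier_L2_twice:
  assumes f: "f \<in> L2"
  shows "AE x in lborel. fourier_L2 (fourier_L2 f) x = f (- x)"
proof -
  define h where "h = (\<lambda>x. fourier_L2 (fourier_L2 f) x - f (- x))"
  have TT: "fourier_L2 (fourier_L2 f) \<in> L2" using f by (intro fourier_L2_in_L2)
  have [measurable]: "f \<in> borel_measurable borel" "fourier_L2 (fourier_L2 f) \<in> borel_measurable borel"
    using f TT by (auto intro: L2_measurable)
  have h: "h \<in> L2" unfolding h_def by (intro L2_diff TT L2_reflect f)
  have "AE x in lborel. h x = 0"
  proof (rule modulated_gauss_orthogonal_imp_zero[OF h])
    fix b
    let ?g = "\<lambda>y. cis (- (b * y)) * gauss 1 y"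
    have g: "?g \<in> L2"
      using L2_mult_bounded(1)[OF gauss_L2, of "\<lambda>y. cis (- (b * y))" 1] by auto
    have [measurable]: "fourier_L2 (fourier_L2 ?g) \<in> borel_measurable borel"
      using g by (intro L2_measurable fourier_L2_in_L2)
    \<comment> \<open>Using the multiplication formula twice moves both transforms from f to the
      Gaussian, where the double transform is known explicitly.\<close>
    have "(LINT y|lborel. fourier_L2 (fourier_L2 f) y * ?g y) = (LINT y|lborel. f y * fourier_L2 (fourier_L2 ?g) y)"
      by (simp only: fourier_L2_multiplication_formula[OF fourier_L2_in_L2[OF f] g]
          fourier_L2_multiplication_formula[OF f fourier_L2_in_L2[OF g]])
    also have "\<dots> = (LINT y|lborel. f y * ?g (- y))"
      using fourier_L2_twice_modulated_gauss[of b] by (intro integral_cong_AE) (auto elim!: eventually_mono)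
    also have "\<dots> = (LINT y|lborel. f (- y) * ?g y)"
      using lborel_integral_real_affine[of "-1" "\<lambda>y. f y * ?g (- y)" 0] by simp
    finally have *: "(LINT y|lborel. fourier_L2 (fourier_L2 f) y * ?g y) = (LINT y|lborel. f (- y) * ?g y)" .
    have "(LINT y|lborel. h y * ?g y)
        = (LINT y|lborel. fourier_L2 (fourier_L2 f) y * ?g y) - (LINT y|lborel. f (- y) * ?g y)"
      unfolding h_def left_diff_distrib
      by (intro Bochner_Integration.integral_diff L2_Cauchy_Schwarz(1) TT g L2_reflect f)
    with * show "(LINT y|lborel. h y * ?g y) = 0" by simp
  qed
  then show ?thesis by (simp add: h_def)
qed

text \<open>Two contractions whose composition is an isometric reflection: the norm cannot drop at
  the first of them.\<close>

lemma L2_norm_fourier_L2: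
  assumes f: "f \<in> L2"
  shows "L2_norm (fourier_L2 f) = L2_norm f"
proof (rule antisym[OF fourier_L2_contraction[OF f]])
  have "L2_norm f = L2_norm (\<lambda>x. f (- x))" using L2_reflect[OF f] by simp
  also have "\<dots> = L2_norm (fourier_L2 (fourier_L2 f))"
    using L2_cong(2)[OF L2_reflect(1)[OF f] _ fourier_L2_twice[OF f]] f
    by (simp add: fourier_L2_measurable fourier_L2_in_L2)
  also have "\<dots> \<le> L2_norm (fourier_L2 f)"
    by (intro fourier_L2_contraction fourier_L2_in_L2 f)
  finally show "L2_norm f \<le> L2_norm (fourier_L2 f)" .
qed

lemma AE_reflect: "AE x in lborel. P x \<Longrightarrow> AE x in lborel. P (- x :: real)"
  using AE_lborel_affine[of P "-1" 0] by simp

lemma AE_shift: "AE x in lborel. P x \<Longrightarrow> AE x in lborel. P (x + h :: real)"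
  using AE_lborel_affine[of P 1 h] by (simp add: add.commute)

lemma fourier_L2_reflect:
  assumes f: "f \<in> L2"
  shows "AE \<xi> in lborel. fourier_L2 (\<lambda>x. f (- x)) \<xi> = fourier_L2 f (- \<xi>)"
proof (rule fourier_L2_unique)
  have t: "trunc n (\<lambda>x. f (- x)) = (\<lambda>x. trunc n f (- x))" for n
    by (auto simp: trunc_def fun_eq_iff indicator_def)
  have *: "\<forall>\<^sub>F n in sequentially. (\<lambda>x. fourier (trunc n f) x - fourier_L2 f x) \<in> L2"
    "(\<lambda>n. L2_norm (\<lambda>x. fourier (trunc n f) x - fourier_L2 f x)) \<longlonglongrightarrow> 0"
    using fourier_L2_spec(2)[OF f] by (auto simp: L2_tendsto_def)
  have n: "L2_norm (\<lambda>x. fourier (trunc n f) (- x) - fourier_L2 f (- x)) = L2_norm (\<lambda>x. fourier (trunc n f) x - fourier_L2 f x)" for n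
    using L2_reflect(2)[of "\<lambda>x. fourier (trunc n f) x - fourier_L2 f x"] f
    by (simp add: fourier_contraction trunc_L2 fourier_L2_in_L2)
  show "L2_tendsto (\<lambda>n. fourier (trunc n (\<lambda>x. f (- x)))) (\<lambda>\<xi>. fourier_L2 f (- \<xi>)) sequentially"
    unfolding L2_tendsto_def t fourier_reflect n
    using * L2_reflect(1)[of "\<lambda>x. fourier (trunc _ f) x - fourier_L2 f x"] by (auto elim!: eventually_mono)
qed (use f in \<open>auto intro!: L2_reflect fourier_L2_in_L2\<close>)

lemma fourier_L2_modulate:
  assumes f: "f \<in> L2"
  shows "AE \<xi> in lborel. fourier_L2 (\<lambda>x. cis (- (h * x)) * f x) \<xi> = fourier_L2 f (\<xi> + h)"
proof (rule fourier_L2_unique)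
  have t: "trunc n (\<lambda>x. cis (- (h * x)) * f x) = (\<lambda>x. cis (- h * x) * trunc n f x)" for n
    by (auto simp: trunc_def fun_eq_iff)
  have *: "\<forall>\<^sub>F n in sequentially. (\<lambda>x. fourier (trunc n f) x - fourier_L2 f x) \<in> L2"
    "(\<lambda>n. L2_norm (\<lambda>x. fourier (trunc n f) x - fourier_L2 f x)) \<longlonglongrightarrow> 0"
    using fourier_L2_spec(2)[OF f] by (auto simp: L2_tendsto_def)
  have n: "L2_norm (\<lambda>x. fourier (trunc n f) (x + h) - fourier_L2 f (x + h)) = L2_norm (\<lambda>x. fourier (trunc n f) x - fourier_L2 f x)" for n
    using L2_shift(2)[of "\<lambda>x. fourier (trunc n f) x - fourier_L2 f x" h] f
    by (simp add: fourier_contraction trunc_L2 fourier_L2_in_L2)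
  show "L2_tendsto (\<lambda>n. fourier (trunc n (\<lambda>x. cis (- (h * x)) * f x))) (\<lambda>\<xi>. fourier_L2 f (\<xi> + h)) sequentially"
    unfolding L2_tendsto_def t fourier_cis_mult diff_minus_eq_add n
    using * L2_shift(1)[of "\<lambda>x. fourier (trunc _ f) x - fourier_L2 f x" h] by (auto elim!: eventually_mono)
  show "(\<lambda>x. cis (- (h * x)) * f x) \<in> L2"
    using L2_mult_bounded(1)[OF f, of "\<lambda>x. cis (- (h * x))" 1] by auto
qed (use f in \<open>auto intro!: L2_shift fourier_L2_in_L2\<close>)

lemma inv_fourier_L2_in_L2:
  assumes "g \<in> L2"
  shows "inv_fourier_L2 g \<in> L2" "L2_norm (inv_fourier_L2 g) = L2_norm g"
  unfolding inv_fourier_L2_def[abs_def]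
  using L2_reflect[OF fourier_L2_in_L2[OF assms]] L2_norm_fourier_L2[OF assms] by auto

lemma inv_fourier_L2_fourier_L2:
  assumes "f \<in> L2"
  shows "AE x in lborel. inv_fourier_L2 (fourier_L2 f) x = f x"
  using AE_reflect[OF fourier_L2_twice[OF assms]] by (simp add: inv_fourier_L2_def)

lemma fourier_L2_inv_fourier_L2:
  assumes g: "g \<in> L2"
  shows "AE x in lborel. fourier_L2 (inv_fourier_L2 g) x = g x"
  using fourier_L2_reflect[OF fourier_L2_in_L2[OF g]] AE_reflect[OF fourier_L2_twice[OF g]]
  by eventually_elim (simp add: inv_fourier_L2_def[abs_def])

lemma fourier_L2_eqD:
  assumes "f \<in> L2" "g \<in> L2" "AE \<xi> in lborel. fourier_L2 f \<xi> = fourier_L2 g \<xi>"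
  shows "AE x in lborel. f x = g x"
proof -
  have "inv_fourier_L2 (fourier_L2 f) = inv_fourier_L2 (fourier_L2 g)"
    using fourier_L2_cong_AE[OF _ _ assms(3)] assms by (simp add: inv_fourier_L2_def fun_eq_iff fourier_L2_measurable)
  then have *: "inv_fourier_L2 (fourier_L2 f) x = inv_fourier_L2 (fourier_L2 g) x" for x by simp
  show ?thesis
    using inv_fourier_L2_fourier_L2[OF assms(1)] inv_fourier_L2_fourier_L2[OF assms(2)]
    by eventually_elim (use * in simp)
qed

lemma fourier_mult_L2:
  assumes "(\<lambda>\<xi>. a \<xi> * fourier_L2 f \<xi>) \<in> L2"
  shows "fourier_mult a f \<in> L2" "AE \<xi> in lborel. fourier_L2 (fourier_mult a f) \<xi> = a \<xi> * fourier_L2 f \<xi>"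
  unfolding fourier_mult_def using inv_fourier_L2_in_L2[OF assms] fourier_L2_inv_fourier_L2[OF assms] by auto

section \<open>Weights as L2 Lipschitz constants of the transform\<close>

lemma norm_cis_minus_1: "cmod (cis a - 1) \<le> \<bar>a\<bar>"
proof -
  have "cmod (iexp a - (\<Sum>k\<le>0. (\<i> * complex_of_real a)^k / fact k)) \<le> \<bar>a\<bar>^(Suc 0) / fact (Suc 0)"
    by (rule iexp_approx1)
  then show ?thesis by (simp add: cis_conv_exp)
qed

text \<open>A shift of the transform is a modulation of f, so by Plancherel the increment in
  frequency is measured by a bounded multiplier in x.\<close>

lemma fourier_L2_difference:
  assumes f: "f \<in> L2"
  shows "(\<lambda>x. (cis (- (h * x)) - 1) * f x) \<in> L2"
    "L2_norm (\<lambda>\<xi>. fourier_L2 f (\<xi> + h) - fourier_L2 f \<xi>) = L2_norm (\<lambda>x. (cis (- (h * x)) - 1) * f x)"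
proof -
  have c: "(\<lambda>x. cis (- (h * x)) * f x) \<in> L2"
    using L2_mult_bounded(1)[OF f, of "\<lambda>x. cis (- (h * x))" 1] by auto
  show d: "(\<lambda>x. (cis (- (h * x)) - 1) * f x) \<in> L2"
    using L2_diff[OF c f] by (simp add: left_diff_distrib)
  have T: "fourier_L2 f \<in> L2" by (rule fourier_L2_in_L2[OF f])
  have "AE \<xi> in lborel. fourier_L2 f (\<xi> + h) - fourier_L2 f \<xi> = fourier_L2 (\<lambda>x. (cis (- (h * x)) - 1) * f x) \<xi>"
    using fourier_L2_diff[OF c f] fourier_L2_modulate[OF f, of h]
    by eventually_elim (simp add: left_diff_distrib)
  then have "L2_norm (\<lambda>\<xi>. fourier_L2 f (\<xi> + h) - fourier_L2 f \<xi>) = L2_norm (fourier_L2 (\<lambda>x. (cis (- (h * x)) - 1) * f x))"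
    by (rule L2_cong(2)[OF fourier_L2_in_L2[OF d] L2_measurable[OF L2_diff[OF L2_shift(1)[OF T] T]]])
  then show "L2_norm (\<lambda>\<xi>. fourier_L2 f (\<xi> + h) - fourier_L2 f \<xi>) = L2_norm (\<lambda>x. (cis (- (h * x)) - 1) * f x)"
    by (simp add: L2_norm_fourier_L2[OF d])
qed

abbreviation xmul :: "(real \<Rightarrow> complex) \<Rightarrow> real \<Rightarrow> complex" where
  "xmul f \<equiv> (\<lambda>x. complex_of_real x * f x)"

lemma fourier_L2_lipschitz:
  assumes f: "f \<in> L2" and xf: "xmul f \<in> L2"
  shows "L2_norm (\<lambda>\<xi>. fourier_L2 f (\<xi> + h) - fourier_L2 f \<xi>) \<le> \<bar>h\<bar> * L2_norm (xmul f)"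
  unfolding fourier_L2_difference(2)[OF f]
proof (rule L2_dominated(2)[OF xf])
  show "AE x in lborel. cmod ((cis (- (h * x)) - 1) * f x) \<le> \<bar>h\<bar> * cmod (xmul f x)"
  proof (rule AE_I2)
    fix x
    have "cmod (cis (- (h * x)) - 1) * cmod (f x) \<le> \<bar>- (h * x)\<bar> * cmod (f x)"
      by (intro mult_right_mono norm_cis_minus_1) simp
    then show "cmod ((cis (- (h * x)) - 1) * f x) \<le> \<bar>h\<bar> * cmod (xmul f x)"
      by (simp add: norm_mult abs_mult mult.assoc)
  qed
qed (use L2_measurable[OF fourier_L2_difference(1)[OF f]] in auto)

text \<open>The normalized difference quotients converge pointwise to x f with bounded norms, so
  Fatou applies. The summand \<open>h * C'\<close> admits a second order error, as the quadratic
  phase of the free group produces one, without affecting the constant C.\<close>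

lemma weighted_if_fourier_L2_lipschitz:
  assumes f: "f \<in> L2" and C: "0 \<le> C"
    and lip: "\<And>h. 0 < h \<Longrightarrow> h \<le> 1 \<Longrightarrow> L2_norm (\<lambda>\<xi>. fourier_L2 f (\<xi> + h) - fourier_L2 f \<xi>) \<le> h * (C + h * C')"
  shows "xmul f \<in> L2" "L2_norm (xmul f) \<le> C"
proof -
  have [measurable]: "f \<in> borel_measurable borel" using f by (rule L2_measurable)
  define h where "h = (\<lambda>n. 1 / real (Suc n))"
  have h: "0 < h n" "h n \<le> 1" for n by (auto simp: h_def)
  have hlim: "h \<longlonglongrightarrow> 0"
    unfolding h_def using LIMSEQ_inverse_real_of_nat by (simp add: inverse_eq_divide)
  \<comment> \<open>(exp(-ihx) - 1)/h tends to -ix, and the factor i turns this limit into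
    x.\<close>
  define s where "s = (\<lambda>n x. (\<i> / h n) * ((cis (- (h n * x)) - 1) * f x))"
  have s: "s n \<in> L2" for n unfolding s_def by (intro L2_cmult fourier_L2_difference(1) f)
  have sn: "L2_norm (s n) \<le> C + h n * C'" for n
  proof -
    have "L2_norm (s n) = (1 / h n) * L2_norm (\<lambda>\<xi>. fourier_L2 f (\<xi> + h n) - fourier_L2 f \<xi>)"
      unfolding s_def L2_norm_cmult fourier_L2_difference(2)[OF f] using h[of n] by (simp add: norm_divide)
    also have "\<dots> \<le> (1 / h n) * (h n * (C + h n * C'))"
      using h[of n] lip[of "h n"] by (intro mult_left_mono) auto
    finally show ?thesis using h[of n] by simp
  qed
  have lim: "(\<lambda>n. s n x) \<longlonglongrightarrow> xmul f x" for x
  proof -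
    have "((\<lambda>y. cis (- (y * x))) has_vector_derivative (- x) *\<^sub>R (\<i> * cis (- (0 * x)))) (at 0)"
      unfolding has_vector_derivative_def by (auto intro!: derivative_eq_intros simp: scaleR_conv_of_real)
    then have "((\<lambda>y. (cis (- (y * x)) - 1) / complex_of_real y) \<longlongrightarrow> (- x) *\<^sub>R \<i>) (at 0)"
      unfolding has_vector_derivative_iff_quotient by simp
    moreover have "filterlim h (at 0) sequentially"
      using hlim h by (intro filterlim_atI) (auto simp: less_imp_neq[symmetric] intro!: always_eventually)
    ultimately have "(\<lambda>n. (cis (- (h n * x)) - 1) / complex_of_real (h n)) \<longlonglongrightarrow> (- x) *\<^sub>R \<i>"
      by (rule filterlim_compose)
    from tendsto_mult_right[OF tendsto_mult_left[OF this, of \<i>], of "f x"]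
    show ?thesis by (simp add: s_def scaleR_conv_of_real mult.assoc) (simp add: mult.left_commute mult.commute)
  qed
  have main: "xmul f \<in> L2 \<and> L2_norm (xmul f) \<le> C + e" if e: "0 < e" for e
  proof -
    have "(\<lambda>n. C + h n * C') \<longlonglongrightarrow> C + 0 * C'" by (intro tendsto_intros hlim)
    then have "\<forall>\<^sub>F n in sequentially. C + h n * C' < C + e" using e by (intro order_tendstoD(2)) auto
    then have ev: "\<forall>\<^sub>F n in sequentially. L2_norm (s n) \<le> C + e"
      by eventually_elim (meson sn order_trans less_imp_le)
    show ?thesis using L2_fatou[OF s _ _ ev, of "xmul f"] lim C e by auto
  qed
  show "xmul f \<in> L2" using main[of 1] by simp
  show "L2_norm (xmul f) \<le> C" by (rule field_le_epsilon) (use main in blast)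
qed

lemma xmul_reflect:
  assumes "xmul f \<in> L2"
  shows "xmul (\<lambda>x. f (- x)) \<in> L2" "L2_norm (xmul (\<lambda>x. f (- x))) = L2_norm (xmul f)"
  using L2_uminus[OF L2_reflect(1)[OF assms]] L2_reflect(2)[OF assms]
    L2_norm_uminus[of "\<lambda>x. complex_of_real (- x) * f (- x)"] by auto

lemma xmul_inv_fourier_L2:
  "xmul (inv_fourier_L2 g) \<in> L2 \<longleftrightarrow> xmul (fourier_L2 g) \<in> L2"
  "xmul (fourier_L2 g) \<in> L2 \<Longrightarrow> L2_norm (xmul (inv_fourier_L2 g)) = L2_norm (xmul (fourier_L2 g))"
  using xmul_reflect[of "fourier_L2 g"] xmul_reflect[of "inv_fourier_L2 g"]
  by (auto simp: inv_fourier_L2_def[abs_def])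

lemma L2_difference_cong:
  assumes f: "f \<in> L2" and g: "g \<in> L2" and eq: "AE x in lborel. f x = g x"
  shows "L2_norm (\<lambda>x. f (x + h) - f x) = L2_norm (\<lambda>x. g (x + h) - g x)"
proof (rule L2_cong(2)[OF L2_diff[OF L2_shift(1)[OF g] g] L2_measurable[OF L2_diff[OF L2_shift(1)[OF f] f]]])
  show "AE x in lborel. f (x + h) - f x = g (x + h) - g x"
    using eq AE_shift[OF eq, of h] by eventually_elim simp
qed

lemma lipschitz_if_weighted_transform:
  assumes g: "g \<in> L2" and xg: "xmul (fourier_L2 g) \<in> L2"
  shows "L2_norm (\<lambda>x. g (x + h) - g x) \<le> \<bar>h\<bar> * L2_norm (xmul (fourier_L2 g))"
  using fourier_L2_lipschitz[OF inv_fourier_L2_in_L2(1)[OF g], of h] xmul_inv_fourier_L2[of g] xg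
    L2_difference_cong[OF fourier_L2_in_L2[OF inv_fourier_L2_in_L2(1)[OF g]] g fourier_L2_inv_fourier_L2[OF g], of h]
  by simp

text \<open>The previous criterion for \<open>inv_fourier_L2 g\<close>, whose transform is g. It
  suits the nonlinearity, for which increments are easy to estimate and derivatives are
  avoided.\<close>

lemma weighted_transform_if_lipschitz:
  assumes g: "g \<in> L2" and C: "0 \<le> C"
    and lip: "\<And>h. 0 < h \<Longrightarrow> h \<le> 1 \<Longrightarrow> L2_norm (\<lambda>x. g (x + h) - g x) \<le> h * (C + h * C')"
  shows "xmul (fourier_L2 g) \<in> L2" "L2_norm (xmul (fourier_L2 g)) \<le> C"
proof -
  have *: "L2_norm (\<lambda>\<xi>. fourier_L2 (inv_fourier_L2 g) (\<xi> + h) - fourier_L2 (inv_fourier_L2 g) \<xi>) \<le> h * (C + h * C')"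
    if "0 < h" "h \<le> 1" for h
    using lip[OF that] L2_difference_cong[OF fourier_L2_in_L2[OF inv_fourier_L2_in_L2(1)[OF g]] g fourier_L2_inv_fourier_L2[OF g], of h]
    by simp
  note w = weighted_if_fourier_L2_lipschitz[OF inv_fourier_L2_in_L2(1)[OF g] C *]
  then show "xmul (fourier_L2 g) \<in> L2" using xmul_inv_fourier_L2(1)[of g] by simp
  then show "L2_norm (xmul (fourier_L2 g)) \<le> C" using w xmul_inv_fourier_L2(2)[of g] by simp
qed

subsection \<open>The cubic nonlinearity\<close>

lemma L2_norm_of_real_cmod:
  assumes "f \<in> L2"
  shows "(\<lambda>x. complex_of_real (cmod (f x))) \<in> L2" "L2_norm (\<lambda>x. complex_of_real (cmod (f x))) = L2_norm f"
  using assms by (auto simp: L2_def L2_norm_def)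

lemma L2_dominated2:
  assumes f: "f \<in> L2" and g: "g \<in> L2" and k: "k \<in> borel_measurable borel" and "0 \<le> a" "0 \<le> b"
    and le: "AE x in lborel. cmod (k x) \<le> a * cmod (f x) + b * cmod (g x)"
  shows "k \<in> L2" "L2_norm k \<le> a * L2_norm f + b * L2_norm g"
proof -
  let ?f = "\<lambda>x. complex_of_real a * complex_of_real (cmod (f x))"
  let ?g = "\<lambda>x. complex_of_real b * complex_of_real (cmod (g x))"
  have fg: "?f \<in> L2" "?g \<in> L2" using L2_norm_of_real_cmod f g by auto
  have le': "AE x in lborel. cmod (k x) \<le> 1 * cmod (?f x + ?g x)"
    using le
  proof eventually_elim
    case (elim x)
    have "cmod (?f x + ?g x) = a * cmod (f x) + b * cmod (g x)"
      using \<open>0 \<le> a\<close> \<open>0 \<le> b\<close> by (simp flip: of_real_add of_real_mult)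
    with elim show ?case by simp
  qed
  note d = L2_dominated[OF L2_add[OF fg] k _ le']
  show "k \<in> L2" using d by simp
  have "L2_norm k \<le> L2_norm (\<lambda>x. ?f x + ?g x)" using d by simp
  also have "\<dots> \<le> L2_norm ?f + L2_norm ?g" by (rule L2_triangle[OF fg])
  finally show "L2_norm k \<le> a * L2_norm f + b * L2_norm g"
    using f g \<open>0 \<le> a\<close> \<open>0 \<le> b\<close> by (simp add: L2_norm_cmult L2_norm_of_real_cmod)
qed

lemma damping_measurable [measurable]:
  "v \<in> borel_measurable borel \<Longrightarrow> u \<in> borel_measurable borel \<Longrightarrow> damping v u \<in> borel_measurable borel"
  unfolding damping_def[abs_def] by measurable

lemma damping_L2:
  assumes u: "u \<in> L2" and v: "v \<in> borel_measurable borel" and B: "AE x in lborel. cmod (v x) \<le> B"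
  shows "damping v u \<in> L2" "L2_norm (damping v u) \<le> B\<^sup>2 * L2_norm u"
proof -
  have "AE x in lborel. cmod (damping v u x) \<le> B\<^sup>2 * cmod (u x)"
    using B by eventually_elim (auto simp: damping_def norm_mult norm_power intro!: mult_right_mono power_mono)
  then show "damping v u \<in> L2" "L2_norm (damping v u) \<le> B\<^sup>2 * L2_norm u"
    using L2_dominated[OF u, of "damping v u" "B\<^sup>2"] v L2_measurable[OF u] by auto
qed

text \<open>The factor 2 comes from |c|^2 - |d|^2 = (|c| - |d|)(|c| + |d|). The bound is used for
  spatial increments of the nonlinearity and for replacing one pair of transforms by another in the
  cubic main term.\<close>

lemma cubic_difference:
  assumes B: "cmod a \<le> B" "cmod b \<le> B" "cmod c \<le> B" "cmod d \<le> B"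
  shows "cmod (complex_of_real ((cmod c)\<^sup>2) * a - complex_of_real ((cmod d)\<^sup>2) * b)
    \<le> B\<^sup>2 * (cmod (a - b) + 2 * cmod (c - d))"
proof -
  have B0: "0 \<le> B" using B(1) norm_ge_zero order_trans by blast
  have "complex_of_real ((cmod c)\<^sup>2) * a - complex_of_real ((cmod d)\<^sup>2) * b
    = complex_of_real ((cmod c)\<^sup>2) * (a - b) + complex_of_real ((cmod c)\<^sup>2 - (cmod d)\<^sup>2) * b"
    by (simp add: algebra_simps)
  then have "cmod (complex_of_real ((cmod c)\<^sup>2) * a - complex_of_real ((cmod d)\<^sup>2) * b)
    \<le> (cmod c)\<^sup>2 * cmod (a - b) + \<bar>(cmod c)\<^sup>2 - (cmod d)\<^sup>2\<bar> * cmod b"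
    using norm_triangle_ineq[of "complex_of_real ((cmod c)\<^sup>2) * (a - b)" "complex_of_real ((cmod c)\<^sup>2 - (cmod d)\<^sup>2) * b"]
    by (simp add: norm_mult norm_power del: of_real_diff of_real_power)
  also have "\<dots> \<le> B\<^sup>2 * cmod (a - b) + (cmod (c - d) * (2 * B)) * B"
  proof (intro add_mono mult_right_mono mult_mono)
    show "(cmod c)\<^sup>2 \<le> B\<^sup>2" using B by (intro power_mono) auto
    have "(cmod c)\<^sup>2 - (cmod d)\<^sup>2 = (cmod c - cmod d) * (cmod c + cmod d)"
      by (simp add: power2_eq_square algebra_simps)
    then have "\<bar>(cmod c)\<^sup>2 - (cmod d)\<^sup>2\<bar> = \<bar>cmod c - cmod d\<bar> * (cmod c + cmod d)"
      by (simp add: abs_mult)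
    also have "\<dots> \<le> cmod (c - d) * (2 * B)"
      using B by (intro mult_mono norm_triangle_ineq3) auto
    finally show "\<bar>(cmod c)\<^sup>2 - (cmod d)\<^sup>2\<bar> \<le> cmod (c - d) * (2 * B)" .
  qed (use B B0 in auto)
  finally show ?thesis by (simp add: algebra_simps power2_eq_square)
qed

lemma damping_difference:
  assumes u: "u \<in> L2" and v: "v \<in> L2" and B: "AE x in lborel. cmod (u x) \<le> B" "AE x in lborel. cmod (v x) \<le> B"
  shows "L2_norm (\<lambda>x. damping v u (x + h) - damping v u x)
    \<le> B\<^sup>2 * (L2_norm (\<lambda>x. u (x + h) - u x) + 2 * L2_norm (\<lambda>x. v (x + h) - v x))"
proof -
  have [measurable]: "u \<in> borel_measurable borel" "v \<in> borel_measurable borel"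
    using u v by (auto intro: L2_measurable)
  have ae: "AE x in lborel. cmod (damping v u (x + h) - damping v u x)
      \<le> B\<^sup>2 * cmod (u (x + h) - u x) + (2 * B\<^sup>2) * cmod (v (x + h) - v x)"
    using B AE_shift[OF B(1), of h] AE_shift[OF B(2), of h]
  proof eventually_elim
    case (elim x)
    show ?case
      using cubic_difference[OF elim(3,1,4,2)] by (simp add: damping_def algebra_simps)
  qed
  have "L2_norm (\<lambda>x. damping v u (x + h) - damping v u x)
    \<le> B\<^sup>2 * L2_norm (\<lambda>x. u (x + h) - u x) + (2 * B\<^sup>2) * L2_norm (\<lambda>x. v (x + h) - v x)"
    by (rule L2_dominated2(2)[OF L2_diff[OF L2_shift(1)[OF u] u] L2_diff[OF L2_shift(1)[OF v] v] _ _ _ ae]) auto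
  then show ?thesis by (simp add: algebra_simps)
qed

text \<open>Applied on two levels: to the solutions themselves it controls the frequency weight of
  the nonlinearity; to the transforms \<open>fourier (chirp t v)\<close> it controls the spatial
  weight in the interaction picture.\<close>

lemma weighted_transform_damping:
  assumes u: "u \<in> L2" and v: "v \<in> L2" and B: "AE x in lborel. cmod (u x) \<le> B" "AE x in lborel. cmod (v x) \<le> B"
    and w: "xmul (fourier_L2 u) \<in> L2" "xmul (fourier_L2 v) \<in> L2"
  shows "xmul (fourier_L2 (damping v u)) \<in> L2"
    "L2_norm (xmul (fourier_L2 (damping v u))) \<le> B\<^sup>2 * (L2_norm (xmul (fourier_L2 u)) + 2 * L2_norm (xmul (fourier_L2 v)))"
proof -
  let ?C = "B\<^sup>2 * (L2_norm (xmul (fourier_L2 u)) + 2 * L2_norm (xmul (fourier_L2 v)))"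
  have "L2_norm (\<lambda>x. damping v u (x + h) - damping v u x) \<le> h * (?C + h * 0)" if "0 < h" "h \<le> 1" for h
  proof -
    have "L2_norm (\<lambda>x. damping v u (x + h) - damping v u x)
      \<le> B\<^sup>2 * (L2_norm (\<lambda>x. u (x + h) - u x) + 2 * L2_norm (\<lambda>x. v (x + h) - v x))"
      by (rule damping_difference[OF u v B])
    also have "\<dots> \<le> B\<^sup>2 * (\<bar>h\<bar> * L2_norm (xmul (fourier_L2 u)) + 2 * (\<bar>h\<bar> * L2_norm (xmul (fourier_L2 v))))"
      by (intro mult_left_mono add_mono lipschitz_if_weighted_transform u v w) auto
    also have "\<dots> = h * (?C + h * 0)" using that by (simp add: algebra_simps)
    finally show ?thesis .
  qed
  from weighted_transform_if_lipschitz[OF damping_L2(1)[OF u L2_measurable[OF v] B(2)] _ this]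
  show "xmul (fourier_L2 (damping v u)) \<in> L2" "L2_norm (xmul (fourier_L2 (damping v u))) \<le> ?C"
    by auto
qed

subsection \<open>The free group\<close>

lemma schroedinger_eq: "schroedinger t = fourier_mult (\<lambda>\<xi>. cis (- (t * \<xi>\<^sup>2 / 2)))"
  unfolding schroedinger_def exp_minus_ii_eq_cis ..

lemma cis_mult_L2:
  assumes "f \<in> L2" and [measurable]: "g \<in> borel_measurable borel"
  shows "(\<lambda>x. cis (g x) * f x) \<in> L2" "L2_norm (\<lambda>x. cis (g x) * f x) = L2_norm f"
proof -
  show 1: "(\<lambda>x. cis (g x) * f x) \<in> L2" using L2_mult_bounded(1)[OF assms(1), of "\<lambda>x. cis (g x)" 1] by auto
  show "L2_norm (\<lambda>x. cis (g x) * f x) = L2_norm f" by (simp add: L2_norm_def norm_mult)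
qed

lemma schroedinger_L2:
  assumes f: "f \<in> L2"
  shows "schroedinger t f \<in> L2" "L2_norm (schroedinger t f) = L2_norm f"
    "AE \<xi> in lborel. fourier_L2 (schroedinger t f) \<xi> = cis (- (t * \<xi>\<^sup>2 / 2)) * fourier_L2 f \<xi>"
proof -
  note c = cis_mult_L2[OF fourier_L2_in_L2[OF f], of "\<lambda>\<xi>. - (t * \<xi>\<^sup>2 / 2)"]
  show "schroedinger t f \<in> L2"
    "AE \<xi> in lborel. fourier_L2 (schroedinger t f) \<xi> = cis (- (t * \<xi>\<^sup>2 / 2)) * fourier_L2 f \<xi>"
    unfolding schroedinger_eq using c by (auto intro!: fourier_mult_L2)
  show "L2_norm (schroedinger t f) = L2_norm f"
    unfolding schroedinger_eq fourier_mult_def using c inv_fourier_L2_in_L2 L2_norm_fourier_L2[OF f] by simp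
qed

lemma schroedinger_cong_AE:
  assumes "f \<in> L2" "g \<in> L2" "AE x in lborel. f x = g x"
  shows "schroedinger t f = schroedinger t g"
  unfolding schroedinger_eq fourier_mult_def
  using fourier_L2_cong_AE[OF _ _ assms(3)] L2_measurable assms by simp

lemma schroedinger_inverse:
  assumes f: "f \<in> L2"
  shows "AE x in lborel. schroedinger (- t) (schroedinger t f) x = f x"
proof (rule fourier_L2_eqD)
  show "AE \<xi> in lborel. fourier_L2 (schroedinger (- t) (schroedinger t f)) \<xi> = fourier_L2 f \<xi>"
    using schroedinger_L2(3)[OF f, of t] schroedinger_L2(3)[OF schroedinger_L2(1)[OF f], of "- t" t]
    by eventually_elim (simp add: mult.assoc[symmetric] cis_mult)
qed (use f schroedinger_L2 in auto)

text \<open>The modulation M of the factorization; negative t gives its inverse.\<close>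

definition chirp :: "real \<Rightarrow> (real \<Rightarrow> complex) \<Rightarrow> real \<Rightarrow> complex" where
  "chirp t v x = cis (x\<^sup>2 / (2 * t)) * v x"

lemma chirp_L2:
  assumes v: "v \<in> L2"
  shows "chirp t v \<in> L2" "L2_norm (chirp t v) = L2_norm v"
  unfolding chirp_def[abs_def] using cis_mult_L2[OF v, of "\<lambda>x. x\<^sup>2 / (2 * t)"] by auto

lemma chirp_xmul:
  assumes v: "xmul v \<in> L2"
  shows "xmul (chirp t v) \<in> L2" "L2_norm (xmul (chirp t v)) = L2_norm (xmul v)"
proof -
  have "xmul (chirp t v) = (\<lambda>x. cis (x\<^sup>2 / (2 * t)) * xmul v x)"
    by (simp add: chirp_def fun_eq_iff)
  then show "xmul (chirp t v) \<in> L2" "L2_norm (xmul (chirp t v)) = L2_norm (xmul v)"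
    using cis_mult_L2[OF v, of "\<lambda>x. x\<^sup>2 / (2 * t)"] by auto
qed

lemma chirp_chirp: "chirp t (chirp (- t) v) = v" "chirp (- t) (chirp t v) = v"
  by (simp_all add: chirp_def fun_eq_iff mult.assoc[symmetric] cis_mult)

lemma chirp_cmult: "chirp t (\<lambda>x. c * v x) = (\<lambda>x. c * chirp t v x)"
  by (simp add: chirp_def fun_eq_iff)

lemma norm_gauss_le_1: "0 \<le> Re z \<Longrightarrow> cmod (gauss z x) \<le> 1"
  by (simp add: norm_gauss)

lemma Re_inverse_nonneg: "0 \<le> Re z \<Longrightarrow> 0 \<le> Re (1 / z)"
  by (simp add: Re_divide)

lemma norm_csqrt: "cmod (csqrt z) = sqrt (cmod z)"
proof -
  have "(cmod (csqrt z))\<^sup>2 = cmod z" by (simp flip: norm_power)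
  then show ?thesis by (metis norm_ge_zero real_sqrt_unique)
qed

text \<open>The multiplier $e^{-it\xi^2/2}$ is approximated by Gaussians with parameter $\delta + it$,
  $\delta \to 0$.\<close>

lemma schroedinger_factorization:
  assumes v: "v \<in> L2" "integrable lborel v" and t: "0 < t"
  shows "AE x in lborel. schroedinger t v x
    = cis (x\<^sup>2 / (2 * t)) / csqrt (\<i> * t) * fourier (chirp t v) (x / t)"
proof -
  have [measurable]: "v \<in> borel_measurable borel" using v by auto
  define d where "d = (\<lambda>n. 1 / real (Suc n))"
  have d: "0 < d n" for n by (auto simp: d_def)
  have dlim: "d \<longlonglongrightarrow> 0" unfolding d_def using LIMSEQ_inverse_real_of_nat by (simp add: inverse_eq_divide)
  define z where "z = (\<lambda>n. complex_of_real (d n) + \<i> * complex_of_real t)"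
  have Rez: "Re (z n) = d n" and Imz: "Im (z n) = t" for n by (auto simp: z_def)
  have zlim: "z \<longlonglongrightarrow> \<i> * complex_of_real t"
    unfolding z_def using tendsto_add[OF tendsto_of_real[OF dlim] tendsto_const, of "\<i> * complex_of_real t"] by simp
  have it: "\<i> * complex_of_real t \<noteq> 0" "\<i> * complex_of_real t \<notin> \<real>\<^sub>\<le>\<^sub>0"
    using t by (auto simp: complex_nonpos_Reals_iff)
  define k where "k = (\<lambda>\<xi>. gauss (\<i> * complex_of_real t) \<xi> * fourier v \<xi>)"
  define K where "K = (\<lambda>n \<xi>. gauss (z n) \<xi> * fourier v \<xi>)"
  have Fv: "fourier v \<in> L2" using fourier_contraction v by blast
  have k: "k \<in> L2" unfolding k_def
    by (rule L2_mult_bounded(1)[OF Fv, of _ 1]) (auto intro!: norm_gauss_le_1)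
  have K: "K n \<in> L2" for n unfolding K_def
    by (rule L2_mult_bounded(1)[OF Fv, of _ 1]) (auto intro!: norm_gauss_le_1 simp: Rez less_imp_le[OF d])
  have KI: "integrable lborel (K n)" for n
  proof -
    obtain C where C: "0 \<le> C" "\<And>\<xi>. cmod (fourier v \<xi>) \<le> C" using fourier_bounded[OF v(2)] by blast
    show ?thesis unfolding K_def
    proof (rule Bochner_Integration.integrable_bound)
      show "integrable lborel (\<lambda>\<xi>. gauss (z n) \<xi> * complex_of_real C)"
        using gauss_integrable(2)[of "z n"] d[of n] by (simp add: Rez)
      show "AE \<xi> in lborel. norm (gauss (z n) \<xi> * fourier v \<xi>) \<le> norm (gauss (z n) \<xi> * complex_of_real C)"
        using C by (auto simp: norm_mult intro!: mult_left_mono)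
    qed auto
  qed
  have Kk: "(\<lambda>n. L2_norm (\<lambda>\<xi>. K n \<xi> - k \<xi>)) \<longlonglongrightarrow> 0"
  proof (rule L2_dominated_convergence)
    show "(\<lambda>\<xi>. 2 * fourier v \<xi>) \<in> L2" using Fv by simp
    show "AE \<xi> in lborel. cmod (K n \<xi> - k \<xi>) \<le> cmod (2 * fourier v \<xi>)" for n
    proof (rule AE_I2)
      fix \<xi>
      have "cmod (gauss (z n) \<xi> - gauss (\<i> * complex_of_real t) \<xi>) \<le> cmod (gauss (z n) \<xi>) + cmod (gauss (\<i> * complex_of_real t) \<xi>)"
        by (rule norm_triangle_ineq4)
      also have "\<dots> \<le> 1 + 1" by (intro add_mono norm_gauss_le_1) (auto simp: Rez less_imp_le[OF d])
      finally have "cmod (gauss (z n) \<xi> - gauss (\<i> * complex_of_real t) \<xi>) * cmod (fourier v \<xi>) \<le> 2 * cmod (fourier v \<xi>)"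
        by (intro mult_right_mono) auto
      then show "cmod (K n \<xi> - k \<xi>) \<le> cmod (2 * fourier v \<xi>)"
        by (simp add: K_def k_def norm_mult flip: left_diff_distrib)
    qed
    show "AE \<xi> in lborel. (\<lambda>n. K n \<xi>) \<longlonglongrightarrow> k \<xi>"
      unfolding K_def k_def gauss_def by (intro AE_I2 tendsto_intros zlim) auto
  qed (auto simp: K_def k_def)
  \<comment> \<open>The undamped kernel integral. Passage to it is dominated because Re (1/z) \<ge>
    0 bounds the Gaussian by 1 and Im z = t gives |\<open>csqrt\<close> z| \<ge> sqrt t.\<close>
  define L where "L = (\<lambda>x. complex_of_real (1 / sqrt (2 * pi)) *
      (LINT y|lborel. v y * (gauss (1 / (\<i> * complex_of_real t)) (x + y) / csqrt (\<i> * complex_of_real t))))"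
  have Lm[measurable]: "L \<in> borel_measurable borel" unfolding L_def by measurable
  have lim: "(\<lambda>n. fourier (K n) x) \<longlonglongrightarrow> L x" for x
  proof -
    have eq: "fourier (K n) x = complex_of_real (1 / sqrt (2 * pi)) *
        (LINT y|lborel. v y * (gauss (1 / z n) (x + y) / csqrt (z n)))" for n
      unfolding K_def by (rule fourier_gauss_mult_fourier[OF v(2)]) (simp add: Rez d)
    have "(\<lambda>n. LINT y|lborel. v y * (gauss (1 / z n) (x + y) / csqrt (z n))) \<longlonglongrightarrow>
      (LINT y|lborel. v y * (gauss (1 / (\<i> * complex_of_real t)) (x + y) / csqrt (\<i> * complex_of_real t)))"
    proof (rule integral_dominated_convergence[where w = "\<lambda>y. (1 / sqrt t) * cmod (v y)"])
      show "AE y in lborel. (\<lambda>n. v y * (gauss (1 / z n) (x + y) / csqrt (z n))) \<longlonglongrightarrow>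
        v y * (gauss (1 / (\<i> * complex_of_real t)) (x + y) / csqrt (\<i> * complex_of_real t))"
        unfolding gauss_def using it
        by (intro AE_I2 tendsto_intros zlim isCont_tendsto_compose[OF continuous_at_csqrt]) auto
      show "AE y in lborel. norm (v y * (gauss (1 / z n) (x + y) / csqrt (z n))) \<le> (1 / sqrt t) * cmod (v y)" for n
      proof (rule AE_I2)
        fix y
        have "t \<le> cmod (z n)" using abs_Im_le_cmod[of "z n"] Imz by simp
        then have "sqrt t \<le> cmod (csqrt (z n))" by (simp add: norm_csqrt)
        moreover have "cmod (gauss (1 / z n) (x + y)) \<le> 1"
          by (intro norm_gauss_le_1 Re_inverse_nonneg) (simp add: Rez less_imp_le[OF d])
        ultimately have "cmod (gauss (1 / z n) (x + y)) / cmod (csqrt (z n)) \<le> 1 / sqrt t"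
          using t by (intro frac_le) auto
        then have "cmod (v y) * (cmod (gauss (1 / z n) (x + y)) / cmod (csqrt (z n))) \<le> cmod (v y) * (1 / sqrt t)"
          by (intro mult_left_mono) auto
        then show "norm (v y * (gauss (1 / z n) (x + y) / csqrt (z n))) \<le> (1 / sqrt t) * cmod (v y)"
          by (simp add: norm_mult norm_divide)
      qed
    qed (use v in auto)
    then show ?thesis unfolding eq L_def by (intro tendsto_intros)
  qed
  have Tk: "fourier_L2 k \<in> L2" by (rule fourier_L2_in_L2[OF k])
  have sL: "(\<lambda>x. fourier (K n) x - fourier_L2 k x) \<in> L2" for n
    using Tk fourier_contraction(1)[OF KI K] by auto
  have sn: "L2_norm (\<lambda>x. fourier (K n) x - fourier_L2 k x) = L2_norm (\<lambda>\<xi>. K n \<xi> - k \<xi>)" for n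
  proof -
    have "AE x in lborel. fourier (K n) x - fourier_L2 k x = fourier_L2 (\<lambda>\<xi>. K n \<xi> - k \<xi>) x"
      using fourier_L2_diff[OF K k, of n] fourier_L2_eq_fourier[OF K KI, of n] by eventually_elim simp
    then have "L2_norm (\<lambda>x. fourier (K n) x - fourier_L2 k x) = L2_norm (fourier_L2 (\<lambda>\<xi>. K n \<xi> - k \<xi>))"
      by (rule L2_cong(2)[OF fourier_L2_in_L2[OF L2_diff[OF K k]] L2_measurable[OF sL]])
    then show ?thesis by (simp add: L2_norm_fourier_L2[OF L2_diff[OF K k]])
  qed
  \<comment> \<open>The regularized transforms converge pointwise to L and in L2 to
    \<open>fourier_L2 k\<close>. Fatou makes the distance between the two limits arbitrarily
    small.\<close>
  have fat: "(\<lambda>x. L x - fourier_L2 k x) \<in> L2 \<and> L2_norm (\<lambda>x. L x - fourier_L2 k x) \<le> e" if "0 < e" for e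
  proof -
    have ev: "\<forall>\<^sub>F n in sequentially. L2_norm (\<lambda>x. fourier (K n) x - fourier_L2 k x) \<le> e"
      unfolding sn using order_tendstoD(2)[OF Kk that] by (auto elim!: eventually_mono)
    have "AE x in lborel. (\<lambda>n. fourier (K n) x - fourier_L2 k x) \<longlonglongrightarrow> L x - fourier_L2 k x"
      by (intro AE_I2 tendsto_intros lim)
    from L2_fatou[OF sL _ _ ev this] show ?thesis
      using that L2_measurable[OF Tk] by auto
  qed
  have "L2_norm (\<lambda>x. L x - fourier_L2 k x) \<le> 0 + e" if "0 < e" for e using fat[OF that] by simp
  then have "L2_norm (\<lambda>x. L x - fourier_L2 k x) \<le> 0" by (rule field_le_epsilon)
  then have "L2_norm (\<lambda>x. L x - fourier_L2 k x) = 0" by (intro antisym) auto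
  then have AE: "AE x in lborel. L x = fourier_L2 k x"
    using L2_norm_eq_0D[of "\<lambda>x. L x - fourier_L2 k x"] fat[of 1] by auto
  have "fourier_L2 (\<lambda>\<xi>. cis (- (t * \<xi>\<^sup>2 / 2)) * fourier_L2 v \<xi>) = fourier_L2 k"
    using fourier_L2_eq_fourier[OF v] fourier_L2_measurable[OF v(1)]
    by (intro fourier_L2_cong_AE) (auto simp: k_def gauss_imaginary elim!: eventually_mono)
  then have S: "schroedinger t v x = fourier_L2 k (- x)" for x
    by (simp add: schroedinger_eq fourier_mult_def inv_fourier_L2_def)
  have Leq: "L (- x) = cis (x\<^sup>2 / (2 * t)) / csqrt (\<i> * t) * fourier (chirp t v) (x / t)" for x
  proof -
    have g: "gauss (1 / (\<i> * complex_of_real t)) r = cis (r\<^sup>2 / (2 * t))" for r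
    proof -
      have "1 / (\<i> * complex_of_real t) = \<i> * complex_of_real (- (1 / t))"
        using t by (simp add: complex_eq_iff Re_divide Im_divide power2_eq_square)
      then show ?thesis by (simp only: gauss_imaginary) (simp add: mult.commute)
    qed
    have "v y * (gauss (1 / (\<i> * complex_of_real t)) (- x + y) / csqrt (\<i> * complex_of_real t))
      = (cis (x\<^sup>2 / (2 * t)) / csqrt (\<i> * t)) * (cis (- (y * (x / t))) * chirp t v y)" for y
    proof -
      \<comment> \<open>Expanding the square separates the three phases: the outer chirp, the
        Fourier phase at frequency x/t, and the chirp acting on v.\<close>
      have "(- x + y)\<^sup>2 / (2 * t) = x\<^sup>2 / (2 * t) + (- (y * (x / t)) + y\<^sup>2 / (2 * t))"
        using t by (simp add: field_simps power2_eq_square)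
      then have "cis ((- x + y)\<^sup>2 / (2 * t)) = cis (x\<^sup>2 / (2 * t)) * (cis (- (y * (x / t))) * cis (y\<^sup>2 / (2 * t)))"
        by (simp only: cis_mult)
      then show ?thesis unfolding g chirp_def by simp
    qed
    note p = this
    show ?thesis unfolding L_def fourier_eq_cis p integral_mult_right_zero
      by (simp only: mult_ac)
  qed
  show ?thesis
    using AE_reflect[OF AE] by eventually_elim (simp only: S Leq)
qed

lemma fourier_isCont:
  assumes f: "integrable lborel f"
  shows "isCont (fourier f) \<xi>"
  unfolding isCont_def tendsto_at_iff_sequentially comp_def
proof (intro allI impI)
  have [measurable]: "f \<in> borel_measurable borel" using f by auto
  have cc: "isCont cis a" for a
    using continuous_on_cis[OF continuous_on_id, of UNIV] by (simp add: continuous_on_eq_continuous_at)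
  fix X :: "nat \<Rightarrow> real" assume X: "\<forall>i. X i \<in> UNIV - {\<xi>}" "X \<longlonglongrightarrow> \<xi>"
  have "(\<lambda>i. LINT x|lborel. cis (- (x * X i)) * f x) \<longlonglongrightarrow> (LINT x|lborel. cis (- (x * \<xi>)) * f x)"
  proof (rule integral_dominated_convergence[where w = "\<lambda>x. cmod (f x)"])
    show "AE x in lborel. (\<lambda>i. cis (- (x * X i)) * f x) \<longlonglongrightarrow> cis (- (x * \<xi>)) * f x"
      using X(2) by (intro AE_I2 tendsto_intros isCont_tendsto_compose[OF cc])
    show "AE x in lborel. norm (cis (- (x * X i)) * f x) \<le> cmod (f x)" for i by (simp add: norm_mult)
  qed (use f in auto)
  then show "(\<lambda>i. fourier f (X i)) \<longlonglongrightarrow> fourier f \<xi>"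
    unfolding fourier_eq_cis by (intro tendsto_intros)
qed

text \<open>For continuous g the set where g exceeds c is open and null, hence empty. This carries
  bounds on L2 classes to every frequency.\<close>

lemma AE_le_imp_le:
  fixes g :: "real \<Rightarrow> real"
  assumes ae: "AE x in lborel. g x \<le> c" and cont: "\<And>x. isCont g x"
  shows "g x \<le> c"
proof (rule ccontr)
  assume "\<not> g x \<le> c"
  have op: "open {x. c < g x}"
    using cont by (intro open_Collect_less) (auto simp: continuous_at_imp_continuous_on)
  moreover have "{x. c < g x} \<in> null_sets lborel"
    using AE_iff_null_sets[of "{x. c < g x}" lborel] ae op by (auto simp: not_less)
  ultimately have "{x. c < g x} = {}"
    using open_not_negligible by (metis negligible_iff_null_sets null_sets_completionI)
  then show False using \<open>\<not> g x \<le> c\<close> by (auto simp: not_le)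
qed

subsection \<open>Factorization of the nonlinearity\<close>

text \<open>The weight is tailored to the next bound on the chirp phase; scaling by sqrt s gives the
  squared norm of order s^(-1/2), which is the source of the rate s^(-1/4).\<close>

lemma scaled_cauchy_weight:
  assumes s: "0 < s"
  shows "(\<lambda>y. complex_of_real (sqrt (8 / (s + y\<^sup>2)))) \<in> L2"
    "(L2_norm (\<lambda>y. complex_of_real (sqrt (8 / (s + y\<^sup>2)))))\<^sup>2 = 8 * pi / sqrt s"
proof -
  have eq: "(cmod (complex_of_real (sqrt (8 / (s + y\<^sup>2)))))\<^sup>2 = 8 / (s + y\<^sup>2)" for y
    using s by (simp add: add_nonneg_nonneg)
  have w: "(cmod (complex_of_real (1 / sqrt (1 + x\<^sup>2))))\<^sup>2 = 1 / (1 + x\<^sup>2)" for x :: real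
    by (simp add: norm_divide power_divide)
  have int: "integrable lborel (\<lambda>x::real. 1 / (1 + x\<^sup>2))"
    using L2_integrable[OF cauchy_weight_L2(1)] unfolding w .
  have val: "(LINT x|lborel. 1 / (1 + (x::real)\<^sup>2)) = pi"
    using L2_norm_sq[of "\<lambda>x. complex_of_real (1 / sqrt (1 + x\<^sup>2))"] unfolding w cauchy_weight_L2(2) by simp
  have sub: "8 / (s + (0 + sqrt s * x)\<^sup>2) = (8 / s) * (1 / (1 + x\<^sup>2))" for x
    using s by (simp add: power_mult_distrib field_simps)
  have i: "integrable lborel (\<lambda>x. 8 / (s + (0 + sqrt s * x)\<^sup>2))"
    unfolding sub by (intro integrable_mult_right int)
  then have i2: "integrable lborel (\<lambda>y. 8 / (s + y\<^sup>2))"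
    using lborel_integrable_real_affine_iff[of "sqrt s" "\<lambda>y. 8 / (s + y\<^sup>2)" 0] s by simp
  then show "(\<lambda>y. complex_of_real (sqrt (8 / (s + y\<^sup>2)))) \<in> L2"
    unfolding L2_def mem_Collect_eq eq by simp
  have "(LINT y|lborel. 8 / (s + y\<^sup>2)) = \<bar>sqrt s\<bar> *\<^sub>R (LINT x|lborel. 8 / (s + (0 + sqrt s * x)\<^sup>2))"
    by (rule lborel_integral_real_affine) (use s in auto)
  also have "\<dots> = sqrt s * ((8 / s) * pi)"
    unfolding sub integral_mult_right_zero val using s by simp
  also have "\<dots> = 8 * pi / sqrt s"
    using s real_div_sqrt[of s] by (simp add: field_simps)
  finally show "(L2_norm (\<lambda>y. complex_of_real (sqrt (8 / (s + y\<^sup>2)))))\<^sup>2 = 8 * pi / sqrt s"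
    unfolding L2_norm_sq eq .
qed

text \<open>With z = y^2/s, the bound 2 for z \<ge> 1 and the bound z/2 for z < 1 are both covered
  by the square root of 8z/(1+z). Extracting |y| leaves a weight that is square integrable.\<close>

lemma chirp_phase_bound:
  assumes s: "0 < s" "\<bar>t\<bar> = s"
  shows "cmod (cis (y\<^sup>2 / (2 * t)) - 1) \<le> sqrt (8 / (s + y\<^sup>2)) * \<bar>y\<bar>"
proof -
  define z where "z = y\<^sup>2 / s"
  have z: "0 \<le> z" using s by (simp add: z_def)
  let ?c = "cmod (cis (y\<^sup>2 / (2 * t)) - 1)"
  have c2: "?c \<le> 2" using norm_triangle_ineq4[of "cis (y\<^sup>2 / (2 * t))" 1] by simp
  have "?c \<le> \<bar>y\<^sup>2 / (2 * t)\<bar>" by (rule norm_cis_minus_1)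
  also have "\<dots> = z / 2" using s by (simp add: z_def abs_mult)
  finally have cz: "?c \<le> z / 2" .
  have "?c\<^sup>2 \<le> 8 * z / (1 + z)"
  proof (cases "1 \<le> z")
    case True
    have "?c\<^sup>2 \<le> 2\<^sup>2" using c2 by (intro power_mono) auto
    also have "\<dots> \<le> 8 * z / (1 + z)" using True by (simp add: field_simps)
    finally show ?thesis .
  next
    case False
    have zz: "z * z \<le> 1" using mult_mono[of z 1 z 1] False z by auto
    have "?c\<^sup>2 \<le> (z / 2)\<^sup>2" using cz by (intro power_mono) auto
    also have "\<dots> = z * (z / 4)" by (simp add: power2_eq_square)
    also have "\<dots> \<le> z * (8 / (1 + z))"
      using False z zz by (intro mult_left_mono) (auto simp: field_simps)
    finally show ?thesis by (simp add: mult.commute)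
  qed
  also have "8 * z / (1 + z) = 8 / (s + y\<^sup>2) * y\<^sup>2"
    using s add_pos_nonneg[OF s(1), of "y\<^sup>2"] by (simp add: z_def field_simps)
  finally have "sqrt (?c\<^sup>2) \<le> sqrt (8 / (s + y\<^sup>2) * y\<^sup>2)" by (rule real_sqrt_le_mono)
  then show ?thesis by (simp only: real_sqrt_mult real_sqrt_abs)
qed

text \<open>Cauchy-Schwarz spends the single weight x on the phase error, uniformly in \<xi>. The
  constant is sqrt (8 pi) / sqrt (2 pi) = 2. Negative t is allowed because the inverse modulation is
  needed as well.\<close>

lemma fourier_chirp_difference:
  assumes v: "v \<in> L2" and xv: "xmul v \<in> L2" and s: "0 < s" "\<bar>t\<bar> = s"
  shows "cmod (fourier (chirp t v) \<xi> - fourier v \<xi>) \<le> 2 * s powr (- 1 / 4) * L2_norm (xmul v)"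
proof -
  have [measurable]: "v \<in> borel_measurable borel" using v by (rule L2_measurable)
  have iv: "integrable lborel v" by (rule weighted_imp_integrable[OF v xv])
  have ic: "integrable lborel (chirp t v)"
    by (rule weighted_imp_integrable[OF chirp_L2(1)[OF v] chirp_xmul(1)[OF xv]])
  let ?W = "\<lambda>y. complex_of_real (sqrt (8 / (s + y\<^sup>2)))"
  note W = scaled_cauchy_weight[OF s(1)]
  have d: "integrable lborel (\<lambda>y. chirp t v y - v y)" using ic iv by simp
  have "cmod (fourier (chirp t v) \<xi> - fourier v \<xi>) = cmod (fourier (\<lambda>y. chirp t v y - v y) \<xi>)"
    by (simp add: fourier_diff ic iv)
  also have "\<dots> \<le> (1 / sqrt (2 * pi)) * (LINT y|lborel. cmod (chirp t v y - v y))"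
    by (rule fourier_norm_le[OF d])
  also have "\<dots> \<le> (1 / sqrt (2 * pi)) * (LINT y|lborel. cmod (?W y) * cmod (xmul v y))"
  proof (intro mult_left_mono integral_mono)
    show "integrable lborel (\<lambda>y. cmod (?W y) * cmod (xmul v y))"
      using integrable_norm[OF L2_Cauchy_Schwarz(1)[OF W(1) xv]] by (simp add: norm_mult)
    fix y
    have "cmod (cis (y\<^sup>2 / (2 * t)) - 1) * cmod (v y) \<le> (sqrt (8 / (s + y\<^sup>2)) * \<bar>y\<bar>) * cmod (v y)"
      by (intro mult_right_mono chirp_phase_bound s) auto
    then show "cmod (chirp t v y - v y) \<le> cmod (?W y) * cmod (xmul v y)"
      using s add_nonneg_nonneg[of s "y\<^sup>2"] by (simp add: chirp_def norm_mult mult.assoc left_diff_distrib flip: norm_mult)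
        (simp add: left_diff_distrib norm_mult)
  qed (use d in auto)
  also have "\<dots> \<le> (1 / sqrt (2 * pi)) * (L2_norm ?W * L2_norm (xmul v))"
    by (intro mult_left_mono L2_Cauchy_Schwarz W xv) auto
  also have "L2_norm ?W = sqrt (8 * pi / sqrt s)"
    using W(2) by (metis L2_norm_nonneg real_sqrt_unique)
  also have "sqrt (8 * pi / sqrt s) = 2 * sqrt (2 * pi) * s powr (- 1 / 4)"
  proof -
    have "sqrt (sqrt s) = s powr (1 / 4)"
      using s by (simp add: powr_half_sqrt[symmetric] powr_powr)
    moreover have "sqrt (8 * pi) = 2 * sqrt (2 * pi)"
      using real_sqrt_mult[of 4 "2 * pi"] by simp
    ultimately show ?thesis
      by (simp add: real_sqrt_divide powr_minus_divide)
  qed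
  finally show ?thesis by (simp add: mult_ac)
qed

text \<open>By factorization each u_j is a unimodular phase times t^(-1/2) times a function of x/t.
  The squared modulus loses its phase, so the cubic term has the factorized form again. Thus its
  interaction-picture version is 1/t times the inverse chirp of g, where g has the cubic product as
  its transform, and the x weight of g follows from that of \<open>v1\<close> and
  \<open>v2\<close>.\<close>

lemma damping_schroedinger:
  assumes v: "v1 \<in> L2" "xmul v1 \<in> L2" "v2 \<in> L2" "xmul v2 \<in> L2" and t: "0 < t"
    and u: "u1 \<in> L2" "u2 \<in> L2"
    and uv: "AE x in lborel. u1 x = schroedinger t v1 x" "AE x in lborel. u2 x = schroedinger t v2 x"
    and b: "0 \<le> b" "AE x in lborel. cmod (u1 x) \<le> b" "AE x in lborel. cmod (u2 x) \<le> b"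
  obtains g where
    "AE x in lborel. schroedinger (- t) (damping u2 u1) x = complex_of_real (1 / t) * chirp (- t) g x"
    "g \<in> L2" "xmul g \<in> L2"
    "L2_norm (xmul g) \<le> t * b\<^sup>2 * (L2_norm (xmul v1) + 2 * L2_norm (xmul v2))"
    "\<And>\<xi>. fourier g \<xi> = damping (fourier (chirp t v2)) (fourier (chirp t v1)) \<xi>"
    "\<And>\<xi>. cmod (fourier (chirp t v1) \<xi>) \<le> sqrt t * b" "\<And>\<xi>. cmod (fourier (chirp t v2) \<xi>) \<le> sqrt t * b"
proof -
  have sup: "cmod (fourier (chirp t w) \<xi>) \<le> sqrt t * b" and Fb: "fourier (chirp t w) \<in> L2"
    and AEw: "AE x in lborel. y x = cis (x\<^sup>2 / (2 * t)) / csqrt (\<i> * t) * fourier (chirp t w) (x / t)"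
    and xF: "xmul (fourier_L2 (fourier (chirp t w))) \<in> L2"
      "L2_norm (xmul (fourier_L2 (fourier (chirp t w)))) = L2_norm (xmul w)"
    if w: "w \<in> L2" "xmul w \<in> L2" and y: "AE x in lborel. y x = schroedinger t w x" "AE x in lborel. cmod (y x) \<le> b"
    for w y \<xi>
  proof -
    have iw: "integrable lborel w" by (rule weighted_imp_integrable[OF w])
    have c: "chirp t w \<in> L2" "xmul (chirp t w) \<in> L2" "L2_norm (xmul (chirp t w)) = L2_norm (xmul w)"
      using chirp_L2 chirp_xmul w by auto
    have ic: "integrable lborel (chirp t w)" by (rule weighted_imp_integrable[OF c(1,2)])
    show AEw: "AE x in lborel. y x = cis (x\<^sup>2 / (2 * t)) / csqrt (\<i> * t) * fourier (chirp t w) (x / t)"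
      using y(1) schroedinger_factorization[OF w(1) iw t] by eventually_elim simp
    have "AE x in lborel. cmod (fourier (chirp t w) (x / t)) \<le> sqrt t * b"
      using AEw y(2)
    proof eventually_elim
      case (elim x)
      have "cmod (fourier (chirp t w) (x / t)) = sqrt t * cmod (y x)"
        using t unfolding elim(1) by (simp add: norm_mult norm_divide norm_csqrt)
      then show ?case using elim(2) t by simp
    qed
    \<comment> \<open>Rescaling removes the argument x/t; continuity then extends the almost
      everywhere bound to all frequencies.\<close>
    then have "AE x in lborel. cmod (fourier (chirp t w) x) \<le> sqrt t * b"
      using AE_lborel_affine[of "\<lambda>x. cmod (fourier (chirp t w) (x / t)) \<le> sqrt t * b" t 0] t by simp
    then show "cmod (fourier (chirp t w) \<xi>) \<le> sqrt t * b"
      by (rule AE_le_imp_le) (intro isCont_norm fourier_isCont ic)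
    show Fb: "fourier (chirp t w) \<in> L2" by (rule fourier_contraction[OF ic c(1)])
    \<comment> \<open>A second transform reflects the chirped function, so the weight on the
      transform of \<open>fourier (chirp t w)\<close> is the x weight of w itself.\<close>
    have "fourier_L2 (fourier (chirp t w)) = fourier_L2 (fourier_L2 (chirp t w))"
      using fourier_L2_eq_fourier[OF c(1) ic] Fb fourier_L2_measurable[OF c(1)] L2_measurable
      by (intro fourier_L2_cong_AE) (auto elim!: eventually_mono)
    then have AE2: "AE x in lborel. fourier_L2 (fourier (chirp t w)) x = chirp t w (- x)"
      using fourier_L2_twice[OF c(1)] by simp
    have AE3: "AE x in lborel. xmul (fourier_L2 (fourier (chirp t w))) x = xmul (\<lambda>x. chirp t w (- x)) x"
      using AE2 by eventually_elim simp
    have m: "xmul (fourier_L2 (fourier (chirp t w))) \<in> borel_measurable borel"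
      using fourier_L2_measurable[OF Fb] by measurable
    show "xmul (fourier_L2 (fourier (chirp t w))) \<in> L2"
      "L2_norm (xmul (fourier_L2 (fourier (chirp t w)))) = L2_norm (xmul w)"
      using L2_cong[OF xmul_reflect(1)[OF c(2)] m AE3] xmul_reflect(2)[OF c(2)] c(3) by auto
  qed
  let ?\<beta>1 = "fourier (chirp t v1)" and ?\<beta>2 = "fourier (chirp t v2)"
  have s1: "cmod (?\<beta>1 \<xi>) \<le> sqrt t * b" and s2: "cmod (?\<beta>2 \<xi>) \<le> sqrt t * b" for \<xi>
    using sup[OF v(1,2) uv(1) b(2)] sup[OF v(3,4) uv(2) b(3)] by auto
  note F1 = Fb[OF v(1,2) uv(1) b(2)] and F2 = Fb[OF v(3,4) uv(2) b(3)]
  note xF1 = xF[OF v(1,2) uv(1) b(2)] and xF2 = xF[OF v(3,4) uv(2) b(3)]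
  note A1 = AEw[OF v(1,2) uv(1) b(2)] and A2 = AEw[OF v(3,4) uv(2) b(3)]
  define G where "G = damping ?\<beta>2 ?\<beta>1"
  have G: "G \<in> L2" unfolding G_def
    using damping_L2(1)[OF F1 L2_measurable[OF F2], of "sqrt t * b"] s2 by simp
  have xG: "xmul (fourier_L2 G) \<in> L2"
    "L2_norm (xmul (fourier_L2 G)) \<le> (sqrt t * b)\<^sup>2 * (L2_norm (xmul v1) + 2 * L2_norm (xmul v2))"
    unfolding G_def
    using weighted_transform_damping[OF F1 F2, of "sqrt t * b"] s1 s2 xF1 xF2 by auto
  define g where "g = inv_fourier_L2 G"
  have g: "g \<in> L2" unfolding g_def by (rule inv_fourier_L2_in_L2[OF G])
  have xg: "xmul g \<in> L2" "L2_norm (xmul g) = L2_norm (xmul (fourier_L2 G))"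
    unfolding g_def using xmul_inv_fourier_L2[of G] xG by auto
  have ig: "integrable lborel g" by (rule weighted_imp_integrable[OF g xg(1)])
  have contG: "isCont G \<xi>" for \<xi>
    unfolding G_def damping_def[abs_def]
    by (intro continuous_intros fourier_isCont weighted_imp_integrable[OF chirp_L2(1) chirp_xmul(1)] v)
  \<comment> \<open>Both sides are continuous, so the almost everywhere inversion formula holds at
    every frequency.\<close>
  have FgG: "fourier g \<xi> = G \<xi>" for \<xi>
  proof -
    have "AE \<xi> in lborel. cmod (fourier g \<xi> - G \<xi>) \<le> 0"
      using fourier_L2_eq_fourier[OF g ig] fourier_L2_inv_fourier_L2[OF G]
      by eventually_elim (simp add: g_def)
    from AE_le_imp_le[OF this, of \<xi>] have "cmod (fourier g \<xi> - G \<xi>) \<le> 0"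
      by (simp add: continuous_intros fourier_isCont[OF ig] contG)
    then show ?thesis by simp
  qed
  \<comment> \<open>Chosen so that \<open>chirp t V\<close> = g/t: factorizing
    \<open>schroedinger t V\<close> then reproduces G(x/t)/t with exactly the prefactor of
    u1.\<close>
  define V where "V = (\<lambda>x. complex_of_real (1 / t) * chirp (- t) g x)"
  have V: "V \<in> L2" unfolding V_def by (intro L2_cmult chirp_L2 g)
  have xV: "xmul V \<in> L2"
    unfolding V_def using L2_cmult[OF chirp_xmul(1)[OF xg(1), of "- t"], of "complex_of_real (1 / t)"]
    by (simp add: mult.left_commute)
  have iV: "integrable lborel V" by (rule weighted_imp_integrable[OF V xV])
  have cV: "chirp t V = (\<lambda>x. complex_of_real (1 / t) * g x)"
    unfolding V_def chirp_cmult chirp_chirp ..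
  have D: "damping u2 u1 \<in> L2" by (rule damping_L2(1)[OF u(1) L2_measurable[OF u(2)] b(3)])
  have "AE x in lborel. damping u2 u1 x = schroedinger t V x"
    using A1 A2 schroedinger_factorization[OF V iV t]
  proof eventually_elim
    case (elim x)
    have n: "(cmod (u2 x))\<^sup>2 = (1 / t) * (cmod (?\<beta>2 (x / t)))\<^sup>2"
      unfolding elim(2) using t by (simp add: norm_mult norm_divide norm_csqrt power_mult_distrib power_divide)
    show ?case
      unfolding elim(3) cV fourier_cmult FgG G_def damping_def n unfolding elim(1) by (simp add: mult_ac)
  qed
  then have "schroedinger (- t) (damping u2 u1) = schroedinger (- t) (schroedinger t V)"
    by (rule schroedinger_cong_AE[OF D schroedinger_L2(1)[OF V]])
  then have "AE x in lborel. schroedinger (- t) (damping u2 u1) x = complex_of_real (1 / t) * chirp (- t) g x"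
    using schroedinger_inverse[OF V, of t] by (simp add: V_def)
  moreover have "L2_norm (xmul g) \<le> t * b\<^sup>2 * (L2_norm (xmul v1) + 2 * L2_norm (xmul v2))"
    using xg(2) xG(2) t by (simp add: power_mult_distrib)
  ultimately show ?thesis
    using g xg(1) FgG s1 s2 by (intro that[of g]) (auto simp: G_def)
qed

subsection \<open>Curves in \<open>L2\<close>\<close>

lemma fourier_L2_inj_norm:
  assumes "f \<in> L2" "g \<in> L2" "AE x in lborel. fourier_L2 f x = g x"
  shows "L2_norm f = L2_norm g"
  using L2_cong(2)[OF fourier_L2_in_L2[OF assms(1)] L2_measurable[OF assms(2)]] assms
  by (simp add: L2_norm_fourier_L2 eq_commute)

text \<open>Plancherel applied to each difference quotient. The derivative of \<open>V\<close> is
  computed on the Fourier side and carried back by this equivalence.\<close>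

lemma has_L2_time_derivative_fourier_iff:
  assumes w: "\<And>\<tau>. 0 \<le> \<tau> \<Longrightarrow> w \<tau> \<in> L2" and W: "\<And>\<tau>. 0 \<le> \<tau> \<Longrightarrow> W \<tau> \<in> L2"
    and eq: "\<And>\<tau>. 0 \<le> \<tau> \<Longrightarrow> AE \<xi> in lborel. fourier_L2 (w \<tau>) \<xi> = W \<tau> \<xi>"
    and d: "d \<in> L2" and D: "D \<in> L2" and eqd: "AE \<xi> in lborel. fourier_L2 d \<xi> = D \<xi>" and t: "0 < t"
  shows "has_L2_time_derivative w d t \<longleftrightarrow> has_L2_time_derivative W D t"
proof -
  have ev: "\<forall>\<^sub>F h in at 0. 0 \<le> t + h"
    using t by (intro eventually_at_in_open'[of "{- t<..}", THEN eventually_mono]) auto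
  have in1: "(\<lambda>x. (w (t + h) x - w t x) / complex_of_real h - d x) \<in> L2"
    and in2: "(\<lambda>x. (W (t + h) x - W t x) / complex_of_real h - D x) \<in> L2"
    and n: "L2_norm (\<lambda>x. (w (t + h) x - w t x) / complex_of_real h - d x)
      = L2_norm (\<lambda>x. (W (t + h) x - W t x) / complex_of_real h - D x)" if h: "0 \<le> t + h" for h
  proof -
    have wt: "w (t + h) \<in> L2" "w t \<in> L2" "W (t + h) \<in> L2" "W t \<in> L2" using w W h t by auto
    have q: "(\<lambda>x. (1 / complex_of_real h) * (w (t + h) x - w t x)) \<in> L2"
      and Q: "(\<lambda>x. (1 / complex_of_real h) * (W (t + h) x - W t x)) \<in> L2"
      by (intro L2_cmult L2_diff wt)+
    show 1: "(\<lambda>x. (w (t + h) x - w t x) / complex_of_real h - d x) \<in> L2" using L2_diff[OF q d] by simp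
    show 2: "(\<lambda>x. (W (t + h) x - W t x) / complex_of_real h - D x) \<in> L2" using L2_diff[OF Q D] by simp
    show "L2_norm (\<lambda>x. (w (t + h) x - w t x) / complex_of_real h - d x)
      = L2_norm (\<lambda>x. (W (t + h) x - W t x) / complex_of_real h - D x)"
    proof (rule fourier_L2_inj_norm[OF 1 2])
      show "AE x in lborel. fourier_L2 (\<lambda>x. (w (t + h) x - w t x) / complex_of_real h - d x) x
          = (W (t + h) x - W t x) / complex_of_real h - D x"
        using eq[OF h] eq[of t] t fourier_L2_diff[OF q d] fourier_L2_cmult[OF L2_diff[OF wt(1,2)], of "1 / complex_of_real h"]
          fourier_L2_diff[OF wt(1,2)] eqd
        by (auto elim!: eventually_elim2)
    qed
  qed
  have "\<forall>\<^sub>F h in at 0. (\<lambda>x. (w (t + h) x - w t x) / complex_of_real h - d x) \<in> L2"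
    "\<forall>\<^sub>F h in at 0. (\<lambda>x. (W (t + h) x - W t x) / complex_of_real h - D x) \<in> L2"
    "\<forall>\<^sub>F h in at 0. L2_norm (\<lambda>x. (w (t + h) x - w t x) / complex_of_real h - d x)
      = L2_norm (\<lambda>x. (W (t + h) x - W t x) / complex_of_real h - D x)"
    using ev by (eventually_elim, use in1 in2 n in blast)+
  then show ?thesis
    unfolding has_L2_time_derivative_def L2_tendsto_def using d D by (simp add: tendsto_cong)
qed

lemma L2_tendsto_const: "f \<in> L2 \<Longrightarrow> L2_tendsto (\<lambda>i. f) f F"
  by (simp add: L2_tendsto_def)

lemma L2_pairing_derivative:
  assumes w: "\<And>\<tau>. 0 \<le> \<tau> \<Longrightarrow> w \<tau> \<in> L2" and d: "has_L2_time_derivative w d t" and t: "0 < t" and k: "k \<in> L2"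
  shows "((\<lambda>\<tau>. LINT x|lborel. w \<tau> x * k x) has_vector_derivative (LINT x|lborel. d x * k x)) (at t)"
  unfolding has_vector_derivative_iff_quotient
proof (rule Lim_transform_eventually)
  have "d \<in> L2" "L2_tendsto (\<lambda>h x. (w (t + h) x - w t x) / complex_of_real h) d (at 0)"
    using d by (auto simp: has_L2_time_derivative_def)
  then show "((\<lambda>h. LINT x|lborel. ((w (t + h) x - w t x) / complex_of_real h) * k x) \<longlongrightarrow> (LINT x|lborel. d x * k x)) (at 0)"
    by (intro L2_integral_tendsto L2_tendsto_const k)
  have ev: "\<forall>\<^sub>F h in at 0. 0 \<le> t + h"
    using t by (intro eventually_at_in_open'[of "{- t<..}", THEN eventually_mono]) auto
  then show "\<forall>\<^sub>F h in at 0. (LINT x|lborel. ((w (t + h) x - w t x) / complex_of_real h) * k x)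
      = ((LINT x|lborel. w (t + h) x * k x) - (LINT x|lborel. w t x * k x)) / complex_of_real h"
  proof eventually_elim
    case (elim h)
    have "integrable lborel (\<lambda>x. w (t + h) x * k x)" "integrable lborel (\<lambda>x. w t x * k x)"
      using L2_Cauchy_Schwarz(1) w elim t k by auto
    then show ?case by (simp add: left_diff_distrib)
  qed
qed

lemma L2_pairing_continuous:
  fixes w :: "real \<Rightarrow> real \<Rightarrow> complex"
  assumes w: "\<And>\<tau>. 0 \<le> \<tau> \<Longrightarrow> w \<tau> \<in> L2"
    and c: "\<And>t. 0 \<le> t \<Longrightarrow> ((\<lambda>\<tau>. L2_norm (\<lambda>x. w \<tau> x - w t x)) \<longlongrightarrow> 0) (at t within {0..})" and k: "k \<in> L2"
  shows "continuous_on {0..} (\<lambda>\<tau>. LINT x|lborel. w \<tau> x * k x)"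
  unfolding continuous_on_def
proof
  fix t :: real assume t: "t \<in> {0..}"
  have "L2_tendsto w (w t) (at t within {0..})"
    unfolding L2_tendsto_def using c t w by (auto simp: eventually_at_filter)
  then show "((\<lambda>\<tau>. LINT x|lborel. w \<tau> x * k x) \<longlongrightarrow> (LINT x|lborel. w t x * k x)) (at t within {0..})"
    using t w k by (intro L2_integral_tendsto L2_tendsto_const) auto
qed

text \<open>A mean value inequality for the possibly unbounded weight \<open>\<phi>\<close>: truncate \<open>\<phi>\<close>, pair with the
  truncated increment itself, and let the truncation tend to infinity.\<close>

lemma weighted_mean_value:
  fixes \<phi> G G' :: "real \<Rightarrow> real"
  assumes w: "\<And>\<tau>. 0 \<le> \<tau> \<Longrightarrow> w \<tau> \<in> L2"
    and c: "\<And>t. 0 \<le> t \<Longrightarrow> ((\<lambda>\<tau>. L2_norm (\<lambda>x. w \<tau> x - w t x)) \<longlongrightarrow> 0) (at t within {0..})"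
    and d: "\<And>t. a < t \<Longrightarrow> t < b \<Longrightarrow> has_L2_time_derivative w (d t) t"
    and [measurable]: "\<phi> \<in> borel_measurable borel"
    and dphi: "\<And>t. a < t \<Longrightarrow> t < b \<Longrightarrow> (\<lambda>x. complex_of_real (\<phi> x) * d t x) \<in> L2"
    and le: "\<And>t. a < t \<Longrightarrow> t < b \<Longrightarrow> L2_norm (\<lambda>x. complex_of_real (\<phi> x) * d t x) \<le> G' t"
    and G: "continuous_on {a..b} G" "\<And>t. a < t \<Longrightarrow> t < b \<Longrightarrow> (G has_vector_derivative G' t) (at t)"
    and ab: "0 \<le> a" "a < b"
    and wa: "(\<lambda>x. complex_of_real (\<phi> x) * w a x) \<in> L2" and wb: "(\<lambda>x. complex_of_real (\<phi> x) * w b x) \<in> L2"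
  shows "L2_norm (\<lambda>x. complex_of_real (\<phi> x) * w b x) \<le> L2_norm (\<lambda>x. complex_of_real (\<phi> x) * w a x) + (G b - G a)"
proof -
  define \<phi>n where "\<phi>n = (\<lambda>(n::nat) x. max (- real n) (min (real n) (\<phi> x)))"
  have [measurable]: "\<phi>n n \<in> borel_measurable borel" for n unfolding \<phi>n_def by measurable
  have pn: "\<bar>\<phi>n n x\<bar> \<le> real n" "\<bar>\<phi>n n x\<bar> \<le> \<bar>\<phi> x\<bar>" for n x by (auto simp: \<phi>n_def)
  have wab: "w a \<in> L2" "w b \<in> L2" using w ab by auto
  have [measurable]: "w a \<in> borel_measurable borel" "w b \<in> borel_measurable borel" using wab by (auto intro: L2_measurable)
  define s where "s = (\<lambda>n x. complex_of_real (\<phi>n n x) * (w b x - w a x))"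
  have bm: "(\<lambda>x. complex_of_real (\<phi>n n x) * f x) \<in> L2" if "f \<in> L2" for f n
    using L2_mult_bounded(1)[OF that, of "\<lambda>x. complex_of_real (\<phi>n n x)" "real n"] pn by auto
  have s: "s n \<in> L2" for n unfolding s_def by (intro bm L2_diff wab)
  have bound: "L2_norm (s n) \<le> G b - G a" for n
  proof -
    \<comment> \<open>The truncated weight occurs twice, once here and once inside s n, so pairing k
      with the increment of w gives the squared norm of s n.\<close>
    define k where "k = (\<lambda>x. complex_of_real (\<phi>n n x) * cnj (s n x))"
    have k: "k \<in> L2" unfolding k_def by (intro bm L2_cnj s)
    have "norm ((LINT x|lborel. w b x * k x) - (LINT x|lborel. w a x * k x)) \<le> L2_norm (s n) * G b - L2_norm (s n) * G a"
    proof (rule differentiable_bound_general[OF ab(2)])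
      show "continuous_on {a..b} (\<lambda>\<tau>. LINT x|lborel. w \<tau> x * k x)"
        by (rule continuous_on_subset[OF L2_pairing_continuous[OF w c k]]) (use ab in auto)
      show "continuous_on {a..b} (\<lambda>t. L2_norm (s n) * G t)" by (intro continuous_intros G)
      fix t assume t: "a < t" "t < b"
      then have t0: "0 < t" using ab by simp
      show "((\<lambda>\<tau>. LINT x|lborel. w \<tau> x * k x) has_vector_derivative (LINT x|lborel. d t x * k x)) (at t)"
        by (rule L2_pairing_derivative[OF w d[OF t] t0 k])
      show "((\<lambda>t. L2_norm (s n) * G t) has_vector_derivative L2_norm (s n) * G' t) (at t)"
        using G(2)[OF t] by (auto intro!: derivative_eq_intros)
      have dt: "d t \<in> L2" using d[OF t] by (simp add: has_L2_time_derivative_def)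
      have [measurable]: "d t \<in> borel_measurable borel" by (rule L2_measurable[OF dt])
      have "L2_norm (\<lambda>x. complex_of_real (\<phi>n n x) * d t x) \<le> 1 * L2_norm (\<lambda>x. complex_of_real (\<phi> x) * d t x)"
        by (rule L2_dominated(2)[OF dphi[OF t]]) (use pn in \<open>auto simp: norm_mult intro!: mult_right_mono\<close>)
      then have l: "L2_norm (\<lambda>x. complex_of_real (\<phi>n n x) * d t x) \<le> G' t" using le[OF t] by simp
      have "norm (LINT x|lborel. d t x * k x) = norm (LINT x|lborel. (complex_of_real (\<phi>n n x) * d t x) * cnj (s n x))"
        by (simp add: k_def mult_ac)
      also have "\<dots> \<le> L2_norm (\<lambda>x. complex_of_real (\<phi>n n x) * d t x) * L2_norm (\<lambda>x. cnj (s n x))"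
        by (intro L2_Cauchy_Schwarz(3) bm dt L2_cnj s)
      also have "\<dots> \<le> G' t * L2_norm (s n)" using l by (intro mult_mono) (auto intro: order_trans[OF L2_norm_nonneg])
      finally show "norm (LINT x|lborel. d t x * k x) \<le> L2_norm (s n) * G' t" by (simp add: mult.commute)
    qed
    also have "(LINT x|lborel. w b x * k x) - (LINT x|lborel. w a x * k x) = (LINT x|lborel. w b x * k x - w a x * k x)"
      by (intro Bochner_Integration.integral_diff[symmetric] L2_Cauchy_Schwarz(1) wab k)
    also have "\<dots> = (LINT x|lborel. complex_of_real ((cmod (s n x))\<^sup>2))"
      unfolding complex_norm_square k_def by (simp add: s_def algebra_simps)
    also have "\<dots> = complex_of_real ((L2_norm (s n))\<^sup>2)" unfolding L2_norm_sq by (rule integral_complex_of_real)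
    finally have "L2_norm (s n) * L2_norm (s n) \<le> L2_norm (s n) * (G b - G a)"
      by (simp add: power2_eq_square right_diff_distrib norm_mult)
    \<comment> \<open>Required when s n has norm 0, where cancelling the norm is impossible. It is
      the mean value inequality for the zero function, as G' dominates a norm.\<close>
    moreover have "0 \<le> G b - G a"
    proof -
      have "norm (0 - (0::complex)) \<le> G b - G a"
      proof (rule differentiable_bound_general[OF ab(2), where f = "\<lambda>_. 0"])
        fix t assume t: "a < t" "t < b"
        show "norm (0::complex) \<le> G' t" using le[OF t] order_trans[OF L2_norm_nonneg] by auto
      qed (use G in auto)
      then show ?thesis by simp
    qed
    ultimately show ?thesis
      using L2_norm_nonneg[of "s n"] by (cases "L2_norm (s n) = 0") (auto simp: mult_le_cancel_left)
  qed
  have lim: "(\<lambda>n. s n x) \<longlonglongrightarrow> complex_of_real (\<phi> x) * (w b x - w a x)" for x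
  proof (rule tendsto_eventually)
    obtain N :: nat where N: "\<bar>\<phi> x\<bar> \<le> real N" using real_arch_simple by blast
    show "\<forall>\<^sub>F n in sequentially. s n x = complex_of_real (\<phi> x) * (w b x - w a x)"
      using eventually_ge_at_top[of N] by eventually_elim (use N in \<open>auto simp: s_def \<phi>n_def max_def min_def\<close>)
  qed
  have G0: "0 \<le> G b - G a" using bound[of 0] order_trans[OF L2_norm_nonneg] by blast
  have "L2_norm (\<lambda>x. complex_of_real (\<phi> x) * (w b x - w a x)) \<le> G b - G a"
    by (rule L2_fatou(2)[of s, OF s _ G0]) (use bound lim in auto)
  then show ?thesis
    using L2_norm_le_diff[OF wb wa] by (simp add: right_diff_distrib)
qed

subsection \<open>Weighted Sobolev spaces\<close>

lemma japanese_1: "japanese 1 x = complex_of_real (sqrt (1 + x\<^sup>2))"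
  by (simp add: japanese_def powr_half_sqrt add_nonneg_nonneg)

lemma japanese_2: "japanese 2 x = complex_of_real (1 + x\<^sup>2)"
  by (simp add: japanese_def powr_one add_nonneg_nonneg)

lemma japanese_measurable [measurable]: "japanese s \<in> borel_measurable borel"
  unfolding japanese_def[abs_def] by measurable

lemma bessel_L2:
  assumes "\<phi> \<in> sobolev s \<sigma>"
  shows "bessel s \<phi> \<in> L2" "AE \<xi> in lborel. fourier_L2 (bessel s \<phi>) \<xi> = japanese s \<xi> * fourier_L2 \<phi> \<xi>"
  unfolding bessel_def using assms by (auto intro!: fourier_mult_L2 simp: sobolev_def)

text \<open>Linearity of \<open>bessel\<close> holds only almost everywhere, its values being chosen
  representatives; it is read off on the Fourier side.\<close>

lemma sobolev_diff:
  assumes f: "f \<in> sobolev s \<sigma>" and g: "g \<in> sobolev s \<sigma>"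
  shows "(\<lambda>x. f x - g x) \<in> sobolev s \<sigma>"
    "AE x in lborel. bessel s (\<lambda>x. f x - g x) x = bessel s f x - bessel s g x"
proof -
  have L: "f \<in> L2" "g \<in> L2" "(\<lambda>\<xi>. japanese s \<xi> * fourier_L2 f \<xi>) \<in> L2" "(\<lambda>\<xi>. japanese s \<xi> * fourier_L2 g \<xi>) \<in> L2"
    "(\<lambda>x. japanese \<sigma> x * bessel s f x) \<in> L2" "(\<lambda>x. japanese \<sigma> x * bessel s g x) \<in> L2"
    using f g by (auto simp: sobolev_def)
  have d: "(\<lambda>x. f x - g x) \<in> L2" using L by auto
  have Td: "AE \<xi> in lborel. japanese s \<xi> * fourier_L2 (\<lambda>x. f x - g x) \<xi> = japanese s \<xi> * fourier_L2 f \<xi> - japanese s \<xi> * fourier_L2 g \<xi>"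
    using fourier_L2_diff[OF L(1,2)] by eventually_elim (simp only: right_diff_distrib)
  have m: "(\<lambda>\<xi>. japanese s \<xi> * fourier_L2 (\<lambda>x. f x - g x) \<xi>) \<in> borel_measurable borel"
    using fourier_L2_measurable[OF d] by measurable
  have j: "(\<lambda>\<xi>. japanese s \<xi> * fourier_L2 (\<lambda>x. f x - g x) \<xi>) \<in> L2"
    by (rule L2_cong(1)[OF L2_diff[OF L(3,4)] m Td])
  then have b: "bessel s (\<lambda>x. f x - g x) \<in> L2"
    "AE \<xi> in lborel. fourier_L2 (bessel s (\<lambda>x. f x - g x)) \<xi> = japanese s \<xi> * fourier_L2 (\<lambda>x. f x - g x) \<xi>"
    unfolding bessel_def by (auto intro!: fourier_mult_L2)
  note bf = bessel_L2[OF f] and bg = bessel_L2[OF g]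
  show eq: "AE x in lborel. bessel s (\<lambda>x. f x - g x) x = bessel s f x - bessel s g x"
  proof (rule fourier_L2_eqD[OF b(1) L2_diff[OF bf(1) bg(1)]])
    show "AE \<xi> in lborel. fourier_L2 (bessel s (\<lambda>x. f x - g x)) \<xi> = fourier_L2 (\<lambda>x. bessel s f x - bessel s g x) \<xi>"
      using b(2) Td bf(2) bg(2) fourier_L2_diff[OF bf(1) bg(1)] by eventually_elim simp
  qed
  have "AE x in lborel. japanese \<sigma> x * bessel s (\<lambda>x. f x - g x) x = japanese \<sigma> x * bessel s f x - japanese \<sigma> x * bessel s g x"
    using eq by eventually_elim (simp only: right_diff_distrib)
  then have "(\<lambda>x. japanese \<sigma> x * bessel s (\<lambda>x. f x - g x) x) \<in> L2"
    using L2_measurable[OF b(1)] by (intro L2_cong(1)[OF L2_diff[OF L(5,6)]]) auto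
  with d j show "(\<lambda>x. f x - g x) \<in> sobolev s \<sigma>" by (simp add: sobolev_def)
qed

lemma sobolev_norm_diff:
  assumes f: "f \<in> sobolev s \<sigma>" and g: "g \<in> sobolev s \<sigma>"
  shows "\<bar>sobolev_norm s \<sigma> f - sobolev_norm s \<sigma> g\<bar> \<le> sobolev_norm s \<sigma> (\<lambda>x. f x - g x)"
proof -
  have L: "(\<lambda>x. japanese \<sigma> x * bessel s f x) \<in> L2" "(\<lambda>x. japanese \<sigma> x * bessel s g x) \<in> L2"
    using f g by (auto simp: sobolev_def)
  have "AE x in lborel. japanese \<sigma> x * bessel s (\<lambda>x. f x - g x) x = japanese \<sigma> x * bessel s f x - japanese \<sigma> x * bessel s g x"
    using sobolev_diff(2)[OF f g] by eventually_elim (simp only: right_diff_distrib)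
  then have "sobolev_norm s \<sigma> (\<lambda>x. f x - g x) = L2_norm (\<lambda>x. japanese \<sigma> x * bessel s f x - japanese \<sigma> x * bessel s g x)"
    unfolding sobolev_norm_def using L2_measurable[OF bessel_L2(1)[OF sobolev_diff(1)[OF f g]]]
    by (intro L2_cong(2)[OF L2_diff[OF L]]) auto
  then show ?thesis
    using L2_norm_le_diff[OF L] L2_norm_le_diff[OF L(2,1)]
      L2_norm_minus_commute[of "\<lambda>x. japanese \<sigma> x * bessel s f x" "\<lambda>x. japanese \<sigma> x * bessel s g x"]
    unfolding sobolev_norm_def by linarith
qed

text \<open>Reverse triangle inequality for the complex numbers 1 + ix and 1 + iy.\<close>

lemma sqrt_lipschitz: "\<bar>sqrt (1 + x\<^sup>2) - sqrt (1 + y\<^sup>2)\<bar> \<le> \<bar>x - y\<bar>" for x y :: real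
  using norm_triangle_ineq3[of "Complex 1 x" "Complex 1 y"] by (simp add: cmod_def)

lemma inverse_sqrt_lipschitz: "\<bar>1 / sqrt (1 + x\<^sup>2) - 1 / sqrt (1 + y\<^sup>2)\<bar> \<le> \<bar>x - y\<bar>" for x y :: real
proof -
  let ?a = "sqrt (1 + x\<^sup>2)" and ?b = "sqrt (1 + y\<^sup>2)"
  have ab: "1 \<le> ?a" "1 \<le> ?b" by auto
  then have "1 \<le> ?a * ?b" using mult_mono[of 1 ?a 1 ?b] by simp
  have "1 / a - 1 / b = (b - a) / (a * b)" if "1 \<le> a" "1 \<le> b" for a b :: real
    using that by (simp add: field_simps)
  from this[OF ab] have "1 / ?a - 1 / ?b = (?b - ?a) / (?a * ?b)" .
  then have "\<bar>1 / ?a - 1 / ?b\<bar> = \<bar>?a - ?b\<bar> / (?a * ?b)"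
    using ab by (simp add: abs_mult abs_minus_commute)
  also have "\<dots> \<le> \<bar>?a - ?b\<bar> / 1" using \<open>1 \<le> ?a * ?b\<close> by (intro divide_left_mono) auto
  also have "\<dots> \<le> \<bar>x - y\<bar>" using sqrt_lipschitz[of x y] by simp
  finally show ?thesis .
qed

text \<open>The weight stands outside the Bessel potential w, so x must be commuted past its
  inverse. On the Fourier side that inverse is (1 + \<xi>^2)^(-1/2), bounded by 1 and 1-Lipschitz;
  increments of the product therefore cost the weighted norm of w plus its plain norm, whence the
  factor 2.\<close>

lemma sobolev_1_1_bounds:
  assumes f: "f \<in> sobolev 1 1"
  shows "f \<in> L2" "xmul f \<in> L2" "xmul (fourier_L2 f) \<in> L2"
    "L2_norm f \<le> sobolev_norm 1 1 f" "L2_norm (xmul f) \<le> 2 * sobolev_norm 1 1 f"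
    "L2_norm (xmul (fourier_L2 f)) \<le> sobolev_norm 1 1 f"
proof -
  let ?S = "sobolev_norm 1 1 f"
  define w where "w = bessel 1 f"
  show fL: "f \<in> L2" using f by (simp add: sobolev_def)
  have jw: "(\<lambda>x. japanese 1 x * w x) \<in> L2" "L2_norm (\<lambda>x. japanese 1 x * w x) = ?S"
    and jf: "(\<lambda>x. japanese 1 x * fourier_L2 f x) \<in> L2"
    using f by (auto simp: sobolev_def sobolev_norm_def w_def)
  have w: "w \<in> L2" "AE \<xi> in lborel. fourier_L2 w \<xi> = japanese 1 \<xi> * fourier_L2 f \<xi>"
    unfolding w_def using bessel_L2[OF f] by auto
  have [measurable]: "w \<in> borel_measurable borel" "f \<in> borel_measurable borel" "fourier_L2 f \<in> borel_measurable borel"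
    "fourier_L2 w \<in> borel_measurable borel"
    using w fL by (auto intro: L2_measurable fourier_L2_measurable)
  have j1: "cmod (y x) \<le> 1 * cmod (japanese 1 x * y x)" and jx: "cmod (xmul y x) \<le> 1 * cmod (japanese 1 x * y x)" for y x
  proof -
    have "1 * cmod (y x) \<le> sqrt (1 + x\<^sup>2) * cmod (y x)" by (intro mult_right_mono) auto
    then show "cmod (y x) \<le> 1 * cmod (japanese 1 x * y x)" by (simp add: japanese_1 norm_mult)
    have "\<bar>x\<bar> * cmod (y x) \<le> sqrt (1 + x\<^sup>2) * cmod (y x)"
      by (intro mult_right_mono real_le_rsqrt) auto
    then show "cmod (xmul y x) \<le> 1 * cmod (japanese 1 x * y x)" by (simp add: japanese_1 norm_mult)
  qed
  have wS: "L2_norm w \<le> ?S" "xmul w \<in> L2" "L2_norm (xmul w) \<le> ?S"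
    using L2_dominated[OF jw(1), of w 1] L2_dominated[OF jw(1), of "xmul w" 1] j1 jx jw(2) by auto
  have jf': "L2_norm (\<lambda>x. japanese 1 x * fourier_L2 f x) \<le> ?S"
    using L2_cong(2)[OF jf _ w(2)] L2_norm_fourier_L2[OF w(1)] wS by simp
  show "xmul (fourier_L2 f) \<in> L2"
    by (rule L2_dominated(1)[OF jf, of "xmul (fourier_L2 f)" 1]) (use jx in auto)
  have "L2_norm (xmul (fourier_L2 f)) \<le> 1 * L2_norm (\<lambda>x. japanese 1 x * fourier_L2 f x)"
    by (rule L2_dominated(2)[OF jf, of "xmul (fourier_L2 f)" 1]) (use jx in auto)
  then show "L2_norm (xmul (fourier_L2 f)) \<le> ?S" using jf' by simp
  have "L2_norm (fourier_L2 f) \<le> 1 * L2_norm (\<lambda>x. japanese 1 x * fourier_L2 f x)"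
    by (rule L2_dominated(2)[OF jf]) (use j1 in auto)
  then show "L2_norm f \<le> ?S" using jf' L2_norm_fourier_L2[OF fL] by simp
  have lip: "L2_norm (\<lambda>\<xi>. fourier_L2 f (\<xi> + h) - fourier_L2 f \<xi>) \<le> h * (2 * ?S + h * 0)" if h: "0 < h" for h
  proof -
    note Tw = fourier_L2_in_L2[OF w(1)]
    have "AE \<xi> in lborel. cmod (fourier_L2 f (\<xi> + h) - fourier_L2 f \<xi>)
        \<le> 1 * cmod (fourier_L2 w (\<xi> + h) - fourier_L2 w \<xi>) + h * cmod (fourier_L2 w \<xi>)"
      using w(2) AE_shift[OF w(2), of h]
    proof eventually_elim
      case (elim \<xi>)
      let ?b = "\<lambda>\<xi>. complex_of_real (1 / sqrt (1 + \<xi>\<^sup>2))"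
      have bj: "?b \<xi> * japanese 1 \<xi> = 1" for \<xi>
        using add_pos_nonneg[of 1 "\<xi>\<^sup>2"] by (simp add: japanese_1)
      have alg: "a * p - b * q = a * (p - q) + (a - b) * q" for a b p q :: complex
        by (simp add: algebra_simps)
      have F: "fourier_L2 f (\<xi> + h) = ?b (\<xi> + h) * fourier_L2 w (\<xi> + h)" "fourier_L2 f \<xi> = ?b \<xi> * fourier_L2 w \<xi>"
        unfolding elim mult.assoc[symmetric] bj by simp_all
      have "fourier_L2 f (\<xi> + h) - fourier_L2 f \<xi> = ?b (\<xi> + h) * (fourier_L2 w (\<xi> + h) - fourier_L2 w \<xi>)
          + (?b (\<xi> + h) - ?b \<xi>) * fourier_L2 w \<xi>"
        unfolding F by (rule alg)
      then have "cmod (fourier_L2 f (\<xi> + h) - fourier_L2 f \<xi>) \<le> cmod (?b (\<xi> + h)) * cmod (fourier_L2 w (\<xi> + h) - fourier_L2 w \<xi>)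
          + cmod (?b (\<xi> + h) - ?b \<xi>) * cmod (fourier_L2 w \<xi>)"
        by (metis norm_mult norm_triangle_ineq)
      also have "\<dots> \<le> 1 * cmod (fourier_L2 w (\<xi> + h) - fourier_L2 w \<xi>) + h * cmod (fourier_L2 w \<xi>)"
      proof (intro add_mono mult_right_mono)
        have "1 / sqrt (1 + (\<xi> + h)\<^sup>2) \<le> 1 / 1" by (rule divide_left_mono) (auto intro: add_pos_nonneg)
        then show "cmod (?b (\<xi> + h)) \<le> 1" by (simp add: norm_divide)
        have "cmod (?b (\<xi> + h) - ?b \<xi>) = \<bar>1 / sqrt (1 + (\<xi> + h)\<^sup>2) - 1 / sqrt (1 + \<xi>\<^sup>2)\<bar>"
          by (simp only: of_real_diff[symmetric] norm_of_real)
        then show "cmod (?b (\<xi> + h) - ?b \<xi>) \<le> h" using inverse_sqrt_lipschitz[of "\<xi> + h" \<xi>] h by simp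
      qed auto
      finally show ?case .
    qed
    then have "L2_norm (\<lambda>\<xi>. fourier_L2 f (\<xi> + h) - fourier_L2 f \<xi>)
        \<le> 1 * L2_norm (\<lambda>\<xi>. fourier_L2 w (\<xi> + h) - fourier_L2 w \<xi>) + h * L2_norm (fourier_L2 w)"
      using h by (intro L2_dominated2(2) L2_diff L2_shift Tw) auto
    also have "\<dots> \<le> \<bar>h\<bar> * L2_norm (xmul w) + h * L2_norm w"
      using fourier_L2_lipschitz[OF w(1) wS(2), of h] by (simp add: L2_norm_fourier_L2[OF w(1)])
    also have "\<dots> \<le> h * ?S + h * ?S" using h wS by (intro add_mono mult_mono) auto
    finally show ?thesis by (simp add: algebra_simps)
  qed
  have S0: "0 \<le> 2 * ?S" by (simp add: sobolev_norm_def)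
  show "xmul f \<in> L2" "L2_norm (xmul f) \<le> 2 * ?S"
    using weighted_if_fourier_L2_lipschitz[OF fL S0 lip] by auto
qed

text \<open>Sobolev embedding by inversion: the transform is integrable, and the constant sqrt pi /
  sqrt (2 pi) is below 1.\<close>

lemma sobolev_sup_bound:
  assumes f: "f \<in> L2" and xf: "xmul (fourier_L2 f) \<in> L2"
  shows "AE x in lborel. cmod (f x) \<le> L2_norm f + L2_norm (xmul (fourier_L2 f))"
proof -
  let ?F = "fourier_L2 f"
  have F: "?F \<in> L2" by (rule fourier_L2_in_L2[OF f])
  note w = weighted_imp_integrable[OF F xf]
  have "cmod (fourier ?F x) \<le> L2_norm f + L2_norm (xmul ?F)" for x
  proof -
    have "cmod (fourier ?F x) \<le> (1 / sqrt (2 * pi)) * (sqrt pi * (L2_norm ?F + L2_norm (xmul ?F)))"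
      by (rule order_trans[OF fourier_norm_le[OF w(1)] mult_left_mono[OF w(2)]]) simp
    also have "\<dots> = (1 / sqrt 2) * (L2_norm f + L2_norm (xmul ?F))"
      by (simp add: real_sqrt_mult L2_norm_fourier_L2[OF f])
    also have "\<dots> \<le> 1 * (L2_norm f + L2_norm (xmul ?F))" by (intro mult_right_mono) auto
    finally show ?thesis by simp
  qed
  note bound = this
  show ?thesis
    using inv_fourier_L2_fourier_L2[OF f] AE_reflect[OF fourier_L2_eq_fourier[OF F w(1)]]
    by eventually_elim (metis bound inv_fourier_L2_def)
qed

text \<open>Conjugating x by the free group adds t times the momentum. In terms of increments, the
  phase changes by t(h \<xi> + h^2/2): the first part gives the frequency weight, the second is the
  second order error that the Lipschitz criterion tolerates.\<close>

lemma xmul_schroedinger: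
  assumes f: "f \<in> L2" and xf: "xmul f \<in> L2" and xF: "xmul (fourier_L2 f) \<in> L2"
  shows "xmul (schroedinger t f) \<in> L2"
    "L2_norm (xmul (schroedinger t f)) \<le> L2_norm (xmul f) + \<bar>t\<bar> * L2_norm (xmul (fourier_L2 f))"
proof -
  let ?F = "fourier_L2 f" and ?E = "\<lambda>\<xi>. cis (- (t * \<xi>\<^sup>2 / 2))"
  have F: "?F \<in> L2" by (rule fourier_L2_in_L2[OF f])
  have [measurable]: "?F \<in> borel_measurable borel" by (rule L2_measurable[OF F])
  note S = schroedinger_L2[OF f, of t]
  let ?C = "L2_norm (xmul f) + \<bar>t\<bar> * L2_norm (xmul ?F)"
  have lip: "L2_norm (\<lambda>\<xi>. fourier_L2 (schroedinger t f) (\<xi> + h) - fourier_L2 (schroedinger t f) \<xi>)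
      \<le> h * (?C + h * (\<bar>t\<bar> * L2_norm ?F))" if h: "0 < h" for h
  proof -
    let ?A = "\<lambda>\<xi>. ?E (\<xi> + h) * (?F (\<xi> + h) - ?F \<xi>)"
    let ?B = "\<lambda>\<xi>. (?E (\<xi> + h) - ?E \<xi>) * ?F \<xi>"
    have A: "?A \<in> L2" "L2_norm ?A = L2_norm (\<lambda>\<xi>. ?F (\<xi> + h) - ?F \<xi>)"
      using cis_mult_L2[OF L2_diff[OF L2_shift(1)[OF F] F], of "\<lambda>\<xi>. - (t * (\<xi> + h)\<^sup>2 / 2)" h] by auto
    have Bb: "cmod (?B \<xi>) \<le> (\<bar>t\<bar> * h) * cmod (xmul ?F \<xi>) + (\<bar>t\<bar> * h * h) * cmod (?F \<xi>)" for \<xi>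
    proof -
      have "?E (\<xi> + h) - ?E \<xi> = ?E \<xi> * (cis (- (t * (h * \<xi> + h * h / 2))) - 1)"
        by (simp add: right_diff_distrib cis_mult power2_eq_square algebra_simps add_divide_distrib)
      then have "cmod (?E (\<xi> + h) - ?E \<xi>) = cmod (cis (- (t * (h * \<xi> + h * h / 2))) - 1)"
        by (simp add: norm_mult)
      also have "\<dots> \<le> \<bar>- (t * (h * \<xi> + h * h / 2))\<bar>" by (rule norm_cis_minus_1)
      also have "\<dots> = \<bar>t\<bar> * \<bar>h * \<xi> + h * h / 2\<bar>" by (simp only: abs_minus_cancel abs_mult)
      also have "\<dots> \<le> \<bar>t\<bar> * (h * \<bar>\<xi>\<bar> + h * h)"
      proof (rule mult_left_mono)
        show "\<bar>h * \<xi> + h * h / 2\<bar> \<le> h * \<bar>\<xi>\<bar> + h * h"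
        proof -
          have "\<bar>h * \<xi> + h * h / 2\<bar> \<le> h * \<bar>\<xi>\<bar> + h * h / 2"
            using abs_triangle_ineq[of "h * \<xi>" "h * h / 2"] h by (simp add: abs_mult)
          moreover have "0 < h * h" by (rule mult_pos_pos[OF h h])
          ultimately show ?thesis by linarith
        qed
      qed simp
      finally have "cmod (?E (\<xi> + h) - ?E \<xi>) * cmod (?F \<xi>) \<le> (\<bar>t\<bar> * (h * \<bar>\<xi>\<bar> + h * h)) * cmod (?F \<xi>)"
        by (intro mult_right_mono) auto
      then show ?thesis by (simp only: norm_mult norm_of_real distrib_left distrib_right mult_ac)
    qed
    have B: "?B \<in> L2" "L2_norm ?B \<le> (\<bar>t\<bar> * h) * L2_norm (xmul ?F) + (\<bar>t\<bar> * h * h) * L2_norm ?F"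
      using L2_dominated2[OF xF F, of ?B "\<bar>t\<bar> * h" "\<bar>t\<bar> * h * h"] Bb h by auto
    have ae: "AE \<xi> in lborel. fourier_L2 (schroedinger t f) (\<xi> + h) - fourier_L2 (schroedinger t f) \<xi> = ?A \<xi> + ?B \<xi>"
      using S(3) AE_shift[OF S(3), of h] by eventually_elim (simp add: algebra_simps)
    have "L2_norm (\<lambda>\<xi>. fourier_L2 (schroedinger t f) (\<xi> + h) - fourier_L2 (schroedinger t f) \<xi>) = L2_norm (\<lambda>\<xi>. ?A \<xi> + ?B \<xi>)"
      by (rule L2_cong(2)[OF L2_add[OF A(1) B(1)] L2_measurable ae])
        (intro L2_diff L2_shift fourier_L2_in_L2 S)
    also have "\<dots> \<le> L2_norm ?A + L2_norm ?B" by (rule L2_triangle[OF A(1) B(1)])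
    also have "\<dots> \<le> h * L2_norm (xmul f) + ((\<bar>t\<bar> * h) * L2_norm (xmul ?F) + (\<bar>t\<bar> * h * h) * L2_norm ?F)"
      using fourier_L2_lipschitz[OF f xf, of h] A(2) B(2) h by (intro add_mono) auto
    finally show ?thesis by (simp add: algebra_simps)
  qed
  have C0: "0 \<le> ?C" by simp
  show "xmul (schroedinger t f) \<in> L2" "L2_norm (xmul (schroedinger t f)) \<le> ?C"
    using weighted_if_fourier_L2_lipschitz[OF S(1) C0 lip] by auto
qed

subsection \<open>Solutions in the interaction picture\<close>

text \<open>The phase is Lipschitz in time with constant of order \<xi>^2, so the H^2 regularity of
  the solution pays for time regularity of \<open>V\<close>.\<close>

lemma L2_group_difference:
  assumes F: "F \<in> L2" and xF: "(\<lambda>\<xi>. complex_of_real (\<xi>\<^sup>2) * F \<xi>) \<in> L2"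
  shows "(\<lambda>\<xi>. (cis (r * \<xi>\<^sup>2 / 2) - cis (s * \<xi>\<^sup>2 / 2)) * F \<xi>) \<in> L2"
    "L2_norm (\<lambda>\<xi>. (cis (r * \<xi>\<^sup>2 / 2) - cis (s * \<xi>\<^sup>2 / 2)) * F \<xi>)
      \<le> \<bar>r - s\<bar> * L2_norm (\<lambda>\<xi>. complex_of_real (\<xi>\<^sup>2) * F \<xi>)"
    "cmod (cis (r * \<xi>\<^sup>2 / 2) - cis (s * \<xi>\<^sup>2 / 2)) \<le> \<bar>r - s\<bar> * \<xi>\<^sup>2"
proof -
  have le: "cmod (cis (r * \<xi>\<^sup>2 / 2) - cis (s * \<xi>\<^sup>2 / 2)) \<le> \<bar>r - s\<bar> * \<xi>\<^sup>2" for \<xi>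
  proof -
    have "cis (r * \<xi>\<^sup>2 / 2) - cis (s * \<xi>\<^sup>2 / 2) = cis (s * \<xi>\<^sup>2 / 2) * (cis ((r - s) * \<xi>\<^sup>2 / 2) - 1)"
    proof -
      have "s * \<xi>\<^sup>2 / 2 + (r - s) * \<xi>\<^sup>2 / 2 = r * \<xi>\<^sup>2 / 2"
        by (simp add: left_diff_distrib diff_divide_distrib)
      then show ?thesis by (simp only: right_diff_distrib cis_mult mult_1_right)
    qed
    then have "cmod (cis (r * \<xi>\<^sup>2 / 2) - cis (s * \<xi>\<^sup>2 / 2)) \<le> \<bar>(r - s) * \<xi>\<^sup>2 / 2\<bar>"
      using norm_cis_minus_1[of "(r - s) * \<xi>\<^sup>2 / 2"] by (simp add: norm_mult)
    also have "\<dots> \<le> \<bar>r - s\<bar> * \<xi>\<^sup>2" by (simp add: abs_mult)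
    finally show ?thesis .
  qed
  then show "cmod (cis (r * \<xi>\<^sup>2 / 2) - cis (s * \<xi>\<^sup>2 / 2)) \<le> \<bar>r - s\<bar> * \<xi>\<^sup>2" .
  have ae: "AE \<xi> in lborel. cmod ((cis (r * \<xi>\<^sup>2 / 2) - cis (s * \<xi>\<^sup>2 / 2)) * F \<xi>) \<le> \<bar>r - s\<bar> * cmod (complex_of_real (\<xi>\<^sup>2) * F \<xi>)"
    using le by (intro AE_I2) (auto simp: norm_mult norm_power mult.assoc[symmetric] intro!: mult_right_mono)
  show "(\<lambda>\<xi>. (cis (r * \<xi>\<^sup>2 / 2) - cis (s * \<xi>\<^sup>2 / 2)) * F \<xi>) \<in> L2"
    "L2_norm (\<lambda>\<xi>. (cis (r * \<xi>\<^sup>2 / 2) - cis (s * \<xi>\<^sup>2 / 2)) * F \<xi>)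
      \<le> \<bar>r - s\<bar> * L2_norm (\<lambda>\<xi>. complex_of_real (\<xi>\<^sup>2) * F \<xi>)"
    using L2_dominated[OF xF _ abs_ge_zero ae] L2_measurable[OF F] by auto
qed

text \<open>One equation with the other unknown as a coefficient. The system consists of two such
  components with the roles exchanged, so each estimate is proved once.\<close>

locale nls_component =
  fixes u v :: "real \<Rightarrow> real \<Rightarrow> complex"
  assumes u20: "continuous_in_sobolev 2 0 u" and u11: "continuous_in_sobolev 1 1 u"
    and v11: "continuous_in_sobolev 1 1 v" and eqn: "solves_equation v u"
begin

text \<open>The interaction-picture unknown, written \<open>V\<close> because \<open>v\<close>
  denotes the partner component; with \<open>n\<close> below, the equation becomes V' = -n.\<close>

definition V :: "real \<Rightarrow> real \<Rightarrow> complex" where "V t = schroedinger (- t) (u t)"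

definition n :: "real \<Rightarrow> real \<Rightarrow> complex" where "n t = schroedinger (- t) (damping (v t) (u t))"

lemma u_bounds:
  assumes "0 \<le> t"
  shows "u t \<in> L2" "xmul (u t) \<in> L2" "xmul (fourier_L2 (u t)) \<in> L2"
    "(\<lambda>\<xi>. complex_of_real (\<xi>\<^sup>2) * fourier_L2 (u t) \<xi>) \<in> L2"
proof -
  have "u t \<in> sobolev 1 1" using u11 assms by (auto simp: continuous_in_sobolev_def)
  from sobolev_1_1_bounds[OF this]
  show ut: "u t \<in> L2" "xmul (u t) \<in> L2" "xmul (fourier_L2 (u t)) \<in> L2" by auto
  have "(\<lambda>\<xi>. japanese 2 \<xi> * fourier_L2 (u t) \<xi>) \<in> L2"
    using u20 assms by (auto simp: continuous_in_sobolev_def sobolev_def)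
  then show "(\<lambda>\<xi>. complex_of_real (\<xi>\<^sup>2) * fourier_L2 (u t) \<xi>) \<in> L2"
  proof (rule L2_dominated(1))
    have "\<xi>\<^sup>2 * cmod (fourier_L2 (u t) \<xi>) \<le> (1 + \<xi>\<^sup>2) * cmod (fourier_L2 (u t) \<xi>)" for \<xi>
      by (intro mult_right_mono) auto
    moreover have "cmod (japanese 2 \<xi>) = 1 + \<xi>\<^sup>2" for \<xi>
      by (simp only: japanese_2 norm_of_real) (simp add: abs_of_nonneg)
    ultimately show "AE \<xi> in lborel. cmod (complex_of_real (\<xi>\<^sup>2) * fourier_L2 (u t) \<xi>) \<le> 1 * cmod (japanese 2 \<xi> * fourier_L2 (u t) \<xi>)"
      by (intro AE_I2) (simp add: norm_mult norm_power)
  qed (use fourier_L2_measurable[OF ut(1)] in auto)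
qed

lemma v_bounds:
  assumes "0 \<le> t"
  shows "v t \<in> L2" "xmul (v t) \<in> L2" "xmul (fourier_L2 (v t)) \<in> L2"
  using sobolev_1_1_bounds[of "v t"] v11 assms by (auto simp: continuous_in_sobolev_def)

lemma damping_in_L2:
  assumes "0 \<le> t"
  shows "damping (v t) (u t) \<in> L2"
  using damping_L2(1)[OF u_bounds(1)[OF assms] L2_measurable[OF v_bounds(1)[OF assms]] sobolev_sup_bound[OF v_bounds(1,3)[OF assms]]] .

lemma n_in_L2: "0 \<le> t \<Longrightarrow> n t \<in> L2"
  unfolding n_def by (intro schroedinger_L2 damping_in_L2)

lemma V_L2:
  assumes t: "0 \<le> t"
  shows "V t \<in> L2" "xmul (V t) \<in> L2" "L2_norm (V t) = L2_norm (u t)"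
    "AE \<xi> in lborel. fourier_L2 (V t) \<xi> = cis (t * \<xi>\<^sup>2 / 2) * fourier_L2 (u t) \<xi>"
    "xmul (fourier_L2 (V t)) \<in> L2" "L2_norm (xmul (fourier_L2 (V t))) = L2_norm (xmul (fourier_L2 (u t)))"
    "L2_norm (xmul (V t)) \<le> L2_norm (xmul (u t)) + t * L2_norm (xmul (fourier_L2 (u t)))"
    "AE x in lborel. u t x = schroedinger t (V t) x" "integrable lborel (V t)"
proof -
  note ub = u_bounds[OF t] and S = schroedinger_L2[OF u_bounds(1)[OF t], of "- t"]
  show V: "V t \<in> L2" "L2_norm (V t) = L2_norm (u t)" unfolding V_def by (auto intro: S)
  show FV: "AE \<xi> in lborel. fourier_L2 (V t) \<xi> = cis (t * \<xi>\<^sup>2 / 2) * fourier_L2 (u t) \<xi>"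
    using S(3) by (simp add: V_def)
  show xV: "xmul (V t) \<in> L2" and "L2_norm (xmul (V t)) \<le> L2_norm (xmul (u t)) + t * L2_norm (xmul (fourier_L2 (u t)))"
    unfolding V_def using xmul_schroedinger[OF ub(1-3), of "- t"] t by auto
  have c: "(\<lambda>\<xi>. cis (t * \<xi>\<^sup>2 / 2) * xmul (fourier_L2 (u t)) \<xi>) \<in> L2"
    "L2_norm (\<lambda>\<xi>. cis (t * \<xi>\<^sup>2 / 2) * xmul (fourier_L2 (u t)) \<xi>) = L2_norm (xmul (fourier_L2 (u t)))"
    using cis_mult_L2[OF ub(3), of "\<lambda>\<xi>. t * \<xi>\<^sup>2 / 2"] by auto
  have ae: "AE \<xi> in lborel. xmul (fourier_L2 (V t)) \<xi> = cis (t * \<xi>\<^sup>2 / 2) * xmul (fourier_L2 (u t)) \<xi>"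
    using FV by eventually_elim (simp add: mult.left_commute)
  have m: "xmul (fourier_L2 (V t)) \<in> borel_measurable borel"
    using fourier_L2_measurable[OF V(1)] by measurable
  show "xmul (fourier_L2 (V t)) \<in> L2" "L2_norm (xmul (fourier_L2 (V t))) = L2_norm (xmul (fourier_L2 (u t)))"
    using L2_cong[OF c(1) m ae] c(2) by auto
  show "AE x in lborel. u t x = schroedinger t (V t) x"
    using schroedinger_inverse[OF ub(1), of "- t"] by (auto simp: V_def elim!: eventually_mono)
  show "integrable lborel (V t)" by (rule weighted_imp_integrable[OF V(1) xV])
qed

text \<open>The increment of u is controlled by the H^{1,1} continuity and the increment of the
  phase by the weight \<xi>^2.\<close>

lemma V_continuous:
  assumes t: "0 \<le> t"
  shows "((\<lambda>\<tau>. L2_norm (\<lambda>x. V \<tau> x - V t x)) \<longlongrightarrow> 0) (at t within {0..})"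
    "((\<lambda>\<tau>. L2_norm (\<lambda>x. fourier_L2 (V \<tau>) x - fourier_L2 (V t) x)) \<longlongrightarrow> 0) (at t within {0..})"
proof -
  let ?K = "L2_norm (\<lambda>\<xi>. complex_of_real (\<xi>\<^sup>2) * fourier_L2 (u t) \<xi>)"
  have eq: "L2_norm (\<lambda>x. V \<tau> x - V t x) = L2_norm (\<lambda>x. fourier_L2 (V \<tau>) x - fourier_L2 (V t) x)" if "0 \<le> \<tau>" for \<tau>
    using fourier_L2_inj_norm[OF L2_diff[OF V_L2(1)[OF that] V_L2(1)[OF t]]
        L2_diff[OF fourier_L2_in_L2[OF V_L2(1)[OF that]] fourier_L2_in_L2[OF V_L2(1)[OF t]]]
        fourier_L2_diff[OF V_L2(1)[OF that] V_L2(1)[OF t]]] .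
  have bound: "L2_norm (\<lambda>x. fourier_L2 (V \<tau>) x - fourier_L2 (V t) x) \<le> sobolev_norm 1 1 (\<lambda>x. u \<tau> x - u t x) + \<bar>\<tau> - t\<bar> * ?K"
    if \<tau>: "0 \<le> \<tau>" for \<tau>
  proof -
    note u\<tau> = u_bounds[OF \<tau>] and ut = u_bounds[OF t]
    let ?A = "\<lambda>\<xi>. cis (\<tau> * \<xi>\<^sup>2 / 2) * (fourier_L2 (u \<tau>) \<xi> - fourier_L2 (u t) \<xi>)"
    let ?B = "\<lambda>\<xi>. (cis (\<tau> * \<xi>\<^sup>2 / 2) - cis (t * \<xi>\<^sup>2 / 2)) * fourier_L2 (u t) \<xi>"
    note FD = L2_diff[OF fourier_L2_in_L2[OF u\<tau>(1)] fourier_L2_in_L2[OF ut(1)]]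
    have A: "?A \<in> L2" "L2_norm ?A = L2_norm (\<lambda>\<xi>. fourier_L2 (u \<tau>) \<xi> - fourier_L2 (u t) \<xi>)"
      using cis_mult_L2[OF FD, of "\<lambda>\<xi>. \<tau> * \<xi>\<^sup>2 / 2"] by auto
    note B = L2_group_difference(1,2)[OF fourier_L2_in_L2[OF ut(1)] ut(4), of \<tau> t]
    have "AE \<xi> in lborel. fourier_L2 (V \<tau>) \<xi> - fourier_L2 (V t) \<xi> = ?A \<xi> + ?B \<xi>"
      using V_L2(4)[OF \<tau>] V_L2(4)[OF t] by eventually_elim (simp add: algebra_simps)
    then have "L2_norm (\<lambda>x. fourier_L2 (V \<tau>) x - fourier_L2 (V t) x) = L2_norm (\<lambda>\<xi>. ?A \<xi> + ?B \<xi>)"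
      by (intro L2_cong(2)[OF L2_add[OF A(1) B(1)] L2_measurable] L2_diff fourier_L2_in_L2 V_L2 \<tau> t)
    also have "\<dots> \<le> L2_norm ?A + L2_norm ?B" by (rule L2_triangle[OF A(1) B(1)])
    also have "L2_norm ?A = L2_norm (\<lambda>x. u \<tau> x - u t x)"
      unfolding A(2) by (rule fourier_L2_inj_norm[OF L2_diff[OF u\<tau>(1) ut(1)] FD fourier_L2_diff[OF u\<tau>(1) ut(1)], symmetric])
    also have "\<dots> \<le> sobolev_norm 1 1 (\<lambda>x. u \<tau> x - u t x)"
      by (intro sobolev_1_1_bounds(4) sobolev_diff) (use u11 \<tau> t in \<open>auto simp: continuous_in_sobolev_def\<close>)
    finally show ?thesis using B(2) by simp
  qed
  have ev: "\<forall>\<^sub>F \<tau> in at t within {0..}. 0 \<le> \<tau>" by (auto simp: eventually_at_filter)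
  have lim: "((\<lambda>\<tau>. sobolev_norm 1 1 (\<lambda>x. u \<tau> x - u t x) + \<bar>\<tau> - t\<bar> * ?K) \<longlongrightarrow> 0) (at t within {0..})"
  proof -
    have "((\<lambda>\<tau>. sobolev_norm 1 1 (\<lambda>x. u \<tau> x - u t x)) \<longlongrightarrow> 0) (at t within {0..})"
      using u11 t by (simp add: continuous_in_sobolev_def)
    moreover have "((\<lambda>\<tau>. \<bar>\<tau> - t\<bar> * ?K) \<longlongrightarrow> \<bar>t - t\<bar> * ?K) (at t within {0..})" by (intro tendsto_intros)
    ultimately show ?thesis using tendsto_add by fastforce
  qed
  show 2: "((\<lambda>\<tau>. L2_norm (\<lambda>x. fourier_L2 (V \<tau>) x - fourier_L2 (V t) x)) \<longlongrightarrow> 0) (at t within {0..})"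
    by (rule Lim_null_comparison[OF eventually_mono[OF ev] lim]) (use bound in simp)
  show "((\<lambda>\<tau>. L2_norm (\<lambda>x. V \<tau> x - V t x)) \<longlongrightarrow> 0) (at t within {0..})"
    by (rule Lim_transform_eventually[OF 2 eventually_mono[OF ev]]) (use eq in simp)
qed

text \<open>A product rule on the Fourier side, where \<open>dxx\<close> is multiplication by
  -\<xi>^2: the derivative of the phase cancels the free part of the equation and only -n
  remains.\<close>

lemma V_derivative:
  assumes t: "0 < t"
  shows "has_L2_time_derivative V (\<lambda>x. - n t x) t"
    "has_L2_time_derivative (\<lambda>\<tau>. fourier_L2 (V \<tau>)) (\<lambda>\<xi>. - fourier_L2 (n t) \<xi>) t"
proof -
  have t0: "0 \<le> t" using t by simp
  obtain ut where ut: "has_L2_time_derivative u ut t"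
    and pde: "AE x in lborel. \<i> * ut x + 1 / 2 * dxx (u t) x = - \<i> * damping (v t) (u t) x"
    using eqn t by (auto simp: solves_equation_def)
  let ?U = "fourier_L2 (u t)" and ?N = "damping (v t) (u t)" and ?E = "\<lambda>t \<xi>. cis (t * \<xi>\<^sup>2 / 2)"
  note ub = u_bounds[OF t0]
  have utL: "ut \<in> L2" using ut by (simp add: has_L2_time_derivative_def)
  have N: "?N \<in> L2" by (rule damping_in_L2[OF t0])
  have nt: "n t \<in> L2" by (rule n_in_L2[OF t0])
  have m2: "(\<lambda>\<xi>. - complex_of_real (\<xi>\<^sup>2) * ?U \<xi>) \<in> L2" using L2_uminus[OF ub(4)] by simp
  have dxx: "dxx (u t) \<in> L2" "AE \<xi> in lborel. fourier_L2 (dxx (u t)) \<xi> = - complex_of_real (\<xi>\<^sup>2) * ?U \<xi>"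
    unfolding dxx_def by (rule fourier_mult_L2[OF m2])+
  have "AE x in lborel. ut x = (\<i> / 2) * dxx (u t) x - ?N x"
    using pde
  proof eventually_elim
    case (elim x)
    have "ut x = - \<i> * (\<i> * ut x + 1 / 2 * dxx (u t) x) + (\<i> / 2) * dxx (u t) x"
      by (simp add: algebra_simps)
    then show ?case unfolding elim by (simp add: algebra_simps)
  qed
  then have eq: "fourier_L2 ut = fourier_L2 (\<lambda>x. (\<i> / 2) * dxx (u t) x - ?N x)"
    by (intro fourier_L2_cong_AE L2_measurable[OF utL] L2_measurable[OF L2_diff[OF L2_cmult[OF dxx(1)] N]])
  have Tut: "AE \<xi> in lborel. fourier_L2 ut \<xi> = - (\<i> / 2) * complex_of_real (\<xi>\<^sup>2) * ?U \<xi> - fourier_L2 ?N \<xi>"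
    using fourier_L2_diff[OF L2_cmult[OF dxx(1)] N, of "\<i> / 2"] fourier_L2_cmult[OF dxx(1), of "\<i> / 2"] dxx(2)
    by eventually_elim (simp add: eq)
  have Tn: "AE \<xi> in lborel. fourier_L2 (n t) \<xi> = ?E t \<xi> * fourier_L2 ?N \<xi>"
    unfolding n_def using schroedinger_L2(3)[OF N, of "- t"] by simp
  let ?W = "\<lambda>\<tau>. fourier_L2 (V \<tau>)"
  have ev: "\<forall>\<^sub>F h in at 0. 0 \<le> t + h"
    using t by (intro eventually_at_in_open'[of "{- t<..}", THEN eventually_mono]) auto
  have W: "?W \<tau> \<in> L2" if "0 \<le> \<tau>" for \<tau> by (intro fourier_L2_in_L2 V_L2 that)
  note TutL = fourier_L2_in_L2[OF utL]
  \<comment> \<open>The error of the difference quotient has three parts: the quotient error of u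
    under a unimodular phase, the phase increment times u_t, and the phase quotient error times
    u(t). The last is dominated by \<xi>^2 times the transform of u(t).\<close>
  let ?A = "\<lambda>h. L2_norm (\<lambda>x. (u (t + h) x - u t x) / complex_of_real h - ut x)"
  let ?Bf = "\<lambda>h \<xi>. (?E (t + h) \<xi> - ?E t \<xi>) * fourier_L2 ut \<xi>"
  let ?Cf = "\<lambda>h \<xi>. ((?E (t + h) \<xi> - ?E t \<xi>) / complex_of_real h - (\<i> / 2) * complex_of_real (\<xi>\<^sup>2) * ?E t \<xi>) * ?U \<xi>"
  have [measurable]: "fourier_L2 ut \<in> borel_measurable borel" "?U \<in> borel_measurable borel"
    using TutL fourier_L2_measurable[OF ub(1)] by (auto intro: L2_measurable)
  have BL: "?Bf h \<in> L2" for h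
    using L2_mult_bounded(1)[OF TutL, of "\<lambda>\<xi>. ?E (t + h) \<xi> - ?E t \<xi>" 2] norm_triangle_ineq4[of "cis _" "cis _"]
    by (auto intro: order_trans)
  have Cle: "cmod (?Cf h \<xi>) \<le> 2 * cmod (complex_of_real (\<xi>\<^sup>2) * ?U \<xi>)" for h \<xi>
  proof -
    have "cmod (?E (t + h) \<xi> - ?E t \<xi>) \<le> \<bar>h\<bar> * \<xi>\<^sup>2"
      using L2_group_difference(3)[OF fourier_L2_in_L2[OF ub(1)] ub(4), of "t + h" \<xi> t] by simp
    then have "cmod ((?E (t + h) \<xi> - ?E t \<xi>) / complex_of_real h) \<le> \<xi>\<^sup>2"
      by (cases "h = 0") (auto simp: norm_divide divide_le_eq mult.commute)
    moreover have "cmod ((\<i> / 2) * complex_of_real (\<xi>\<^sup>2) * ?E t \<xi>) \<le> \<xi>\<^sup>2" by (simp add: norm_mult norm_power)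
    ultimately have "cmod ((?E (t + h) \<xi> - ?E t \<xi>) / complex_of_real h - (\<i> / 2) * complex_of_real (\<xi>\<^sup>2) * ?E t \<xi>) \<le> 2 * \<xi>\<^sup>2"
      using norm_triangle_ineq4[of "(?E (t + h) \<xi> - ?E t \<xi>) / complex_of_real h" "(\<i> / 2) * complex_of_real (\<xi>\<^sup>2) * ?E t \<xi>"] by linarith
    then have "cmod ((?E (t + h) \<xi> - ?E t \<xi>) / complex_of_real h - (\<i> / 2) * complex_of_real (\<xi>\<^sup>2) * ?E t \<xi>) * cmod (?U \<xi>) \<le> 2 * \<xi>\<^sup>2 * cmod (?U \<xi>)"
      by (intro mult_right_mono) auto
    then show ?thesis by (simp add: norm_mult norm_power)
  qed
  have CL: "?Cf h \<in> L2" for h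
    by (rule L2_dominated(1)[OF ub(4), of _ 2]) (use Cle in auto)
  have Elim: "(\<lambda>i. cis ((t + X i) * \<xi>\<^sup>2 / 2)) \<longlonglongrightarrow> cis (t * \<xi>\<^sup>2 / 2)" if "X \<longlonglongrightarrow> 0" for X \<xi>
  proof -
    have "isCont cis (t * \<xi>\<^sup>2 / 2)"
      using continuous_on_cis[OF continuous_on_id, of UNIV] by (simp add: continuous_on_eq_continuous_at)
    moreover have "(\<lambda>i. (t + X i) * \<xi>\<^sup>2 / 2) \<longlonglongrightarrow> (t + 0) * \<xi>\<^sup>2 / 2" by (intro tendsto_intros that) auto
    ultimately show ?thesis using isCont_tendsto_compose by fastforce
  qed
  have B0: "((\<lambda>h. L2_norm (?Bf h)) \<longlongrightarrow> 0) (at 0)"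
    unfolding tendsto_at_iff_sequentially comp_def
  proof (intro allI impI)
    fix X :: "nat \<Rightarrow> real" assume X: "X \<longlonglongrightarrow> 0"
    have "(\<lambda>i. L2_norm (\<lambda>\<xi>. ?Bf (X i) \<xi> - 0)) \<longlonglongrightarrow> 0"
    proof (rule L2_dominated_convergence[where w = "\<lambda>\<xi>. 2 * fourier_L2 ut \<xi>"])
      have "cmod (?E (t + h) \<xi> - ?E t \<xi>) \<le> 2" for h \<xi>
        using norm_triangle_ineq4[of "?E (t + h) \<xi>" "?E t \<xi>"] by simp
      then show "AE \<xi> in lborel. cmod (?Bf (X i) \<xi> - 0) \<le> cmod (2 * fourier_L2 ut \<xi>)" for i
        by (intro AE_I2) (auto simp: norm_mult intro!: mult_right_mono)
      have "(\<lambda>i. ?Bf (X i) \<xi>) \<longlonglongrightarrow> (?E t \<xi> - ?E t \<xi>) * fourier_L2 ut \<xi>" for \<xi>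
        by (intro tendsto_intros Elim X)
      then show "AE \<xi> in lborel. (\<lambda>i. ?Bf (X i) \<xi>) \<longlonglongrightarrow> 0" by simp
    qed (use TutL in auto)
    then show "(\<lambda>i. L2_norm (?Bf (X i))) \<longlonglongrightarrow> 0" by simp
  qed
  have C0: "((\<lambda>h. L2_norm (?Cf h)) \<longlongrightarrow> 0) (at 0)"
    unfolding tendsto_at_iff_sequentially comp_def
  proof (intro allI impI)
    fix X :: "nat \<Rightarrow> real" assume X0: "\<forall>i. X i \<in> UNIV - {0}" and X: "X \<longlonglongrightarrow> 0"
    have "(\<lambda>i. L2_norm (\<lambda>\<xi>. ?Cf (X i) \<xi> - 0)) \<longlonglongrightarrow> 0"
    proof (rule L2_dominated_convergence[where w = "\<lambda>\<xi>. 2 * (complex_of_real (\<xi>\<^sup>2) * ?U \<xi>)"])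
      show "AE \<xi> in lborel. cmod (?Cf (X i) \<xi> - 0) \<le> cmod (2 * (complex_of_real (\<xi>\<^sup>2) * ?U \<xi>))" for i
        using Cle[of "X i"] by (intro AE_I2) (simp add: norm_mult[of 2])
      have "(\<lambda>i. ?Cf (X i) \<xi>) \<longlonglongrightarrow> ((\<i> / 2) * complex_of_real (\<xi>\<^sup>2) * ?E t \<xi> - (\<i> / 2) * complex_of_real (\<xi>\<^sup>2) * ?E t \<xi>) * ?U \<xi>" for \<xi>
      proof (intro tendsto_intros)
        have "((\<lambda>s. cis (s * \<xi>\<^sup>2 / 2)) has_vector_derivative (\<i> / 2) * complex_of_real (\<xi>\<^sup>2) * ?E t \<xi>) (at t)"
          unfolding has_vector_derivative_def by (auto intro!: derivative_eq_intros simp: scaleR_conv_of_real mult_ac)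
        then have "((\<lambda>h. (?E (t + h) \<xi> - ?E t \<xi>) / complex_of_real h) \<longlongrightarrow> (\<i> / 2) * complex_of_real (\<xi>\<^sup>2) * ?E t \<xi>) (at 0)"
          by (simp add: has_vector_derivative_iff_quotient)
        then show "(\<lambda>i. (?E (t + X i) \<xi> - ?E t \<xi>) / complex_of_real (X i)) \<longlonglongrightarrow> (\<i> / 2) * complex_of_real (\<xi>\<^sup>2) * ?E t \<xi>"
          using X0 X unfolding tendsto_at_iff_sequentially comp_def by auto
      qed
      then show "AE \<xi> in lborel. (\<lambda>i. ?Cf (X i) \<xi>) \<longlonglongrightarrow> 0" by simp
    qed (use ub(4) in auto)
    then show "(\<lambda>i. L2_norm (?Cf (X i))) \<longlonglongrightarrow> 0" by simp
  qed
  have A0: "(?A \<longlongrightarrow> 0) (at 0)" and AL: "\<forall>\<^sub>F h in at 0. (\<lambda>x. (u (t + h) x - u t x) / complex_of_real h - ut x) \<in> L2"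
    using ut by (auto simp: has_L2_time_derivative_def L2_tendsto_def)
  have quot: "(\<lambda>\<xi>. (?W (t + h) \<xi> - ?W t \<xi>) / complex_of_real h - (- fourier_L2 (n t) \<xi>)) \<in> L2"
    if h: "0 \<le> t + h" for h
    using L2_add[OF L2_cmult[OF L2_diff[OF W[OF h] W[OF t0]], of "1 / complex_of_real h"] fourier_L2_in_L2[OF nt]]
    by simp
  have main: "has_L2_time_derivative ?W (\<lambda>\<xi>. - fourier_L2 (n t) \<xi>) t"
    unfolding has_L2_time_derivative_def L2_tendsto_def
  proof (intro conjI)
    show "(\<lambda>\<xi>. - fourier_L2 (n t) \<xi>) \<in> L2" by (intro L2_uminus fourier_L2_in_L2 nt)
    show "\<forall>\<^sub>F h in at 0. (\<lambda>\<xi>. (?W (t + h) \<xi> - ?W t \<xi>) / complex_of_real h - (- fourier_L2 (n t) \<xi>)) \<in> L2"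
      using ev by eventually_elim (rule quot)
    show "((\<lambda>h. L2_norm (\<lambda>\<xi>. (?W (t + h) \<xi> - ?W t \<xi>) / complex_of_real h - (- fourier_L2 (n t) \<xi>))) \<longlongrightarrow> 0) (at 0)"
    proof (rule Lim_null_comparison)
      show "((\<lambda>h. ?A h + L2_norm (?Bf h) + L2_norm (?Cf h)) \<longlongrightarrow> 0) (at 0)"
        using tendsto_add[OF tendsto_add[OF A0 B0] C0] by simp
      show "\<forall>\<^sub>F h in at 0. norm (L2_norm (\<lambda>\<xi>. (?W (t + h) \<xi> - ?W t \<xi>) / complex_of_real h - (- fourier_L2 (n t) \<xi>)))
          \<le> ?A h + L2_norm (?Bf h) + L2_norm (?Cf h)"
        using ev AL
      proof eventually_elim
        case (elim h)
        note uh = u_bounds(1)[OF elim(1)]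
        let ?q = "\<lambda>x. (1 / complex_of_real h) * (u (t + h) x - u t x)"
        have q: "?q \<in> L2" by (intro L2_cmult L2_diff uh ub)
        let ?Q = "\<lambda>\<xi>. (fourier_L2 (u (t + h)) \<xi> - ?U \<xi>) / complex_of_real h - fourier_L2 ut \<xi>"
        have TQ: "AE \<xi> in lborel. fourier_L2 (\<lambda>x. ?q x - ut x) \<xi> = ?Q \<xi>"
          using fourier_L2_diff[OF q utL] fourier_L2_cmult[OF L2_diff[OF uh ub(1)], of "1 / complex_of_real h"]
            fourier_L2_diff[OF uh ub(1)] by eventually_elim simp
        have Q: "?Q \<in> L2"
          using L2_diff[OF L2_cmult[OF L2_diff[OF fourier_L2_in_L2[OF uh] fourier_L2_in_L2[OF ub(1)]], of "1 / complex_of_real h"] TutL]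
          by simp
        have QA: "L2_norm ?Q = ?A h"
          using fourier_L2_inj_norm[OF L2_diff[OF q utL] Q TQ] by simp
        let ?P = "\<lambda>\<xi>. ?E (t + h) \<xi> * ?Q \<xi>"
        have P: "?P \<in> L2" "L2_norm ?P = ?A h"
          using cis_mult_L2[OF Q, of "\<lambda>\<xi>. (t + h) * \<xi>\<^sup>2 / 2"] QA by auto
        have "AE \<xi> in lborel. (?W (t + h) \<xi> - ?W t \<xi>) / complex_of_real h - (- fourier_L2 (n t) \<xi>) = (?P \<xi> + ?Bf h \<xi>) + ?Cf h \<xi>"
          using V_L2(4)[OF elim(1)] V_L2(4)[OF t0] Tut Tn
        proof eventually_elim
          case (elim \<xi>)
          have Nn: "?E t \<xi> * fourier_L2 (damping (v t) (u t)) \<xi> = - ?E t \<xi> * ((\<i> / 2) * complex_of_real (\<xi>\<^sup>2) * ?U \<xi> + fourier_L2 ut \<xi>)"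
            unfolding elim(3) by (simp add: algebra_simps)
          show ?case unfolding elim(1,2,4) Nn by (simp add: diff_divide_distrib algebra_simps)
        qed
        then have "L2_norm (\<lambda>\<xi>. (?W (t + h) \<xi> - ?W t \<xi>) / complex_of_real h - (- fourier_L2 (n t) \<xi>)) = L2_norm (\<lambda>\<xi>. (?P \<xi> + ?Bf h \<xi>) + ?Cf h \<xi>)"
          by (rule L2_cong(2)[OF L2_add[OF L2_add[OF P(1) BL] CL] L2_measurable[OF quot[OF elim(1)]]])
        also have "\<dots> \<le> L2_norm (\<lambda>\<xi>. ?P \<xi> + ?Bf h \<xi>) + L2_norm (?Cf h)" by (rule L2_triangle[OF L2_add[OF P(1) BL] CL])
        also have "\<dots> \<le> L2_norm ?P + L2_norm (?Bf h) + L2_norm (?Cf h)" using L2_triangle[OF P(1) BL] by simp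
        finally show ?case using P(2) by simp
      qed
    qed
  qed
  show "has_L2_time_derivative (\<lambda>\<tau>. fourier_L2 (V \<tau>)) (\<lambda>\<xi>. - fourier_L2 (n t) \<xi>) t" by (rule main)
  have Tm: "AE \<xi> in lborel. fourier_L2 (\<lambda>x. - n t x) \<xi> = - fourier_L2 (n t) \<xi>"
    using fourier_L2_cmult[OF nt, of "-1"] by simp
  show "has_L2_time_derivative V (\<lambda>x. - n t x) t"
    using has_L2_time_derivative_fourier_iff[of V ?W "\<lambda>x. - n t x" "\<lambda>\<xi>. - fourier_L2 (n t) \<xi>" t] main
    by (simp add: V_L2 W nt fourier_L2_in_L2 Tm t L2_uminus)
qed

end

subsection \<open>Pointwise transforms of curves\<close>

lemma fourier_norm_le_weighted:
  assumes f: "f \<in> L2" and xf: "xmul f \<in> L2"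
  shows "cmod (fourier f \<xi>) \<le> L2_norm f + L2_norm (xmul f)"
proof -
  have "cmod (fourier f \<xi>) \<le> (1 / sqrt (2 * pi)) * (sqrt pi * (L2_norm f + L2_norm (xmul f)))"
    by (rule order_trans[OF fourier_norm_le mult_left_mono])
      (auto intro: weighted_imp_integrable[OF f xf])
  also have "\<dots> = (1 / sqrt 2) * (L2_norm f + L2_norm (xmul f))" by (simp add: real_sqrt_mult)
  also have "\<dots> \<le> 1 * (L2_norm f + L2_norm (xmul f))" by (intro mult_right_mono) auto
  finally show ?thesis by simp
qed

text \<open>The function by which x f must be multiplied to recover what truncation cuts off from f.
  Starting at m + 1 instead of m keeps x away from 0, where 1/x is not square integrable.\<close>

definition tail :: "nat \<Rightarrow> real \<Rightarrow> complex" where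
  "tail m x = (if real (Suc m) < \<bar>x\<bar> then complex_of_real (1 / x) else 0)"

lemma tail_L2: "tail m \<in> L2" and tail_tendsto: "(\<lambda>m. L2_norm (tail m)) \<longlonglongrightarrow> 0"
proof -
  let ?w = "\<lambda>x::real. 2 * complex_of_real (1 / sqrt (1 + x\<^sup>2))"
  have w: "?w \<in> L2" by (intro L2_cmult cauchy_weight_L2)
  have [measurable]: "tail m \<in> borel_measurable borel" for m
    unfolding tail_def[abs_def] by measurable
  have le: "cmod (tail m x) \<le> cmod (?w x)" for m x
  proof (cases "real (Suc m) < \<bar>x\<bar>")
    case True
    then have x1: "1 < \<bar>x\<bar>" by simp
    have "sqrt (1 + x\<^sup>2) \<le> 1 + \<bar>x\<bar>"
      by (rule real_le_lsqrt) (auto simp: power2_eq_square algebra_simps)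
    also have "\<dots> \<le> 2 * \<bar>x\<bar>" using x1 by simp
    finally have "sqrt (1 + x\<^sup>2) \<le> 2 * \<bar>x\<bar>" .
    moreover have "0 < sqrt (1 + x\<^sup>2)" by (simp add: add_pos_nonneg)
    ultimately have "1 / \<bar>x\<bar> \<le> 2 / sqrt (1 + x\<^sup>2)" using x1 by (simp add: field_simps)
    then show ?thesis using True by (simp add: tail_def norm_mult norm_divide)
  qed (simp add: tail_def)
  show "tail m \<in> L2" by (rule L2_dominated(1)[OF w, of _ 1]) (use le in auto)
  have lim: "(\<lambda>m. tail m x) \<longlonglongrightarrow> 0" for x
  proof (rule tendsto_eventually)
    obtain N :: nat where N: "\<bar>x\<bar> \<le> real N" using real_arch_simple by blast
    show "\<forall>\<^sub>F m in sequentially. tail m x = 0"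
      using eventually_ge_at_top[of N] by eventually_elim (use N in \<open>auto simp: tail_def\<close>)
  qed
  have "(\<lambda>m. L2_norm (\<lambda>x. tail m x - 0)) \<longlonglongrightarrow> 0"
    by (rule L2_dominated_convergence[OF _ _ w]) (use le lim in auto)
  then show "(\<lambda>m. L2_norm (tail m)) \<longlonglongrightarrow> 0" by simp
qed

lemma fourier_trunc_difference:
  assumes f: "f \<in> L2" and xf: "xmul f \<in> L2"
  shows "cmod (fourier (trunc (Suc m) f) \<xi> - fourier f \<xi>) \<le> L2_norm (tail m) * L2_norm (xmul f)"
proof -
  have i: "integrable lborel f" by (rule weighted_imp_integrable[OF f xf])
  have eq: "f x - trunc (Suc m) f x = tail m x * xmul f x" for x
    by (auto simp: trunc_def tail_def indicator_def)
  have "cmod (fourier (trunc (Suc m) f) \<xi> - fourier f \<xi>) = cmod (fourier (\<lambda>x. tail m x * xmul f x) \<xi>)"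
    unfolding eq[symmetric] using fourier_diff[OF i trunc_L2(2)[OF f]] by (simp add: norm_minus_commute)
  also have "\<dots> \<le> (1 / sqrt (2 * pi)) * (LINT x|lborel. cmod (tail m x * xmul f x))"
    by (rule fourier_norm_le[OF L2_Cauchy_Schwarz(1)[OF tail_L2 xf]])
  also have "\<dots> \<le> 1 * (LINT x|lborel. cmod (tail m x) * cmod (xmul f x))"
  proof -
    have "1 / sqrt (2 * pi) \<le> 1" using pi_ge_two by simp
    then show ?thesis unfolding norm_mult[of "tail _ _"] by (rule mult_right_mono) simp
  qed
  also have "\<dots> \<le> L2_norm (tail m) * L2_norm (xmul f)"
    using L2_Cauchy_Schwarz(2)[OF tail_L2 xf] by simp
  finally show ?thesis .
qed

text \<open>Evaluation of the transform at a point is not continuous on L2; for truncations it is a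
  pairing with a fixed L2 function, so L2 calculus applies.\<close>

lemma fourier_trunc_pairing:
  "fourier (trunc m f) \<xi> = (LINT x|lborel. f x * (complex_of_real (1 / sqrt (2 * pi)) * (cis (- (x * \<xi>)) * indicator {- real m..real m} x)))"
  "(\<lambda>x. complex_of_real (1 / sqrt (2 * pi)) * (cis (- (x * \<xi>)) * indicator {- real m..real m} x)) \<in> L2"
proof -
  show "fourier (trunc m f) \<xi> = (LINT x|lborel. f x * (complex_of_real (1 / sqrt (2 * pi)) * (cis (- (x * \<xi>)) * indicator {- real m..real m} x)))"
    unfolding fourier_eq_cis trunc_def integral_mult_right_zero[symmetric] by (simp add: mult_ac)
  show "(\<lambda>x. complex_of_real (1 / sqrt (2 * pi)) * (cis (- (x * \<xi>)) * indicator {- real m..real m} x)) \<in> L2"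
    by (intro L2_cmult cis_mult_L2 indicator_interval_L2) auto
qed

text \<open>Truncated transforms can be differentiated as pairings. The uniform bound C on the
  weighted derivative makes their derivatives converge uniformly in time, so the limit is
  differentiable at the fixed frequency.\<close>

lemma fourier_curve_derivative:
  assumes w: "\<And>\<tau>. 0 \<le> \<tau> \<Longrightarrow> w \<tau> \<in> L2" and xw: "\<And>\<tau>. 0 \<le> \<tau> \<Longrightarrow> xmul (w \<tau>) \<in> L2"
    and d: "\<And>\<tau>. a < \<tau> \<Longrightarrow> \<tau> < b \<Longrightarrow> has_L2_time_derivative w (d \<tau>) \<tau>"
    and xd: "\<And>\<tau>. a < \<tau> \<Longrightarrow> \<tau> < b \<Longrightarrow> xmul (d \<tau>) \<in> L2"
    and C: "\<And>\<tau>. a < \<tau> \<Longrightarrow> \<tau> < b \<Longrightarrow> L2_norm (xmul (d \<tau>)) \<le> C"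
    and t: "0 \<le> a" "a < t" "t < b"
  shows "((\<lambda>\<tau>. fourier (w \<tau>) \<xi>) has_vector_derivative fourier (d t) \<xi>) (at t)"
proof -
  let ?f = "\<lambda>m \<tau>. fourier (trunc (Suc m) (w \<tau>)) \<xi>" and ?f' = "\<lambda>m \<tau>. fourier (trunc (Suc m) (d \<tau>)) \<xi>"
  have dL: "d \<tau> \<in> L2" if "a < \<tau>" "\<tau> < b" for \<tau> using d[OF that] by (simp add: has_L2_time_derivative_def)
  have lim: "(\<lambda>m. ?f m \<tau>) \<longlonglongrightarrow> fourier (w \<tau>) \<xi>" if "0 \<le> \<tau>" for \<tau>
  proof -
    have "(\<lambda>m. L2_norm (tail m) * L2_norm (xmul (w \<tau>))) \<longlonglongrightarrow> 0"
      using tendsto_mult_right[OF tail_tendsto, of "L2_norm (xmul (w \<tau>))"] by simp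
    then have "(\<lambda>m. ?f m \<tau> - fourier (w \<tau>) \<xi>) \<longlonglongrightarrow> 0"
      by (rule Lim_null_comparison[rotated]) (use fourier_trunc_difference[OF w[OF that] xw[OF that]] in simp)
    then show ?thesis by (simp add: LIM_zero_iff)
  qed
  have "\<exists>g. \<forall>x\<in>{a<..<b}. (\<lambda>m. ?f m x) \<longlonglongrightarrow> g x \<and>
      (g has_derivative (\<lambda>h. h *\<^sub>R fourier (d x) \<xi>)) (at x within {a<..<b})"
  proof (rule has_derivative_sequence[where f' = "\<lambda>m x h. h *\<^sub>R ?f' m x" and ?x0.0 = t])
    show "(?f m has_derivative (\<lambda>h. h *\<^sub>R ?f' m x)) (at x within {a<..<b})" if "x \<in> {a<..<b}" for m x
    proof -
      have x: "a < x" "x < b" "0 < x" using that t by auto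
      have "(?f m has_vector_derivative ?f' m x) (at x)"
        unfolding fourier_trunc_pairing(1)[of "Suc m"]
        by (rule L2_pairing_derivative[OF w d[OF x(1,2)] x(3) fourier_trunc_pairing(2)])
      then show ?thesis
        unfolding has_vector_derivative_def by (rule has_derivative_at_withinI)
    qed
    show "\<forall>\<^sub>F m in sequentially. \<forall>x\<in>{a<..<b}. \<forall>h. norm (h *\<^sub>R ?f' m x - h *\<^sub>R fourier (d x) \<xi>) \<le> e * norm h"
      if e: "0 < e" for e
    proof -
      have C0: "0 \<le> C" using C[OF t(2,3)] order_trans[OF L2_norm_nonneg] by blast
      have "(\<lambda>m. L2_norm (tail m) * C) \<longlonglongrightarrow> 0 * C" by (intro tendsto_mult_right tail_tendsto)
      then have "\<forall>\<^sub>F m in sequentially. L2_norm (tail m) * C < e" using e by (intro order_tendstoD(2)) auto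
      then show ?thesis
      proof eventually_elim
        case (elim m)
        show ?case
        proof (intro ballI allI)
          fix x h :: real assume "x \<in> {a<..<b}"
          then have x: "a < x" "x < b" by auto
          have "cmod (?f' m x - fourier (d x) \<xi>) \<le> L2_norm (tail m) * L2_norm (xmul (d x))"
            by (rule fourier_trunc_difference[OF dL[OF x] xd[OF x]])
          also have "\<dots> \<le> L2_norm (tail m) * C" using C[OF x] by (intro mult_left_mono) auto
          also have "\<dots> \<le> e" using elim by simp
          finally have "cmod (?f' m x - fourier (d x) \<xi>) * \<bar>h\<bar> \<le> e * \<bar>h\<bar>" by (intro mult_right_mono) auto
          then show "norm (h *\<^sub>R ?f' m x - h *\<^sub>R fourier (d x) \<xi>) \<le> e * norm h"
            by (simp add: mult.commute flip: scaleR_right_diff_distrib)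
        qed
      qed
    qed
    show "t \<in> {a<..<b}" using t by simp
    show "(\<lambda>m. ?f m t) \<longlonglongrightarrow> fourier (w t) \<xi>" using t by (intro lim) simp
  qed simp
  then obtain g where g: "\<And>x. x \<in> {a<..<b} \<Longrightarrow> (\<lambda>m. ?f m x) \<longlonglongrightarrow> g x"
    "\<And>x. x \<in> {a<..<b} \<Longrightarrow> (g has_derivative (\<lambda>h. h *\<^sub>R fourier (d x) \<xi>)) (at x within {a<..<b})"
    by blast
  have gw: "g x = fourier (w x) \<xi>" if "x \<in> {a<..<b}" for x
    using LIMSEQ_unique[OF g(1)[OF that] lim[of x]] that t by simp
  have "(g has_derivative (\<lambda>h. h *\<^sub>R fourier (d t) \<xi>)) (at t)"
    using g(2)[of t] t by (simp add: at_within_open[of t "{a<..<b}"])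
  then have "((\<lambda>\<tau>. fourier (w \<tau>) \<xi>) has_derivative (\<lambda>h. h *\<^sub>R fourier (d t) \<xi>)) (at t)"
    by (rule has_derivative_transform_within_open[of _ _ _ _ "{a<..<b}"]) (use t gw in auto)
  then show ?thesis by (simp add: has_vector_derivative_def)
qed

lemma fourier_curve_continuous:
  fixes w :: "real \<Rightarrow> real \<Rightarrow> complex"
  assumes w: "\<And>\<tau>. 0 \<le> \<tau> \<Longrightarrow> w \<tau> \<in> L2" and xw: "\<And>\<tau>. 0 \<le> \<tau> \<Longrightarrow> xmul (w \<tau>) \<in> L2"
    and c: "\<And>t. 0 \<le> t \<Longrightarrow> ((\<lambda>\<tau>. L2_norm (\<lambda>x. w \<tau> x - w t x)) \<longlongrightarrow> 0) (at t within {0..})"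
    and C: "\<And>\<tau>. 0 \<le> \<tau> \<Longrightarrow> \<tau> \<le> T \<Longrightarrow> L2_norm (xmul (w \<tau>)) \<le> C"
  shows "continuous_on {0..T} (\<lambda>\<tau>. fourier (w \<tau>) \<xi>)"
proof (rule uniform_limit_theorem[where f = "\<lambda>m \<tau>. fourier (trunc (Suc m) (w \<tau>)) \<xi>" and F = sequentially])
  show "\<forall>\<^sub>F m in sequentially. continuous_on {0..T} (\<lambda>\<tau>. fourier (trunc (Suc m) (w \<tau>)) \<xi>)"
    unfolding fourier_trunc_pairing(1)
    by (intro always_eventually allI continuous_on_subset[OF L2_pairing_continuous[OF w c fourier_trunc_pairing(2)]]) auto
  show "uniform_limit {0..T} (\<lambda>m \<tau>. fourier (trunc (Suc m) (w \<tau>)) \<xi>) (\<lambda>\<tau>. fourier (w \<tau>) \<xi>) sequentially"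
  proof (rule uniform_limitI)
    fix e :: real assume e: "0 < e"
    have "(\<lambda>m. L2_norm (tail m) * \<bar>C\<bar>) \<longlonglongrightarrow> 0 * \<bar>C\<bar>" by (intro tendsto_mult_right tail_tendsto)
    then have "\<forall>\<^sub>F m in sequentially. L2_norm (tail m) * \<bar>C\<bar> < e" using e by (intro order_tendstoD(2)) auto
    then show "\<forall>\<^sub>F m in sequentially. \<forall>\<tau>\<in>{0..T}. dist (fourier (trunc (Suc m) (w \<tau>)) \<xi>) (fourier (w \<tau>) \<xi>) < e"
    proof eventually_elim
      case (elim m)
      show ?case
      proof
        fix \<tau> assume "\<tau> \<in> {0..T}"
        then have \<tau>: "0 \<le> \<tau>" "\<tau> \<le> T" by auto
        have "cmod (fourier (trunc (Suc m) (w \<tau>)) \<xi> - fourier (w \<tau>) \<xi>) \<le> L2_norm (tail m) * L2_norm (xmul (w \<tau>))"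
          by (rule fourier_trunc_difference[OF w[OF \<tau>(1)] xw[OF \<tau>(1)]])
        also have "\<dots> \<le> L2_norm (tail m) * \<bar>C\<bar>" using C[OF \<tau>] by (intro mult_left_mono) auto
        finally show "dist (fourier (trunc (Suc m) (w \<tau>)) \<xi>) (fourier (w \<tau>) \<xi>) < e"
          using elim by (simp add: dist_norm)
      qed
    qed
  qed
qed simp

subsection \<open>Growth of weighted norms\<close>

text \<open>A Gronwall argument without continuity of Y. The crude bound M starts an iteration in
  which each use of \<open>step\<close> halves the excess over 2 * Y 0; the limit removes every
  trace of M, so only its finiteness matters.\<close>

lemma growth_closure:
  fixes Y :: "real \<Rightarrow> real"
  assumes bdd: "\<And>t. 0 \<le> t \<Longrightarrow> t \<le> T \<Longrightarrow> Y t \<le> M" and Y0: "0 \<le> Y 0" and p: "0 < p"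
    and step: "\<And>D t. 0 < t \<Longrightarrow> t \<le> T \<Longrightarrow> 0 \<le> D \<Longrightarrow> (\<And>\<tau>. 0 < \<tau> \<Longrightarrow> \<tau> < t \<Longrightarrow> Y \<tau> \<le> D * (1 + \<tau>) powr p)
      \<Longrightarrow> Y t \<le> Y 0 + D / 2 * ((1 + t) powr p - 1)"
    and t: "0 \<le> t" "t \<le> T"
  shows "Y t \<le> 2 * Y 0 * (1 + t) powr p"
proof -
  have one: "1 \<le> (1 + t) powr p" if "0 \<le> t" for t :: real using that p by (simp add: ge_one_powr_ge_zero)
  have it: "\<forall>t. 0 \<le> t \<longrightarrow> t \<le> T \<longrightarrow> Y t \<le> (2 * Y 0 + \<bar>M\<bar> / 2 ^ k) * (1 + t) powr p" for k
  proof (induction k)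
    case 0
    show ?case
    proof (intro allI impI)
      fix t :: real assume t: "0 \<le> t" "t \<le> T"
      have "Y t \<le> (2 * Y 0 + \<bar>M\<bar>) * 1" using bdd[OF t] Y0 by simp
      also have "\<dots> \<le> (2 * Y 0 + \<bar>M\<bar>) * (1 + t) powr p" using one[OF t(1)] Y0 by (intro mult_left_mono) auto
      finally show "Y t \<le> (2 * Y 0 + \<bar>M\<bar> / 2 ^ 0) * (1 + t) powr p" by simp
    qed
  next
    case (Suc k)
    let ?D = "2 * Y 0 + \<bar>M\<bar> / 2 ^ k"
    have D0: "0 \<le> ?D" using Y0 by simp
    show ?case
    proof (intro allI impI)
      fix t :: real assume t: "0 \<le> t" "t \<le> T"
      have "Y t \<le> Y 0 + ?D / 2 * ((1 + t) powr p - 1)"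
      proof (cases "t = 0")
        case False
        then show ?thesis using t Suc.IH by (intro step D0) auto
      qed simp
      also have "\<dots> \<le> Y 0 * (1 + t) powr p + ?D / 2 * (1 + t) powr p"
      proof (rule add_mono)
        show "Y 0 \<le> Y 0 * (1 + t) powr p" using mult_left_mono[OF one[OF t(1)] Y0] by simp
        show "?D / 2 * ((1 + t) powr p - 1) \<le> ?D / 2 * (1 + t) powr p" using D0 by (intro mult_left_mono) auto
      qed
      also have "\<dots> = (2 * Y 0 + \<bar>M\<bar> / 2 ^ Suc k) * (1 + t) powr p"
        by (simp add: algebra_simps add_divide_distrib)
      finally show "Y t \<le> (2 * Y 0 + \<bar>M\<bar> / 2 ^ Suc k) * (1 + t) powr p" .
    qed
  qed
  have "(\<lambda>k. \<bar>M\<bar> * (1/2) ^ k) \<longlonglongrightarrow> \<bar>M\<bar> * 0" by (intro tendsto_mult_left LIMSEQ_power_zero) simp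
  moreover have "\<bar>M\<bar> * (1/2) ^ k = \<bar>M\<bar> / 2 ^ k" for k by (simp add: power_one_over)
  ultimately have z: "(\<lambda>k. \<bar>M\<bar> / 2 ^ k) \<longlonglongrightarrow> 0" by simp
  have "(\<lambda>k. (2 * Y 0 + \<bar>M\<bar> / 2 ^ k) * (1 + t) powr p) \<longlonglongrightarrow> (2 * Y 0 + 0) * (1 + t) powr p"
    by (intro tendsto_mult_right tendsto_add tendsto_const z)
  from LIMSEQ_le_const[OF this, of "Y t"] it t show ?thesis by simp
qed

text \<open>The rate \<kappa>^2/(1 + t) is critical for power growth. If the sum is at most D(1 +
  t)^p, integration gains 2\<kappa>^2 D/p in each component, and 8\<kappa>^2 \<le> p limits this to
  D/4, hence to D/2 for the sum, as the closure requires.\<close>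

lemma weighted_pair_growth:
  fixes w1 w2 d1 d2 :: "real \<Rightarrow> real \<Rightarrow> complex" and \<phi> :: "real \<Rightarrow> real"
  defines "A \<equiv> \<lambda>t. L2_norm (\<lambda>x. complex_of_real (\<phi> x) * w1 t x)"
    and "B \<equiv> \<lambda>t. L2_norm (\<lambda>x. complex_of_real (\<phi> x) * w2 t x)"
  assumes w1: "\<And>\<tau>. 0 \<le> \<tau> \<Longrightarrow> w1 \<tau> \<in> L2"
    and c1: "\<And>t. 0 \<le> t \<Longrightarrow> ((\<lambda>\<tau>. L2_norm (\<lambda>x. w1 \<tau> x - w1 t x)) \<longlongrightarrow> 0) (at t within {0..})"
    and d1: "\<And>t. 0 < t \<Longrightarrow> has_L2_time_derivative w1 (d1 t) t"
    and w2: "\<And>\<tau>. 0 \<le> \<tau> \<Longrightarrow> w2 \<tau> \<in> L2"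
    and c2: "\<And>t. 0 \<le> t \<Longrightarrow> ((\<lambda>\<tau>. L2_norm (\<lambda>x. w2 \<tau> x - w2 t x)) \<longlongrightarrow> 0) (at t within {0..})"
    and d2: "\<And>t. 0 < t \<Longrightarrow> has_L2_time_derivative w2 (d2 t) t"
    and \<phi>: "\<phi> \<in> borel_measurable borel"
    and pw1: "\<And>t. 0 \<le> t \<Longrightarrow> (\<lambda>x. complex_of_real (\<phi> x) * w1 t x) \<in> L2"
    and pw2: "\<And>t. 0 \<le> t \<Longrightarrow> (\<lambda>x. complex_of_real (\<phi> x) * w2 t x) \<in> L2"
    and pd1: "\<And>t. 0 < t \<Longrightarrow> t < T \<Longrightarrow> (\<lambda>x. complex_of_real (\<phi> x) * d1 t x) \<in> L2"
    and pd2: "\<And>t. 0 < t \<Longrightarrow> t < T \<Longrightarrow> (\<lambda>x. complex_of_real (\<phi> x) * d2 t x) \<in> L2"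
    and le1: "\<And>t. 0 < t \<Longrightarrow> t < T \<Longrightarrow> L2_norm (\<lambda>x. complex_of_real (\<phi> x) * d1 t x) \<le> \<kappa>\<^sup>2 / (1 + t) * (2 * (A t + B t))"
    and le2: "\<And>t. 0 < t \<Longrightarrow> t < T \<Longrightarrow> L2_norm (\<lambda>x. complex_of_real (\<phi> x) * d2 t x) \<le> \<kappa>\<^sup>2 / (1 + t) * (2 * (A t + B t))"
    and bdd: "\<And>t. 0 \<le> t \<Longrightarrow> t \<le> T \<Longrightarrow> A t + B t \<le> M"
    and p: "0 < p" "8 * \<kappa>\<^sup>2 \<le> p" and t: "0 \<le> t" "t \<le> T"
  shows "A t + B t \<le> 2 * (A 0 + B 0) * (1 + t) powr p"
proof (rule growth_closure[of T "\<lambda>t. A t + B t" M p t])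
  show "0 \<le> A 0 + B 0" by (simp add: A_def B_def)
next
  fix D t :: real
  assume t: "0 < t" "t \<le> T" and D: "0 \<le> D" and le: "\<And>\<tau>. 0 < \<tau> \<Longrightarrow> \<tau> < t \<Longrightarrow> A \<tau> + B \<tau> \<le> D * (1 + \<tau>) powr p"
  \<comment> \<open>A primitive of the derivative bound that results from inserting the assumed
    growth D(1 + \<tau>)^p.\<close>
  let ?G = "\<lambda>\<tau>. (2 * \<kappa>\<^sup>2 * D / p) * (1 + \<tau>) powr p"
  let ?G' = "\<lambda>\<tau>. (2 * \<kappa>\<^sup>2 * D) * (1 + \<tau>) powr (p - 1)"
  have G1: "continuous_on {0..t} ?G" by (intro continuous_intros) auto
  have G2: "(?G has_vector_derivative ?G' \<tau>) (at \<tau>)" if "0 < \<tau>" "\<tau> < t" for \<tau>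
    unfolding has_real_derivative_iff_has_vector_derivative[symmetric]
    using that p by (auto intro!: derivative_eq_intros)
  have est: "\<kappa>\<^sup>2 / (1 + \<tau>) * (2 * (A \<tau> + B \<tau>)) \<le> ?G' \<tau>" if "0 < \<tau>" "\<tau> < t" for \<tau>
  proof -
    have "\<kappa>\<^sup>2 / (1 + \<tau>) * (2 * (A \<tau> + B \<tau>)) \<le> \<kappa>\<^sup>2 / (1 + \<tau>) * (2 * (D * (1 + \<tau>) powr p))"
      using le[OF that] that by (intro mult_left_mono) auto
    also have "\<dots> = ?G' \<tau>" using that by (simp add: powr_diff)
    finally show ?thesis .
  qed
  have GG: "?G t - ?G 0 \<le> D / 4 * ((1 + t) powr p - 1)"
  proof -
    have "1 \<le> (1 + t) powr p" using t p by (simp add: ge_one_powr_ge_zero)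
    moreover have "2 * \<kappa>\<^sup>2 * D / p \<le> D / 4"
    proof -
      have "8 * \<kappa>\<^sup>2 * D \<le> p * D" using p D by (intro mult_right_mono) auto
      then show ?thesis using p by (simp add: field_simps)
    qed
    ultimately have "(2 * \<kappa>\<^sup>2 * D / p) * ((1 + t) powr p - 1) \<le> D / 4 * ((1 + t) powr p - 1)"
      by (intro mult_right_mono) auto
    then show ?thesis by (simp add: right_diff_distrib)
  qed
  let ?Q = "D / 4 * ((1 + t) powr p - 1)"
  have "A t \<le> A 0 + (?G t - ?G 0)"
    unfolding A_def
  proof (rule weighted_mean_value[where d = d1 and G' = ?G', OF w1 c1 _ \<phi>])
    fix \<tau> assume \<tau>: "0 < \<tau>" "\<tau> < t"
    then have \<tau>T: "\<tau> < T" using t by simp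
    show "has_L2_time_derivative w1 (d1 \<tau>) \<tau>" by (rule d1[OF \<tau>(1)])
    show "(\<lambda>x. complex_of_real (\<phi> x) * d1 \<tau> x) \<in> L2" by (rule pd1[OF \<tau>(1) \<tau>T])
    show "L2_norm (\<lambda>x. complex_of_real (\<phi> x) * d1 \<tau> x) \<le> ?G' \<tau>"
      by (rule order_trans[OF le1[OF \<tau>(1) \<tau>T] est[OF \<tau>]])
    show "(?G has_vector_derivative ?G' \<tau>) (at \<tau>)" by (rule G2[OF \<tau>])
  qed (use t G1 pw1 in auto)
  then have At: "A t \<le> A 0 + ?Q" by (rule order_trans[OF _ add_left_mono[OF GG]])
  have "B t \<le> B 0 + (?G t - ?G 0)"
    unfolding B_def
  proof (rule weighted_mean_value[where d = d2 and G' = ?G', OF w2 c2 _ \<phi>])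
    fix \<tau> assume \<tau>: "0 < \<tau>" "\<tau> < t"
    then have \<tau>T: "\<tau> < T" using t by simp
    show "has_L2_time_derivative w2 (d2 \<tau>) \<tau>" by (rule d2[OF \<tau>(1)])
    show "(\<lambda>x. complex_of_real (\<phi> x) * d2 \<tau> x) \<in> L2" by (rule pd2[OF \<tau>(1) \<tau>T])
    show "L2_norm (\<lambda>x. complex_of_real (\<phi> x) * d2 \<tau> x) \<le> ?G' \<tau>"
      by (rule order_trans[OF le2[OF \<tau>(1) \<tau>T] est[OF \<tau>]])
    show "(?G has_vector_derivative ?G' \<tau>) (at \<tau>)" by (rule G2[OF \<tau>])
  qed (use t G1 pw2 in auto)
  then have Bt: "B t \<le> B 0 + ?Q" by (rule order_trans[OF _ add_left_mono[OF GG]])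
  have "A t + B t \<le> (A 0 + ?Q) + (B 0 + ?Q)" by (rule add_mono[OF At Bt])
  also have "\<dots> = A 0 + B 0 + D / 2 * ((1 + t) powr p - 1)" by (simp add: field_simps)
  finally show "A t + B t \<le> A 0 + B 0 + D / 2 * ((1 + t) powr p - 1)" .
qed (use bdd p t in auto)

lemma sobolev_norm_bounded:
  assumes u: "continuous_in_sobolev s \<sigma> u"
  obtains M where "\<And>t. 0 \<le> t \<Longrightarrow> t \<le> T \<Longrightarrow> sobolev_norm s \<sigma> (u t) \<le> M"
proof -
  have "continuous_on {0..} (\<lambda>t. sobolev_norm s \<sigma> (u t))"
    unfolding continuous_on_def
  proof
    fix t :: real assume t: "t \<in> {0..}"
    have lim: "((\<lambda>\<tau>. sobolev_norm s \<sigma> (\<lambda>x. u \<tau> x - u t x)) \<longlongrightarrow> 0) (at t within {0..})"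
      using u t by (auto simp: continuous_in_sobolev_def)
    have "\<forall>\<^sub>F \<tau> in at t within {0..}. norm (sobolev_norm s \<sigma> (u \<tau>) - sobolev_norm s \<sigma> (u t)) \<le> sobolev_norm s \<sigma> (\<lambda>x. u \<tau> x - u t x)"
      using u t by (auto simp: eventually_at_filter continuous_in_sobolev_def intro!: always_eventually sobolev_norm_diff)
    from Lim_null_comparison[OF this lim]
    show "((\<lambda>\<tau>. sobolev_norm s \<sigma> (u \<tau>)) \<longlongrightarrow> sobolev_norm s \<sigma> (u t)) (at t within {0..})"
      by (simp add: LIM_zero_iff)
  qed
  then have "continuous_on {0..T} (\<lambda>t. sobolev_norm s \<sigma> (u t))" by (rule continuous_on_subset) auto
  then have "compact ((\<lambda>t. sobolev_norm s \<sigma> (u t)) ` {0..T})" by (rule compact_continuous_image) simp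
  then have "bounded ((\<lambda>t. sobolev_norm s \<sigma> (u t)) ` {0..T})" by (rule compact_imp_bounded)
  then obtain M where "\<forall>y\<in>(\<lambda>t. sobolev_norm s \<sigma> (u t)) ` {0..T}. norm y \<le> M" by (auto simp: bounded_iff)
  then show ?thesis by (intro that[of M]) (auto simp: abs_le_iff)
qed

text \<open>The hypotheses are symmetric, so a fact about u becomes one about v by interpreting the
  locale with exchanged arguments.\<close>

locale nls_pair = a: nls_component u v + b: nls_component v u for u v
begin

lemma flip: "nls_pair v u" by unfold_locales

text \<open>The frequency weight comes from the Lipschitz bound on u and v, the x weight from the
  function g of \<open>damping_schroedinger\<close>. The transform of \<open>n t\<close> differs
  from the cubic expression in the chirped transforms only by one inverse chirp on g, which costs
  t^(-1/4).\<close>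

lemma n_bounds:
  assumes t: "0 < t" and \<beta>: "0 \<le> \<beta>" "AE x in lborel. cmod (u t x) \<le> \<beta>" "AE x in lborel. cmod (v t x) \<le> \<beta>"
  shows "L2_norm (a.n t) \<le> \<beta>\<^sup>2 * L2_norm (a.V t)"
    "xmul (fourier_L2 (a.n t)) \<in> L2"
    "L2_norm (xmul (fourier_L2 (a.n t))) \<le> \<beta>\<^sup>2 * (L2_norm (xmul (fourier_L2 (a.V t))) + 2 * L2_norm (xmul (fourier_L2 (b.V t))))"
    "xmul (a.n t) \<in> L2"
    "L2_norm (xmul (a.n t)) \<le> \<beta>\<^sup>2 * (L2_norm (xmul (a.V t)) + 2 * L2_norm (xmul (b.V t)))"
    "cmod (fourier (a.n t) \<xi> - complex_of_real (1 / t) * damping (fourier (chirp t (b.V t))) (fourier (chirp t (a.V t))) \<xi>)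
      \<le> 2 * t powr (- 1 / 4) * (\<beta>\<^sup>2 * (L2_norm (xmul (a.V t)) + 2 * L2_norm (xmul (b.V t))))"
    "cmod (fourier (chirp t (a.V t)) \<xi>) \<le> sqrt t * \<beta>"
proof -
  have t0: "0 \<le> t" using t by simp
  note ub = a.u_bounds[OF t0] and vb = a.v_bounds[OF t0] and V = a.V_L2[OF t0] and W = b.V_L2[OF t0]
  have N: "damping (v t) (u t) \<in> L2" by (rule a.damping_in_L2[OF t0])
  note Sn = schroedinger_L2[OF N, of "- t"]
  have nL: "a.n t \<in> L2" by (rule a.n_in_L2[OF t0])
  show "L2_norm (a.n t) \<le> \<beta>\<^sup>2 * L2_norm (a.V t)"
    unfolding a.n_def using Sn(2) damping_L2(2)[OF ub(1) L2_measurable[OF vb(1)] \<beta>(3)] V(3) by simp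
  have wt: "xmul (fourier_L2 (damping (v t) (u t))) \<in> L2"
    "L2_norm (xmul (fourier_L2 (damping (v t) (u t)))) \<le> \<beta>\<^sup>2 * (L2_norm (xmul (fourier_L2 (u t))) + 2 * L2_norm (xmul (fourier_L2 (v t))))"
    by (rule weighted_transform_damping[OF ub(1) vb(1) \<beta>(2,3) ub(3) vb(3)])+
  have c: "(\<lambda>\<xi>. cis (t * \<xi>\<^sup>2 / 2) * xmul (fourier_L2 (damping (v t) (u t))) \<xi>) \<in> L2"
    "L2_norm (\<lambda>\<xi>. cis (t * \<xi>\<^sup>2 / 2) * xmul (fourier_L2 (damping (v t) (u t))) \<xi>) = L2_norm (xmul (fourier_L2 (damping (v t) (u t))))"
    using cis_mult_L2[OF wt(1), of "\<lambda>\<xi>. t * \<xi>\<^sup>2 / 2"] by auto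
  have ae: "AE \<xi> in lborel. xmul (fourier_L2 (a.n t)) \<xi> = cis (t * \<xi>\<^sup>2 / 2) * xmul (fourier_L2 (damping (v t) (u t))) \<xi>"
    unfolding a.n_def using Sn(3) by eventually_elim (simp add: mult.left_commute)
  have m: "xmul (fourier_L2 (a.n t)) \<in> borel_measurable borel"
    using fourier_L2_measurable[OF nL] by measurable
  note cc = L2_cong[OF c(1) m ae]
  show "xmul (fourier_L2 (a.n t)) \<in> L2" by (rule cc)
  show "L2_norm (xmul (fourier_L2 (a.n t))) \<le> \<beta>\<^sup>2 * (L2_norm (xmul (fourier_L2 (a.V t))) + 2 * L2_norm (xmul (fourier_L2 (b.V t))))"
    using cc(2) c(2) wt(2) V(6) W(6) by simp
  obtain g where g: "AE x in lborel. a.n t x = complex_of_real (1 / t) * chirp (- t) g x"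
    "g \<in> L2" "xmul g \<in> L2"
    "L2_norm (xmul g) \<le> t * \<beta>\<^sup>2 * (L2_norm (xmul (a.V t)) + 2 * L2_norm (xmul (b.V t)))"
    "\<And>\<xi>. fourier g \<xi> = damping (fourier (chirp t (b.V t))) (fourier (chirp t (a.V t))) \<xi>"
    "\<And>\<xi>. cmod (fourier (chirp t (a.V t)) \<xi>) \<le> sqrt t * \<beta>"
  proof (rule damping_schroedinger[OF V(1,2) W(1,2) t ub(1) vb(1) V(8) W(8) \<beta>], goal_cases)
    case (1 g)
    show ?case by (rule that[of g, unfolded a.n_def]; rule 1)
  qed
  show "cmod (fourier (chirp t (a.V t)) \<xi>) \<le> sqrt t * \<beta>" by (rule g)
  note cg = chirp_L2(1)[OF g(2), of "- t"] chirp_xmul[OF g(3), of "- t"]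
  have cx: "(\<lambda>x. complex_of_real (1 / t) * xmul (chirp (- t) g) x) \<in> L2" by (intro L2_cmult cg)
  have cn: "L2_norm (\<lambda>x. complex_of_real (1 / t) * xmul (chirp (- t) g) x) = (1 / t) * L2_norm (xmul g)"
    unfolding L2_norm_cmult cg(3) using t by (simp add: norm_divide)
  have aex: "AE x in lborel. xmul (a.n t) x = complex_of_real (1 / t) * xmul (chirp (- t) g) x"
    using g(1) by eventually_elim (simp add: mult.left_commute)
  have mx: "xmul (a.n t) \<in> borel_measurable borel" using L2_measurable[OF nL] by measurable
  show "xmul (a.n t) \<in> L2" by (rule L2_cong(1)[OF cx mx aex])
  have gt: "(1 / t) * L2_norm (xmul g) \<le> \<beta>\<^sup>2 * (L2_norm (xmul (a.V t)) + 2 * L2_norm (xmul (b.V t)))"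
    using g(4) t by (simp add: field_simps)
  show "L2_norm (xmul (a.n t)) \<le> \<beta>\<^sup>2 * (L2_norm (xmul (a.V t)) + 2 * L2_norm (xmul (b.V t)))"
    using L2_cong(2)[OF cx mx aex] cn gt by simp
  have "fourier (a.n t) = fourier (\<lambda>x. complex_of_real (1 / t) * chirp (- t) g x)"
    by (rule fourier_cong_AE[OF L2_measurable[OF nL] L2_measurable[OF L2_cmult[OF cg(1)]] g(1)])
  then have "fourier (a.n t) \<xi> - complex_of_real (1 / t) * damping (fourier (chirp t (b.V t))) (fourier (chirp t (a.V t))) \<xi>
      = complex_of_real (1 / t) * (fourier (chirp (- t) g) \<xi> - fourier g \<xi>)"
    by (simp only: fourier_cmult g(5) right_diff_distrib)
  then have "cmod (fourier (a.n t) \<xi> - complex_of_real (1 / t) * damping (fourier (chirp t (b.V t))) (fourier (chirp t (a.V t))) \<xi>)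
      = (1 / t) * cmod (fourier (chirp (- t) g) \<xi> - fourier g \<xi>)"
    using t by (simp add: norm_mult norm_divide)
  also have "\<dots> \<le> (1 / t) * (2 * t powr (- 1 / 4) * L2_norm (xmul g))"
    using t fourier_chirp_difference[OF g(2,3) t, of "- t" \<xi>] by (intro mult_left_mono) auto
  also have "\<dots> = 2 * t powr (- 1 / 4) * ((1 / t) * L2_norm (xmul g))" by simp
  also have "\<dots> \<le> 2 * t powr (- 1 / 4) * (\<beta>\<^sup>2 * (L2_norm (xmul (a.V t)) + 2 * L2_norm (xmul (b.V t))))"
    by (rule mult_left_mono[OF gt]) simp
  finally show "cmod (fourier (a.n t) \<xi> - complex_of_real (1 / t) * damping (fourier (chirp t (b.V t))) (fourier (chirp t (a.V t))) \<xi>)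
      \<le> 2 * t powr (- 1 / 4) * (\<beta>\<^sup>2 * (L2_norm (xmul (a.V t)) + 2 * L2_norm (xmul (b.V t))))" .
qed

end

subsection \<open>The bootstrap argument\<close>

text \<open>A qualitative bound with uncontrolled dependence on T and on the solution. It serves
  only as the finite starting value for the iteration in \<open>growth_closure\<close>.\<close>

lemma (in nls_component) V_weighted_bounded:
  obtains M where "\<And>t. 0 \<le> t \<Longrightarrow> t \<le> T \<Longrightarrow> L2_norm (V t) \<le> M"
    "\<And>t. 0 \<le> t \<Longrightarrow> t \<le> T \<Longrightarrow> L2_norm (xmul (V t)) \<le> M"
    "\<And>t. 0 \<le> t \<Longrightarrow> t \<le> T \<Longrightarrow> L2_norm (xmul (fourier_L2 (V t))) \<le> M"
proof -
  obtain M where M: "\<And>t. 0 \<le> t \<Longrightarrow> t \<le> T \<Longrightarrow> sobolev_norm 1 1 (u t) \<le> M"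
    using sobolev_norm_bounded[OF u11] by blast
  have s0: "0 \<le> sobolev_norm 1 1 (u t)" for t by (simp add: sobolev_norm_def)
  have main: "L2_norm (V t) \<le> (2 + \<bar>T\<bar>) * M \<and> L2_norm (xmul (V t)) \<le> (2 + \<bar>T\<bar>) * M
      \<and> L2_norm (xmul (fourier_L2 (V t))) \<le> (2 + \<bar>T\<bar>) * M" if t: "0 \<le> t" "t \<le> T" for t
  proof -
    let ?S = "sobolev_norm 1 1 (u t)"
    have "u t \<in> sobolev 1 1" using u11 t by (auto simp: continuous_in_sobolev_def)
    note sb = sobolev_1_1_bounds(4-6)[OF this]
    have TM: "1 * ?S \<le> (2 + \<bar>T\<bar>) * M" using M[OF t] s0[of t] t by (intro mult_mono) auto
    have "L2_norm (xmul (V t)) \<le> 2 * ?S + t * ?S"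
      using V_L2(7)[OF t(1)] sb mult_left_mono[OF sb(3) t(1)] by linarith
    also have "\<dots> = (2 + t) * ?S" by (simp add: algebra_simps)
    also have "\<dots> \<le> (2 + \<bar>T\<bar>) * M" using M[OF t] s0[of t] t by (intro mult_mono) auto
    finally show ?thesis using TM sb V_L2(3,6)[OF t(1)] by auto
  qed
  show ?thesis by (rule that[of "(2 + \<bar>T\<bar>) * M"]) (use main in auto)
qed

context nls_pair
begin

text \<open>Three instances of one scheme: weight 1 and weight x on \<open>V\<close>, and weight
  \<xi> on its transform. The squared decay bound is exactly the critical rate \<kappa>^2/(1 +
  t).\<close>

lemma weighted_norms_growth:
  assumes dec: "\<And>t. 0 < t \<Longrightarrow> t < T \<Longrightarrow> AE x in lborel. cmod (u t x) \<le> \<kappa> / sqrt (1 + t)"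
    "\<And>t. 0 < t \<Longrightarrow> t < T \<Longrightarrow> AE x in lborel. cmod (v t x) \<le> \<kappa> / sqrt (1 + t)"
    and p: "0 < p" "8 * \<kappa>\<^sup>2 \<le> p" and \<kappa>: "0 \<le> \<kappa>" and t: "0 \<le> t" "t \<le> T"
  shows "L2_norm (a.V t) + L2_norm (b.V t) \<le> 2 * (L2_norm (a.V 0) + L2_norm (b.V 0)) * (1 + t) powr p"
    "L2_norm (xmul (a.V t)) + L2_norm (xmul (b.V t)) \<le> 2 * (L2_norm (xmul (a.V 0)) + L2_norm (xmul (b.V 0))) * (1 + t) powr p"
    "L2_norm (xmul (fourier_L2 (a.V t))) + L2_norm (xmul (fourier_L2 (b.V t)))
      \<le> 2 * (L2_norm (xmul (fourier_L2 (a.V 0))) + L2_norm (xmul (fourier_L2 (b.V 0)))) * (1 + t) powr p"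
proof -
  interpret f: nls_pair v u by (rule flip)
  obtain Ma where Ma: "\<And>t. 0 \<le> t \<Longrightarrow> t \<le> T \<Longrightarrow> L2_norm (a.V t) \<le> Ma"
    "\<And>t. 0 \<le> t \<Longrightarrow> t \<le> T \<Longrightarrow> L2_norm (xmul (a.V t)) \<le> Ma"
    "\<And>t. 0 \<le> t \<Longrightarrow> t \<le> T \<Longrightarrow> L2_norm (xmul (fourier_L2 (a.V t))) \<le> Ma"
    using a.V_weighted_bounded[of T] by blast
  obtain Mb where Mb: "\<And>t. 0 \<le> t \<Longrightarrow> t \<le> T \<Longrightarrow> L2_norm (b.V t) \<le> Mb"
    "\<And>t. 0 \<le> t \<Longrightarrow> t \<le> T \<Longrightarrow> L2_norm (xmul (b.V t)) \<le> Mb"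
    "\<And>t. 0 \<le> t \<Longrightarrow> t \<le> T \<Longrightarrow> L2_norm (xmul (fourier_L2 (b.V t))) \<le> Mb"
    using b.V_weighted_bounded[of T] by blast
  have sq: "(\<kappa> / sqrt (1 + t))\<^sup>2 = \<kappa>\<^sup>2 / (1 + t)" if "0 < t" for t
    using that by (simp add: power_divide)
  have k0: "0 \<le> \<kappa> / sqrt (1 + t)" if "0 < t" for t using that \<kappa> by simp
  \<comment> \<open>One component enters with factor 1, its partner with factor 2; both are relaxed
    to the symmetric 2(A + B), so the two equations obey the same bound.\<close>
  have e1: "K \<le> \<kappa>\<^sup>2 / (1 + t) * (2 * (A + B))" if "0 < t" "0 \<le> A" "0 \<le> B" "K \<le> \<kappa>\<^sup>2 / (1 + t) * (A + 2 * B)" for A B K t :: real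
    by (rule order_trans[OF that(4) mult_left_mono]) (use that in auto)
  have e0: "K \<le> \<kappa>\<^sup>2 / (1 + t) * (2 * (A + B))" if "0 < t" "0 \<le> A" "0 \<le> B" "K \<le> \<kappa>\<^sup>2 / (1 + t) * A" for A B K t :: real
    by (rule order_trans[OF that(4) mult_left_mono]) (use that in auto)
  have e1r: "K \<le> \<kappa>\<^sup>2 / (1 + t) * (2 * (A + B))" if "0 < t" "0 \<le> A" "0 \<le> B" "K \<le> \<kappa>\<^sup>2 / (1 + t) * (B + 2 * A)" for A B K t :: real
    by (rule order_trans[OF that(4) mult_left_mono]) (use that in auto)
  have e0r: "K \<le> \<kappa>\<^sup>2 / (1 + t) * (2 * (A + B))" if "0 < t" "0 \<le> A" "0 \<le> B" "K \<le> \<kappa>\<^sup>2 / (1 + t) * B" for A B K t :: real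
    by (rule order_trans[OF that(4) mult_left_mono]) (use that in auto)
  have nb: "L2_norm (a.n t) \<le> \<kappa>\<^sup>2 / (1 + t) * (2 * (L2_norm (a.V t) + L2_norm (b.V t)))"
    "xmul (fourier_L2 (a.n t)) \<in> L2"
    "L2_norm (xmul (fourier_L2 (a.n t))) \<le> \<kappa>\<^sup>2 / (1 + t) * (2 * (L2_norm (xmul (fourier_L2 (a.V t))) + L2_norm (xmul (fourier_L2 (b.V t)))))"
    "xmul (a.n t) \<in> L2"
    "L2_norm (xmul (a.n t)) \<le> \<kappa>\<^sup>2 / (1 + t) * (2 * (L2_norm (xmul (a.V t)) + L2_norm (xmul (b.V t))))"
    if "0 < t" "t < T" for t
  proof -
    note nn = n_bounds[OF that(1) k0[OF that(1)] dec(1)[OF that] dec(2)[OF that], unfolded sq[OF that(1)]]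
    note pos = that(1) L2_norm_nonneg L2_norm_nonneg
    show "L2_norm (a.n t) \<le> \<kappa>\<^sup>2 / (1 + t) * (2 * (L2_norm (a.V t) + L2_norm (b.V t)))"
      by (rule e0[OF pos nn(1)])
    show "xmul (fourier_L2 (a.n t)) \<in> L2" "xmul (a.n t) \<in> L2" by (rule nn)+
    show "L2_norm (xmul (fourier_L2 (a.n t))) \<le> \<kappa>\<^sup>2 / (1 + t) * (2 * (L2_norm (xmul (fourier_L2 (a.V t))) + L2_norm (xmul (fourier_L2 (b.V t)))))"
      by (rule e1[OF pos nn(3)])
    show "L2_norm (xmul (a.n t)) \<le> \<kappa>\<^sup>2 / (1 + t) * (2 * (L2_norm (xmul (a.V t)) + L2_norm (xmul (b.V t))))"
      by (rule e1[OF pos nn(5)])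
  qed
  have nb': "L2_norm (b.n t) \<le> \<kappa>\<^sup>2 / (1 + t) * (2 * (L2_norm (a.V t) + L2_norm (b.V t)))"
    "xmul (fourier_L2 (b.n t)) \<in> L2"
    "L2_norm (xmul (fourier_L2 (b.n t))) \<le> \<kappa>\<^sup>2 / (1 + t) * (2 * (L2_norm (xmul (fourier_L2 (a.V t))) + L2_norm (xmul (fourier_L2 (b.V t)))))"
    "xmul (b.n t) \<in> L2"
    "L2_norm (xmul (b.n t)) \<le> \<kappa>\<^sup>2 / (1 + t) * (2 * (L2_norm (xmul (a.V t)) + L2_norm (xmul (b.V t))))"
    if "0 < t" "t < T" for t
  proof -
    note nn = f.n_bounds[OF that(1) k0[OF that(1)] dec(2)[OF that] dec(1)[OF that], unfolded sq[OF that(1)]]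
    note pos = that(1) L2_norm_nonneg L2_norm_nonneg
    show "L2_norm (b.n t) \<le> \<kappa>\<^sup>2 / (1 + t) * (2 * (L2_norm (a.V t) + L2_norm (b.V t)))"
      by (rule e0r[OF pos nn(1)])
    show "xmul (fourier_L2 (b.n t)) \<in> L2" "xmul (b.n t) \<in> L2" by (rule nn)+
    show "L2_norm (xmul (fourier_L2 (b.n t))) \<le> \<kappa>\<^sup>2 / (1 + t) * (2 * (L2_norm (xmul (fourier_L2 (a.V t))) + L2_norm (xmul (fourier_L2 (b.V t)))))"
      by (rule e1r[OF pos nn(3)])
    show "L2_norm (xmul (b.n t)) \<le> \<kappa>\<^sup>2 / (1 + t) * (2 * (L2_norm (xmul (a.V t)) + L2_norm (xmul (b.V t))))"
      by (rule e1r[OF pos nn(5)])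
  qed
  have "L2_norm (\<lambda>x. complex_of_real 1 * a.V t x) + L2_norm (\<lambda>x. complex_of_real 1 * b.V t x) \<le> 2 * (L2_norm (\<lambda>x. complex_of_real 1 * a.V 0 x) + L2_norm (\<lambda>x. complex_of_real 1 * b.V 0 x)) * (1 + t) powr p"
  proof (rule weighted_pair_growth[where \<phi> = "\<lambda>_. 1" and ?w1.0 = "a.V" and ?w2.0 = "b.V"
        and ?d1.0 = "\<lambda>t x. - a.n t x" and ?d2.0 = "\<lambda>t x. - b.n t x" and \<kappa> = \<kappa> and M = "Ma + Mb",
        OF a.V_L2(1) a.V_continuous(1) a.V_derivative(1) b.V_L2(1) b.V_continuous(1) b.V_derivative(1) _ _ _ _ _ _ _ _ p t])
    show "(\<lambda>x. complex_of_real 1 * a.V t x) \<in> L2" if "0 \<le> t" for t using a.V_L2(1)[OF that] by simp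
    show "(\<lambda>x. complex_of_real 1 * b.V t x) \<in> L2" if "0 \<le> t" for t using b.V_L2(1)[OF that] by simp
    show "(\<lambda>x. complex_of_real 1 * - a.n t x) \<in> L2" if "0 < t" "t < T" for t
      using a.n_in_L2[of t] that by simp
    show "L2_norm (\<lambda>x. complex_of_real 1 * - a.n t x) \<le> \<kappa>\<^sup>2 / (1 + t) * (2 * (L2_norm (\<lambda>x. complex_of_real 1 * a.V t x) + L2_norm (\<lambda>x. complex_of_real 1 * b.V t x)))" if "0 < t" "t < T" for t
      using nb(1)[OF that] by simp
    show "(\<lambda>x. complex_of_real 1 * - b.n t x) \<in> L2" if "0 < t" "t < T" for t
      using b.n_in_L2[of t] that by simp
    show "L2_norm (\<lambda>x. complex_of_real 1 * - b.n t x) \<le> \<kappa>\<^sup>2 / (1 + t) * (2 * (L2_norm (\<lambda>x. complex_of_real 1 * a.V t x) + L2_norm (\<lambda>x. complex_of_real 1 * b.V t x)))" if "0 < t" "t < T" for t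
      using nb'(1)[OF that] by simp
    show "L2_norm (\<lambda>x. complex_of_real 1 * a.V t x) + L2_norm (\<lambda>x. complex_of_real 1 * b.V t x) \<le> Ma + Mb" if "0 \<le> t" "t \<le> T" for t
      using Ma(1)[OF that] Mb(1)[OF that] by simp
  qed auto
  then show "L2_norm (a.V t) + L2_norm (b.V t) \<le> 2 * (L2_norm (a.V 0) + L2_norm (b.V 0)) * (1 + t) powr p"
    by simp
  have "L2_norm (\<lambda>x. complex_of_real x * a.V t x) + L2_norm (\<lambda>x. complex_of_real x * b.V t x) \<le> 2 * (L2_norm (\<lambda>x. complex_of_real x * a.V 0 x) + L2_norm (\<lambda>x. complex_of_real x * b.V 0 x)) * (1 + t) powr p"
  proof (rule weighted_pair_growth[where \<phi> = "\<lambda>x. x" and ?w1.0 = "a.V" and ?w2.0 = "b.V"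
        and ?d1.0 = "\<lambda>t x. - a.n t x" and ?d2.0 = "\<lambda>t x. - b.n t x" and \<kappa> = \<kappa> and M = "Ma + Mb",
        OF a.V_L2(1) a.V_continuous(1) a.V_derivative(1) b.V_L2(1) b.V_continuous(1) b.V_derivative(1) _ _ _ _ _ _ _ _ p t])
    show "(\<lambda>x. complex_of_real x * a.V t x) \<in> L2" if "0 \<le> t" for t using a.V_L2(2)[OF that] by simp
    show "(\<lambda>x. complex_of_real x * b.V t x) \<in> L2" if "0 \<le> t" for t using b.V_L2(2)[OF that] by simp
    show "(\<lambda>x. complex_of_real x * - a.n t x) \<in> L2" if "0 < t" "t < T" for t
      using L2_uminus[OF nb(4)[OF that]] by simp
    show "L2_norm (\<lambda>x. complex_of_real x * - a.n t x) \<le> \<kappa>\<^sup>2 / (1 + t) * (2 * (L2_norm (\<lambda>x. complex_of_real x * a.V t x) + L2_norm (\<lambda>x. complex_of_real x * b.V t x)))" if "0 < t" "t < T" for t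
      using nb(5)[OF that] by simp
    show "(\<lambda>x. complex_of_real x * - b.n t x) \<in> L2" if "0 < t" "t < T" for t
      using L2_uminus[OF nb'(4)[OF that]] by simp
    show "L2_norm (\<lambda>x. complex_of_real x * - b.n t x) \<le> \<kappa>\<^sup>2 / (1 + t) * (2 * (L2_norm (\<lambda>x. complex_of_real x * a.V t x) + L2_norm (\<lambda>x. complex_of_real x * b.V t x)))" if "0 < t" "t < T" for t
      using nb'(5)[OF that] by simp
    show "L2_norm (\<lambda>x. complex_of_real x * a.V t x) + L2_norm (\<lambda>x. complex_of_real x * b.V t x) \<le> Ma + Mb" if "0 \<le> t" "t \<le> T" for t
      using Ma(2)[OF that] Mb(2)[OF that] by simp
  qed auto
  then show "L2_norm (xmul (a.V t)) + L2_norm (xmul (b.V t)) \<le> 2 * (L2_norm (xmul (a.V 0)) + L2_norm (xmul (b.V 0))) * (1 + t) powr p"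
    by simp
  have "L2_norm (\<lambda>x. complex_of_real x * fourier_L2 (a.V t) x) + L2_norm (\<lambda>x. complex_of_real x * fourier_L2 (b.V t) x) \<le> 2 * (L2_norm (\<lambda>x. complex_of_real x * fourier_L2 (a.V 0) x) + L2_norm (\<lambda>x. complex_of_real x * fourier_L2 (b.V 0) x)) * (1 + t) powr p"
  proof (rule weighted_pair_growth[where \<phi> = "\<lambda>x. x" and ?w1.0 = "\<lambda>t. fourier_L2 (a.V t)" and ?w2.0 = "\<lambda>t. fourier_L2 (b.V t)"
        and ?d1.0 = "\<lambda>t x. - fourier_L2 (a.n t) x" and ?d2.0 = "\<lambda>t x. - fourier_L2 (b.n t) x" and \<kappa> = \<kappa> and M = "Ma + Mb",
        OF fourier_L2_in_L2[OF a.V_L2(1)] a.V_continuous(2) a.V_derivative(2) fourier_L2_in_L2[OF b.V_L2(1)] b.V_continuous(2) b.V_derivative(2) _ _ _ _ _ _ _ _ p t])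
    show "(\<lambda>x. complex_of_real x * fourier_L2 (a.V t) x) \<in> L2" if "0 \<le> t" for t using a.V_L2(5)[OF that] by simp
    show "(\<lambda>x. complex_of_real x * fourier_L2 (b.V t) x) \<in> L2" if "0 \<le> t" for t using b.V_L2(5)[OF that] by simp
    show "(\<lambda>x. complex_of_real x * - fourier_L2 (a.n t) x) \<in> L2" if "0 < t" "t < T" for t
      using L2_uminus[OF nb(2)[OF that]] by simp
    show "L2_norm (\<lambda>x. complex_of_real x * - fourier_L2 (a.n t) x) \<le> \<kappa>\<^sup>2 / (1 + t) * (2 * (L2_norm (\<lambda>x. complex_of_real x * fourier_L2 (a.V t) x) + L2_norm (\<lambda>x. complex_of_real x * fourier_L2 (b.V t) x)))" if "0 < t" "t < T" for t
      using nb(3)[OF that] by simp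
    show "(\<lambda>x. complex_of_real x * - fourier_L2 (b.n t) x) \<in> L2" if "0 < t" "t < T" for t
      using L2_uminus[OF nb'(2)[OF that]] by simp
    show "L2_norm (\<lambda>x. complex_of_real x * - fourier_L2 (b.n t) x) \<le> \<kappa>\<^sup>2 / (1 + t) * (2 * (L2_norm (\<lambda>x. complex_of_real x * fourier_L2 (a.V t) x) + L2_norm (\<lambda>x. complex_of_real x * fourier_L2 (b.V t) x)))" if "0 < t" "t < T" for t
      using nb'(3)[OF that] by simp
    show "L2_norm (\<lambda>x. complex_of_real x * fourier_L2 (a.V t) x) + L2_norm (\<lambda>x. complex_of_real x * fourier_L2 (b.V t) x) \<le> Ma + Mb" if "0 \<le> t" "t \<le> T" for t
      using Ma(3)[OF that] Mb(3)[OF that] by simp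
  qed auto
  then show "L2_norm (xmul (fourier_L2 (a.V t))) + L2_norm (xmul (fourier_L2 (b.V t))) \<le> 2 * (L2_norm (xmul (fourier_L2 (a.V 0))) + L2_norm (xmul (fourier_L2 (b.V 0)))) * (1 + t) powr p"
    by simp
qed

end

section \<open>Small data: quantitative bounds and the continuation argument\<close>

lemma has_real_derivative_cmod_sq:
  fixes f :: "real \<Rightarrow> complex"
  assumes "(f has_vector_derivative d) (at t)"
  shows "((\<lambda>\<tau>. (cmod (f \<tau>))\<^sup>2) has_real_derivative 2 * Re (cnj (f t) * d)) (at t)"
proof -
  have r: "((\<lambda>\<tau>. Re (f \<tau>)) has_real_derivative Re d) (at t)" "((\<lambda>\<tau>. Im (f \<tau>)) has_real_derivative Im d) (at t)"
    unfolding has_real_derivative_iff_has_vector_derivative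
    using bounded_linear.has_vector_derivative[OF bounded_linear_Re assms]
      bounded_linear.has_vector_derivative[OF bounded_linear_Im assms] by auto
  show ?thesis
    unfolding cmod_power2
    by (rule DERIV_cong[OF DERIV_add[OF DERIV_power[OF r(1)] DERIV_power[OF r(2)]]]) simp
qed

lemma powr_early: "0 \<le> t \<Longrightarrow> t \<le> 2 \<Longrightarrow> (1 + t) powr (1 / 24) \<le> 2" for t :: real
proof -
  assume t: "0 \<le> t" "t \<le> 2"
  have "(1 + t) powr (1 / 24) \<le> (1 + t) powr (1 / 2)" using t by (intro powr_mono) auto
  also have "\<dots> = sqrt (1 + t)" using t by (simp add: powr_half_sqrt)
  also have "\<dots> \<le> 2" using t by (intro real_le_lsqrt) auto
  finally show ?thesis .
qed

lemma powr_late: "1 \<le> t \<Longrightarrow> (1 + t) powr (1 / 24) \<le> 2 * t powr (1 / 24)" for t :: real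
proof -
  assume t: "1 \<le> t"
  have "(1 + t) powr (1 / 24) \<le> (2 * t) powr (1 / 24)" using t by (intro powr_mono2) auto
  also have "\<dots> = 2 powr (1 / 24) * t powr (1 / 24)" using t by (simp add: powr_mult)
  also have "\<dots> \<le> 2 powr 1 * t powr (1 / 24)" by (intro mult_right_mono powr_mono) auto
  finally show ?thesis by simp
qed

text \<open>The threshold serves two numerical conditions: 8(100 \<delta>)^2 \<le> 1/24 for the
  growth exponent, and 4608000000 \<delta>^2 \<le> 33 for absorbing the remainder into the bound 17
  \<delta>.\<close>

locale nls_small = nls_pair u v for u v +
  fixes \<delta> :: real
  assumes \<delta>: "0 < \<delta>" "\<delta> \<le> 1 / 100000"
    and data_u: "L2_norm (u 0) \<le> \<delta>" "L2_norm (xmul (u 0)) \<le> \<delta>" "L2_norm (xmul (fourier_L2 (u 0))) \<le> \<delta>"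
    and data_v: "L2_norm (v 0) \<le> \<delta>" "L2_norm (xmul (v 0)) \<le> \<delta>" "L2_norm (xmul (fourier_L2 (v 0))) \<le> \<delta>"
begin

lemma small_flip: "nls_small v u \<delta>"
  using flip \<delta> data_u data_v by (auto simp: nls_small_def nls_small_axioms_def)

text \<open>The bootstrap hypothesis; 100 is twice the constant 50 recovered in
  \<open>decay_improved\<close>.\<close>

definition decay :: "real \<Rightarrow> bool" where
  "decay t \<longleftrightarrow> (AE x in lborel. cmod (u t x) \<le> 100 * \<delta> / sqrt (1 + t)) \<and>
    (AE x in lborel. cmod (v t x) \<le> 100 * \<delta> / sqrt (1 + t))"

abbreviation good :: "real \<Rightarrow> bool" where
  "good T \<equiv> \<forall>t. 0 < t \<longrightarrow> t < T \<longrightarrow> decay t"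

lemma norms_bound:
  assumes good: "good T" and t: "0 \<le> t" "t \<le> T"
  shows "L2_norm (a.V t) \<le> 4 * \<delta> * (1 + t) powr (1 / 24)" "L2_norm (b.V t) \<le> 4 * \<delta> * (1 + t) powr (1 / 24)"
    "L2_norm (xmul (a.V t)) \<le> 4 * \<delta> * (1 + t) powr (1 / 24)" "L2_norm (xmul (b.V t)) \<le> 4 * \<delta> * (1 + t) powr (1 / 24)"
    "L2_norm (xmul (fourier_L2 (a.V t))) \<le> 4 * \<delta> * (1 + t) powr (1 / 24)"
    "L2_norm (xmul (fourier_L2 (b.V t))) \<le> 4 * \<delta> * (1 + t) powr (1 / 24)"
proof -
  have dd: "\<delta> * \<delta> \<le> (1 / 100000) * (1 / 100000)" using \<delta> by (intro mult_mono) auto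
  \<comment> \<open>Here \<kappa> = 100 \<delta>. The value 1/24 lies well below 1/4, the limit for
    integrability of the remainder.\<close>
  have p: "(0::real) < 1 / 24" "8 * (100 * \<delta>)\<^sup>2 \<le> 1 / 24"
    using dd by (auto simp: power2_eq_square)
  have dec: "AE x in lborel. cmod (u t x) \<le> 100 * \<delta> / sqrt (1 + t)" "AE x in lborel. cmod (v t x) \<le> 100 * \<delta> / sqrt (1 + t)"
    if "0 < t" "t < T" for t using good that by (auto simp: decay_def)
  have k: "0 \<le> 100 * \<delta>" using \<delta> by simp
  note g = weighted_norms_growth[OF dec p k t]
  have step: "A \<le> 4 * \<delta> * P \<and> B \<le> 4 * \<delta> * P" if "A + B \<le> 2 * (A0 + B0) * P" "A0 \<le> \<delta>" "B0 \<le> \<delta>" "0 \<le> A" "0 \<le> B" "0 \<le> P"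
    for A B A0 B0 P :: real
  proof -
    have "2 * (A0 + B0) * P \<le> 4 * \<delta> * P" using that by (intro mult_right_mono) auto
    then show ?thesis using that by linarith
  qed
  have a0: "L2_norm (a.V 0) \<le> \<delta>" "L2_norm (xmul (a.V 0)) \<le> \<delta>" "L2_norm (xmul (fourier_L2 (a.V 0))) \<le> \<delta>"
    using a.V_L2(3,6,7)[of 0] data_u by auto
  have b0: "L2_norm (b.V 0) \<le> \<delta>" "L2_norm (xmul (b.V 0)) \<le> \<delta>" "L2_norm (xmul (fourier_L2 (b.V 0))) \<le> \<delta>"
    using b.V_L2(3,6,7)[of 0] data_v by auto
  show "L2_norm (a.V t) \<le> 4 * \<delta> * (1 + t) powr (1 / 24)" "L2_norm (b.V t) \<le> 4 * \<delta> * (1 + t) powr (1 / 24)"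
    using step[OF g(1) a0(1) b0(1)] by auto
  show "L2_norm (xmul (a.V t)) \<le> 4 * \<delta> * (1 + t) powr (1 / 24)" "L2_norm (xmul (b.V t)) \<le> 4 * \<delta> * (1 + t) powr (1 / 24)"
    using step[OF g(2) a0(2) b0(2)] by auto
  show "L2_norm (xmul (fourier_L2 (a.V t))) \<le> 4 * \<delta> * (1 + t) powr (1 / 24)"
    "L2_norm (xmul (fourier_L2 (b.V t))) \<le> 4 * \<delta> * (1 + t) powr (1 / 24)"
    using step[OF g(3) a0(3) b0(3)] by auto
qed

text \<open>For bounded times no dispersion is used: two norms of size 4 \<delta>, each with growth
  factor at most 2.\<close>

lemma alpha_early:
  assumes good: "good T" and t: "0 \<le> t" "t \<le> T" "t \<le> 2"
  shows "cmod (fourier (a.V t) \<xi>) \<le> 16 * \<delta>"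
proof -
  have "cmod (fourier (a.V t) \<xi>) \<le> L2_norm (a.V t) + L2_norm (xmul (a.V t))"
    by (intro fourier_norm_le_weighted a.V_L2 t)
  also have "\<dots> \<le> 8 * \<delta> * (1 + t) powr (1 / 24)" using norms_bound(1,3)[OF good t(1,2)] by simp
  also have "\<dots> \<le> 8 * \<delta> * 2" using powr_early[OF t(1,3)] \<delta> by (intro mult_left_mono) auto
  finally show ?thesis by simp
qed

lemma n_bound:
  assumes good: "good T" and t: "0 < t" "t < T"
  shows "xmul (a.n t) \<in> L2" "L2_norm (xmul (a.n t)) \<le> 12 * (100 * \<delta>)\<^sup>2 * \<delta>"
    "cmod (fourier (a.n t) \<xi>) \<le> 16 * (100 * \<delta>)\<^sup>2 * \<delta>"
proof -
  have dec: "AE x in lborel. cmod (u t x) \<le> 100 * \<delta> / sqrt (1 + t)" "AE x in lborel. cmod (v t x) \<le> 100 * \<delta> / sqrt (1 + t)"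
    using good t by (auto simp: decay_def)
  have b0: "0 \<le> 100 * \<delta> / sqrt (1 + t)" using \<delta> t by simp
  have sq: "(100 * \<delta> / sqrt (1 + t))\<^sup>2 = (100 * \<delta>)\<^sup>2 / (1 + t)" using t by (simp add: power_divide)
  note nb = n_bounds[OF t(1) b0 dec, unfolded sq]
  have t': "0 \<le> t" "t \<le> T" using t by auto
  note N = norms_bound[OF good t']
  \<comment> \<open>The factor 1/(1 + t) from the squared decay is spent entirely on the growth
    factor; only a bound uniform in time is wanted here.\<close>
  have P: "(1 + t) powr (1 / 24) \<le> 1 + t"
    using powr_mono[of "1 / 24" 1 "1 + t"] t by simp
  have scale: "(100 * \<delta>)\<^sup>2 / (1 + t) * (c * \<delta> * (1 + t) powr (1 / 24)) \<le> c * (100 * \<delta>)\<^sup>2 * \<delta>" if "0 \<le> c" for c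
  proof -
    have "(100 * \<delta>)\<^sup>2 / (1 + t) * (c * \<delta> * (1 + t) powr (1 / 24)) \<le> (100 * \<delta>)\<^sup>2 / (1 + t) * (c * \<delta> * (1 + t))"
      using P that \<delta> t by (intro mult_left_mono) auto
    also have "\<dots> = c * (100 * \<delta>)\<^sup>2 * \<delta>" using t by simp
    finally show ?thesis .
  qed
  show xn: "xmul (a.n t) \<in> L2" by (rule nb(4))
  have "L2_norm (xmul (a.n t)) \<le> (100 * \<delta>)\<^sup>2 / (1 + t) * (12 * \<delta> * (1 + t) powr (1 / 24))"
    by (rule order_trans[OF nb(5) mult_left_mono]) (use N t in auto)
  with scale[of 12] show x12: "L2_norm (xmul (a.n t)) \<le> 12 * (100 * \<delta>)\<^sup>2 * \<delta>" by simp
  have "L2_norm (a.n t) \<le> (100 * \<delta>)\<^sup>2 / (1 + t) * (4 * \<delta> * (1 + t) powr (1 / 24))"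
    by (rule order_trans[OF nb(1) mult_left_mono]) (use N t in auto)
  with scale[of 4] have x4: "L2_norm (a.n t) \<le> 4 * (100 * \<delta>)\<^sup>2 * \<delta>" by simp
  have "cmod (fourier (a.n t) \<xi>) \<le> L2_norm (a.n t) + L2_norm (xmul (a.n t))"
    by (intro fourier_norm_le_weighted a.n_in_L2 t' xn)
  then show "cmod (fourier (a.n t) \<xi>) \<le> 16 * (100 * \<delta>)\<^sup>2 * \<delta>" using x12 x4 by simp
qed

text \<open>The chirp loss t^(-1/4) against the growth t^(1/24) leaves -5/24; the constant is 2 * 4
  * 2.\<close>

lemma beta_difference:
  assumes good: "good T" and t: "1 \<le> t" "t \<le> T"
  shows "cmod (fourier (chirp t (a.V t)) \<xi> - fourier (a.V t) \<xi>) \<le> 16 * \<delta> * t powr (- 5 / 24)"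
proof -
  have t': "0 \<le> t" "0 < t" using t by auto
  have "cmod (fourier (chirp t (a.V t)) \<xi> - fourier (a.V t) \<xi>) \<le> 2 * t powr (- 1 / 4) * L2_norm (xmul (a.V t))"
    by (intro fourier_chirp_difference a.V_L2 t') (use t' in simp)
  also have "\<dots> \<le> 2 * t powr (- 1 / 4) * (4 * \<delta> * (2 * t powr (1 / 24)))"
  proof (intro mult_left_mono)
    show "L2_norm (xmul (a.V t)) \<le> 4 * \<delta> * (2 * t powr (1 / 24))"
      by (rule order_trans[OF norms_bound(3)[OF good t'(1) t(2)]]) (use powr_late[OF t(1)] \<delta> in \<open>auto intro!: mult_left_mono\<close>)
  qed auto
  also have "\<dots> = 16 * \<delta> * (t powr (- 1 / 4) * t powr (1 / 24))" by simp
  also have "t powr (- 1 / 4) * t powr (1 / 24) = t powr (- 5 / 24)" by (simp flip: powr_add)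
  finally show ?thesis .
qed

text \<open>The decay bound controls the chirped transforms by 100 \<delta>, and unchirping adds at
  most 16 \<delta>, generously rounded to 200 \<delta>. The remainder collects two errors of size
  t^(-5/24)/t: unchirping inside the cubic term and unchirping the transform of
  \<open>n t\<close>.\<close>

lemma alpha_remainder:
  assumes good: "good T" and t: "1 \<le> t" "t < T"
  shows "cmod (fourier (a.V t) \<xi>) \<le> 200 * \<delta>"
    "cmod (complex_of_real (1 / t * (cmod (fourier (b.V t) \<xi>))\<^sup>2) * fourier (a.V t) \<xi> - fourier (a.n t) \<xi>)
      \<le> 240 * (100 * \<delta>)\<^sup>2 * \<delta> * t powr (- 29 / 24)"
proof -
  interpret f: nls_small v u \<delta> by (rule small_flip)
  have fgood: "f.good T" using good by (auto simp: decay_def f.decay_def)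
  have t': "0 < t" "0 \<le> t" "t \<le> T" using t by auto
  define tt where "tt = t powr (- 5 / 24)"
  have tt: "0 \<le> tt" "tt \<le> 1" using powr_mono[of "- 5 / 24" 0 t] t by (auto simp: tt_def)
  have dec: "AE x in lborel. cmod (u t x) \<le> 100 * \<delta> / sqrt (1 + t)" "AE x in lborel. cmod (v t x) \<le> 100 * \<delta> / sqrt (1 + t)"
    using good t t' by (auto simp: decay_def)
  have b0: "0 \<le> 100 * \<delta> / sqrt (1 + t)" using \<delta> t by simp
  note nb = n_bounds[OF t'(1) b0 dec] and nb' = f.n_bounds[OF t'(1) b0 dec(2,1)]
  let ?\<alpha> = "fourier (a.V t) \<xi>" and ?\<beta> = "fourier (chirp t (a.V t)) \<xi>"
  let ?\<alpha>' = "fourier (b.V t) \<xi>" and ?\<beta>' = "fourier (chirp t (b.V t)) \<xi>"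
  \<comment> \<open>The factor sqrt t from the factorization is cancelled by the assumed decay
    rate.\<close>
  have st: "sqrt t * (100 * \<delta> / sqrt (1 + t)) \<le> 100 * \<delta>"
  proof -
    have "sqrt t / sqrt (1 + t) \<le> 1" using t by simp
    then have "100 * \<delta> * (sqrt t / sqrt (1 + t)) \<le> 100 * \<delta> * 1" using \<delta> by (intro mult_left_mono) auto
    then show ?thesis by (simp add: mult_ac)
  qed
  have \<beta>: "cmod ?\<beta> \<le> 100 * \<delta>" "cmod ?\<beta>' \<le> 100 * \<delta>" using order_trans[OF nb(7) st] order_trans[OF nb'(7) st] by auto
  have d: "cmod (?\<beta> - ?\<alpha>) \<le> 16 * \<delta> * tt" "cmod (?\<beta>' - ?\<alpha>') \<le> 16 * \<delta> * tt"
    using beta_difference[OF good t(1) t'(3)] f.beta_difference[OF fgood t(1) t'(3)] by (auto simp: tt_def)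
  have d16: "16 * \<delta> * tt \<le> 16 * \<delta> * 1" using tt \<delta> by (intro mult_left_mono) auto
  have \<alpha>: "cmod ?\<alpha> \<le> 200 * \<delta>" "cmod ?\<alpha>' \<le> 200 * \<delta>"
    using \<beta> order_trans[OF d(1) d16] order_trans[OF d(2) d16] \<delta>(1) norm_triangle_sub[of ?\<alpha> ?\<beta>] norm_triangle_sub[of ?\<alpha>' ?\<beta>']
      norm_minus_commute[of ?\<alpha> ?\<beta>] norm_minus_commute[of ?\<alpha>' ?\<beta>']
    by linarith+
  then show "cmod ?\<alpha> \<le> 200 * \<delta>" by simp
  have \<beta>2: "cmod ?\<beta> \<le> 200 * \<delta>" "cmod ?\<beta>' \<le> 200 * \<delta>" using \<beta> \<delta> by auto
  \<comment> \<open>I measures the exchange of unchirped for chirped transforms in the cubic term, J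
    the distance of the transform of \<open>n t\<close> from the chirped cubic term; the remainder
    is I/t - J. The constants add up to 192 + 48 = 240.\<close>
  define I where "I = complex_of_real ((cmod ?\<alpha>')\<^sup>2) * ?\<alpha> - complex_of_real ((cmod ?\<beta>')\<^sup>2) * ?\<beta>"
  define J where "J = fourier (a.n t) \<xi> - complex_of_real (1 / t) * damping (fourier (chirp t (b.V t))) (fourier (chirp t (a.V t))) \<xi>"
  have I: "cmod I \<le> 192 * (100 * \<delta>)\<^sup>2 * \<delta> * tt"
  proof -
    have "cmod I \<le> (200 * \<delta>)\<^sup>2 * (cmod (?\<alpha> - ?\<beta>) + 2 * cmod (?\<alpha>' - ?\<beta>'))"
      unfolding I_def by (rule cubic_difference[OF \<alpha>(1) \<beta>2(1) \<alpha>(2) \<beta>2(2)])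
    also have "\<dots> \<le> (200 * \<delta>)\<^sup>2 * (48 * \<delta> * tt)"
      using d by (intro mult_left_mono) (auto simp: norm_minus_commute)
    also have "\<dots> = 192 * (100 * \<delta>)\<^sup>2 * \<delta> * tt" by (simp add: power2_eq_square)
    finally show ?thesis .
  qed
  have J: "cmod J \<le> (1 / t) * (48 * (100 * \<delta>)\<^sup>2 * \<delta> * tt)"
  proof -
    have sq: "(100 * \<delta> / sqrt (1 + t))\<^sup>2 \<le> (100 * \<delta>)\<^sup>2 / t"
      using t by (simp add: power_divide frac_le)
    have Z: "L2_norm (xmul (a.V t)) + 2 * L2_norm (xmul (b.V t)) \<le> 24 * \<delta> * t powr (1 / 24)"
    proof -
      have "4 * \<delta> * (1 + t) powr (1 / 24) \<le> 4 * \<delta> * (2 * t powr (1 / 24))"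
        using powr_late[OF t(1)] \<delta> by (intro mult_left_mono) auto
      then show ?thesis using norms_bound(3,4)[OF good t'(2,3)] by linarith
    qed
    have "cmod J \<le> 2 * t powr (- 1 / 4) * ((100 * \<delta> / sqrt (1 + t))\<^sup>2 * (L2_norm (xmul (a.V t)) + 2 * L2_norm (xmul (b.V t))))"
      unfolding J_def by (rule nb(6))
    also have "\<dots> \<le> 2 * t powr (- 1 / 4) * ((100 * \<delta>)\<^sup>2 / t * (24 * \<delta> * t powr (1 / 24)))"
      using sq Z t by (intro mult_left_mono mult_mono) auto
    also have "\<dots> = (1 / t) * (48 * (100 * \<delta>)\<^sup>2 * \<delta> * (t powr (- 1 / 4) * t powr (1 / 24)))" by simp
    also have "t powr (- 1 / 4) * t powr (1 / 24) = tt" by (simp add: tt_def flip: powr_add)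
    finally show ?thesis .
  qed
  have "complex_of_real (1 / t * (cmod ?\<alpha>')\<^sup>2) * ?\<alpha> - fourier (a.n t) \<xi> = complex_of_real (1 / t) * I - J"
    by (simp add: I_def J_def damping_def algebra_simps)
  then have "cmod (complex_of_real (1 / t * (cmod ?\<alpha>')\<^sup>2) * ?\<alpha> - fourier (a.n t) \<xi>) \<le> (1 / t) * cmod I + cmod J"
    using norm_triangle_ineq4[of "complex_of_real (1 / t) * I" J] t' by (simp add: norm_mult norm_divide)
  also have "\<dots> \<le> (1 / t) * (192 * (100 * \<delta>)\<^sup>2 * \<delta> * tt) + (1 / t) * (48 * (100 * \<delta>)\<^sup>2 * \<delta> * tt)"
    using I J t by (intro add_mono mult_left_mono) auto
  also have "\<dots> = 240 * (100 * \<delta>)\<^sup>2 * \<delta> * (tt / t)" by (simp add: field_simps)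
  also have "tt / t = t powr (- 29 / 24)"
    using t powr_diff[of t "- 5 / 24" 1] by (simp add: tt_def)
  finally show "cmod (complex_of_real (1 / t * (cmod ?\<alpha>')\<^sup>2) * ?\<alpha> - fourier (a.n t) \<xi>)
      \<le> 240 * (100 * \<delta>)\<^sup>2 * \<delta> * t powr (- 29 / 24)" .
qed

lemma alpha_derivative:
  assumes good: "good T" and t: "0 < t" "t < T"
  shows "((\<lambda>\<tau>. fourier (a.V \<tau>) \<xi>) has_vector_derivative - fourier (a.n t) \<xi>) (at t)"
proof -
  have "((\<lambda>\<tau>. fourier (a.V \<tau>) \<xi>) has_vector_derivative fourier (\<lambda>x. - a.n t x) \<xi>) (at t)"
  proof (rule fourier_curve_derivative[where d = "\<lambda>t x. - a.n t x" and a = 0 and b = T and C = "12 * (100 * \<delta>)\<^sup>2 * \<delta>"])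
    fix \<tau> assume \<tau>: "0 < \<tau>" "\<tau> < T"
    show "has_L2_time_derivative a.V (\<lambda>x. - a.n \<tau> x) \<tau>" by (rule a.V_derivative[OF \<tau>(1)])
    show "xmul (\<lambda>x. - a.n \<tau> x) \<in> L2" using L2_uminus[OF n_bound(1)[OF good \<tau>]] by simp
    show "L2_norm (xmul (\<lambda>x. - a.n \<tau> x)) \<le> 12 * (100 * \<delta>)\<^sup>2 * \<delta>" using n_bound(2)[OF good \<tau>] by simp
  qed (use t a.V_L2 in auto)
  moreover have "fourier (\<lambda>x. - a.n t x) \<xi> = - fourier (a.n t) \<xi>"
    using fourier_cmult[of "-1" "a.n t"] by simp
  ultimately show ?thesis by simp
qed

lemma alpha_continuous: "continuous_on {0..T} (\<lambda>\<tau>. fourier (a.V \<tau>) \<xi>)"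
proof (rule a.V_weighted_bounded[of T])
  fix M assume M: "\<And>t. 0 \<le> t \<Longrightarrow> t \<le> T \<Longrightarrow> L2_norm (xmul (a.V t)) \<le> M"
  show ?thesis by (rule fourier_curve_continuous[OF a.V_L2(1,2) a.V_continuous(1) M])
qed

text \<open>The main term has a favourable sign and is dropped. Adding k t^(-5/24), whose derivative
  is a negative multiple of t^(-29/24), makes the squared modulus nonincreasing from time 1
  on.\<close>

lemma alpha_late:
  assumes good: "good T" and T: "1 \<le> T"
  shows "cmod (fourier (a.V T) \<xi>) \<le> 17 * \<delta>"
proof -
  \<comment> \<open>Chosen to match exactly: k * 5/24 equals 2 * (200 \<delta>) * 240 (100
    \<delta>)^2 \<delta>, twice the product of the bounds on the transform and on the
    remainder.\<close>
  define k where "k = 4608 * (100 * \<delta>)\<^sup>2 * (100 * \<delta>) * \<delta>"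
  have k0: "0 \<le> k" using \<delta> by (simp add: k_def)
  let ?\<alpha> = "\<lambda>t. fourier (a.V t) \<xi>"
  let ?F = "\<lambda>t. (cmod (?\<alpha> t))\<^sup>2 + k * t powr (- 5 / 24)"
  have "?F T \<le> ?F 1"
  proof (cases "T = 1")
    case False
    with T have T1: "1 < T" by simp
    show ?thesis
    proof (rule DERIV_nonpos_imp_decreasing_open[OF less_imp_le[OF T1]])
      fix t assume t: "1 < t" "t < T"
      let ?R = "complex_of_real (1 / t * (cmod (fourier (b.V t) \<xi>))\<^sup>2) * ?\<alpha> t - fourier (a.n t) \<xi>"
      have t': "0 < t" "1 \<le> t" using t by auto
      have d: "(?F has_real_derivative 2 * Re (cnj (?\<alpha> t) * (- fourier (a.n t) \<xi>)) + k * (- 5 / 24 * t powr (- 5 / 24 - 1))) (at t)"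
        by (intro DERIV_add has_real_derivative_cmod_sq alpha_derivative[OF good t'(1) t(2)] DERIV_cmult)
          (use t' in \<open>auto intro!: derivative_eq_intros\<close>)
      \<comment> \<open>Splits off the dissipative term -r |z|^2, with r = |\<alpha>_2|^2/t, so that
        only the remainder is estimated in modulus.\<close>
      have alg: "Re (cnj z * (- w)) = Re (cnj z * (complex_of_real r * z - w)) - r * (cmod z)\<^sup>2" for z w r
        unfolding cmod_power2 by (simp add: algebra_simps power2_eq_square)
      have "Re (cnj (?\<alpha> t) * (- fourier (a.n t) \<xi>)) = Re (cnj (?\<alpha> t) * ?R) - (1 / t * (cmod (fourier (b.V t) \<xi>))\<^sup>2) * (cmod (?\<alpha> t))\<^sup>2"
        by (rule alg)
      also have "\<dots> \<le> Re (cnj (?\<alpha> t) * ?R)" using t' by simp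
      also have "\<dots> \<le> cmod (cnj (?\<alpha> t) * ?R)" by (rule complex_Re_le_cmod)
      also have "\<dots> = cmod (?\<alpha> t) * cmod ?R" by (simp add: norm_mult)
      also have "\<dots> \<le> (200 * \<delta>) * (240 * (100 * \<delta>)\<^sup>2 * \<delta> * t powr (- 29 / 24))"
        using alpha_remainder[OF good t'(2) t(2)] \<delta> by (intro mult_mono) auto
      finally have "Re (cnj (?\<alpha> t) * (- fourier (a.n t) \<xi>)) \<le> (200 * \<delta>) * (240 * (100 * \<delta>)\<^sup>2 * \<delta> * t powr (- 29 / 24))" .
      moreover have "k * (- 5 / 24 * t powr (- 5 / 24 - 1)) = - 2 * ((200 * \<delta>) * (240 * (100 * \<delta>)\<^sup>2 * \<delta> * t powr (- 29 / 24)))"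
        by (simp add: k_def)
      ultimately have "2 * Re (cnj (?\<alpha> t) * (- fourier (a.n t) \<xi>)) + k * (- 5 / 24 * t powr (- 5 / 24 - 1)) \<le> 0" by linarith
      with d show "\<exists>y. (?F has_real_derivative y) (at t) \<and> y \<le> 0" by blast
    next
      have "continuous_on {1..T} ?\<alpha>" by (rule continuous_on_subset[OF alpha_continuous[of T]]) auto
      then show "continuous_on {1..T} ?F" by (intro continuous_intros) auto
    qed
  qed simp
  moreover have "0 \<le> k * T powr (- 5 / 24)" using k0 by simp
  moreover have "?F 1 = (cmod (?\<alpha> 1))\<^sup>2 + k * 1" by simp
  ultimately have "(cmod (?\<alpha> T))\<^sup>2 \<le> (cmod (?\<alpha> 1))\<^sup>2 + k * 1" by linarith
  \<comment> \<open>33 = 17^2 - 16^2, so this is exactly the room between the bound at time 1 and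
    the claim.\<close>
  also have "\<dots> \<le> (16 * \<delta>)\<^sup>2 + 33 * \<delta>\<^sup>2"
  proof (rule add_mono)
    show "(cmod (?\<alpha> 1))\<^sup>2 \<le> (16 * \<delta>)\<^sup>2" using alpha_early[OF good, of 1] T by (intro power_mono) auto
    have "\<delta> * \<delta> \<le> (1 / 100000) * (1 / 100000)" using \<delta> by (intro mult_mono) auto
    then have "4608000000 * (\<delta> * \<delta>) * (\<delta> * \<delta>) \<le> 33 * (\<delta> * \<delta>)" by (intro mult_right_mono) auto
    then show "k * 1 \<le> 33 * \<delta>\<^sup>2" by (simp add: k_def power2_eq_square mult_ac)
  qed
  also have "\<dots> = (17 * \<delta>)\<^sup>2" by (simp add: power2_eq_square)
  finally have "(cmod (?\<alpha> T))\<^sup>2 \<le> (17 * \<delta>)\<^sup>2" .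
  then show ?thesis by (rule power2_le_imp_le) (use \<delta> in simp)
qed

text \<open>Up to time 1 Sobolev embedding suffices, with 16 \<delta> against 25 \<delta>.
  Afterwards factorization reduces the bound to the chirped transform, of size at most 17 \<delta> +
  16 \<delta> = 33 \<delta>.\<close>

lemma decay_improved:
  assumes good: "good T" and T: "0 \<le> T"
  shows "AE x in lborel. cmod (u T x) \<le> 50 * \<delta> / sqrt (1 + T)"
proof (cases "T \<le> 1")
  case True
  have "AE x in lborel. cmod (u T x) \<le> L2_norm (u T) + L2_norm (xmul (fourier_L2 (u T)))"
    by (rule sobolev_sup_bound[OF a.u_bounds(1,3)[OF T]])
  moreover have "L2_norm (u T) + L2_norm (xmul (fourier_L2 (u T))) \<le> 50 * \<delta> / sqrt (1 + T)"
  proof -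
    have "L2_norm (u T) + L2_norm (xmul (fourier_L2 (u T))) \<le> 8 * \<delta> * (1 + T) powr (1 / 24)"
      using norms_bound(1,5)[OF good T order_refl] a.V_L2(3,6)[OF T] by simp
    also have "\<dots> \<le> 8 * \<delta> * 2" using powr_early[OF T] True \<delta> by (intro mult_left_mono) auto
    also have "\<dots> \<le> 50 * \<delta> / 2" using \<delta> by simp
    also have "\<dots> \<le> 50 * \<delta> / sqrt (1 + T)"
      using \<delta> T True by (intro divide_left_mono real_le_lsqrt) auto
    finally show ?thesis .
  qed
  ultimately show ?thesis by (auto elim!: eventually_mono)
next
  case False
  then have T1: "1 \<le> T" "0 < T" by auto
  have "AE x in lborel. u T x = cis (x\<^sup>2 / (2 * T)) / csqrt (\<i> * T) * fourier (chirp T (a.V T)) (x / T)"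
    using a.V_L2(8)[OF T] schroedinger_factorization[OF a.V_L2(1,9)[OF T] T1(2)] by eventually_elim simp
  then show ?thesis
  proof eventually_elim
    case (elim x)
    let ?\<beta> = "fourier (chirp T (a.V T)) (x / T)" and ?\<alpha> = "fourier (a.V T) (x / T)"
    have "T powr (- 5 / 24) \<le> T powr 0" using T1 by (intro powr_mono) auto
    then have "16 * \<delta> * T powr (- 5 / 24) \<le> 16 * \<delta> * 1" using T1 \<delta> by (intro mult_left_mono) auto
    then have "cmod (?\<beta> - ?\<alpha>) \<le> 16 * \<delta>" using beta_difference[OF good T1(1) order_refl, of "x / T"] by simp
    then have "cmod ?\<beta> \<le> 33 * \<delta>"
      using alpha_late[OF good T1(1), of "x / T"] norm_triangle_sub[of ?\<beta> ?\<alpha>] by linarith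
    then have 1: "cmod (u T x) \<le> 33 * \<delta> / sqrt T"
      using T1 unfolding elim by (simp add: norm_mult norm_divide norm_csqrt divide_right_mono)
    \<comment> \<open>Changing sqrt T into sqrt (1 + T) costs at most 3/2, and 33 * 3/2 = 49.5 stays
      below 50.\<close>
    have "sqrt (1 + T) \<le> sqrt (2 * T)" using T1 by simp
    also have "\<dots> = sqrt 2 * sqrt T" by (rule real_sqrt_mult)
    also have "\<dots> \<le> 3 / 2 * sqrt T" using T1 by (intro mult_right_mono real_le_lsqrt) (auto simp: power2_eq_square)
    finally have "33 * sqrt (1 + T) \<le> 50 * sqrt T" using real_sqrt_ge_zero[of T] T1 by linarith
    then have "\<delta> * (33 * sqrt (1 + T)) \<le> \<delta> * (50 * sqrt T)" using \<delta> by (intro mult_left_mono) auto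
    then have "33 * \<delta> / sqrt T \<le> 50 * \<delta> / sqrt (1 + T)" using T1 by (simp add: field_simps)
    with 1 show ?case by simp
  qed
qed

lemma sup_difference:
  assumes "0 \<le> t" "0 \<le> s"
  shows "AE x in lborel. cmod (u t x - u s x) \<le> 2 * sobolev_norm 1 1 (\<lambda>x. u t x - u s x)"
proof -
  have "(\<lambda>x. u t x - u s x) \<in> sobolev 1 1"
    using a.u11 assms by (intro sobolev_diff) (auto simp: continuous_in_sobolev_def)
  note sb = sobolev_1_1_bounds[OF this]
  show ?thesis
    using sobolev_sup_bound[OF sb(1,3)] by eventually_elim (use sb(4,6) in simp)
qed

text \<open>The gap between 50 and 100 is used in two halves: 25 for the change of u, small in sup
  norm by H^{1,1} continuity, and the rest for the change of the weight 1/sqrt (1 + t).\<close>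

lemma decay_near:
  assumes good: "good s" and s: "0 \<le> s"
  shows "\<forall>\<^sub>F t in at s within {0..}. AE x in lborel. cmod (u t x) \<le> 100 * \<delta> / sqrt (1 + t)"
proof -
  have lim: "((\<lambda>t. 2 * sobolev_norm 1 1 (\<lambda>x. u t x - u s x)) \<longlongrightarrow> 2 * 0) (at s within {0..})"
    using a.u11 s by (intro tendsto_mult_left) (auto simp: continuous_in_sobolev_def)
  have lim2: "((\<lambda>t. 100 * \<delta> / sqrt (1 + t)) \<longlongrightarrow> 100 * \<delta> / sqrt (1 + s)) (at s within {0..})"
    using s by (intro tendsto_intros) auto
  have pos: "0 < 25 * \<delta> / sqrt (1 + s)" "75 * \<delta> / sqrt (1 + s) < 100 * \<delta> / sqrt (1 + s)"
    using \<delta> s by (auto intro!: divide_strict_right_mono)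
  have e1: "\<forall>\<^sub>F t in at s within {0..}. 2 * sobolev_norm 1 1 (\<lambda>x. u t x - u s x) < 25 * \<delta> / sqrt (1 + s)"
    using order_tendstoD(2)[OF lim] pos by simp
  have e2: "\<forall>\<^sub>F t in at s within {0..}. 75 * \<delta> / sqrt (1 + s) < 100 * \<delta> / sqrt (1 + t)"
    using order_tendstoD(1)[OF lim2] pos by simp
  have e3: "\<forall>\<^sub>F t in at s within {0..}. 0 \<le> t" by (auto simp: eventually_at_filter)
  show ?thesis
    using e1 e2 e3
  proof eventually_elim
    case (elim t)
    show ?case
      using decay_improved[OF good s] sup_difference[OF elim(3) s]
    proof eventually_elim
      case (elim x)
      have "cmod (u t x) \<le> cmod (u s x) + cmod (u t x - u s x)" by (rule norm_triangle_sub)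
      also have "\<dots> \<le> 50 * \<delta> / sqrt (1 + s) + 25 * \<delta> / sqrt (1 + s)"
        using elim \<open>2 * sobolev_norm 1 1 (\<lambda>x. u t x - u s x) < 25 * \<delta> / sqrt (1 + s)\<close> by simp
      also have "\<dots> = 75 * \<delta> / sqrt (1 + s)" by (simp flip: add_divide_distrib)
      finally show ?case using \<open>75 * \<delta> / sqrt (1 + s) < 100 * \<delta> / sqrt (1 + t)\<close> by simp
    qed
  qed
qed

text \<open>At the infimum s of the failing times the improved bound holds, and it persists nearby,
  which contradicts the choice of s. For s = 0 the condition \<open>good\<close> is vacuous, so the
  start of the bootstrap is included.\<close>

lemma decay_all:
  assumes "0 \<le> t"
  shows "decay t"
proof (rule ccontr)
  assume nd: "\<not> decay t"
  interpret f: nls_small v u \<delta> by (rule small_flip)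
  define S where "S = {t. 0 \<le> t \<and> \<not> decay t}"
  define s where "s = Inf S"
  have S: "S \<noteq> {}" "bdd_below S" using assms nd by (auto simp: S_def intro!: bdd_belowI[of _ 0])
  have s0: "0 \<le> s" unfolding s_def using S by (intro cInf_greatest) (auto simp: S_def)
  have good: "good s"
  proof (intro allI impI)
    fix t assume t: "0 < t" "t < s"
    then have "t \<notin> S" using cInf_lower[OF _ S(2), of t] by (auto simp: s_def)
    then show "decay t" using t by (simp add: S_def)
  qed
  then have fgood: "f.good s" by (auto simp: decay_def f.decay_def)
  have le: "50 * \<delta> / sqrt (1 + s) \<le> 100 * \<delta> / sqrt (1 + s)" using \<delta> s0 by (intro divide_right_mono) auto
  have "AE x in lborel. cmod (u s x) \<le> 100 * \<delta> / sqrt (1 + s)"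
    using decay_improved[OF good s0] by eventually_elim (use le in linarith)
  moreover have "AE x in lborel. cmod (v s x) \<le> 100 * \<delta> / sqrt (1 + s)"
    using f.decay_improved[OF fgood s0] by eventually_elim (use le in linarith)
  ultimately have ds: "decay s" by (simp add: decay_def)
  have "\<forall>\<^sub>F t in at s within {0..}. decay t"
    using decay_near[OF good s0] f.decay_near[OF fgood s0] by eventually_elim (simp add: decay_def)
  then obtain d where d: "0 < d" "\<And>t. 0 \<le> t \<Longrightarrow> t \<noteq> s \<Longrightarrow> dist t s < d \<Longrightarrow> decay t"
    unfolding eventually_at by auto
  obtain t where t: "t \<in> S" "t < s + d"
    using cInf_lessD[OF S(1), of "s + d"] d by (auto simp: s_def)
  have "s \<le> t" unfolding s_def by (rule cInf_lower[OF t(1) S(2)])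
  then have "decay t" using d(2)[of t] ds t by (cases "t = s") (auto simp: S_def dist_real_def)
  then show False using t by (simp add: S_def)
qed

lemma good_all: "good T"
  using decay_all by simp

subsection \<open>The limiting profile\<close>

lemma profile_eq: "profile u t = fourier (a.V t)"
  by (simp add: profile_def a.V_def)

text \<open>A cubic change multiplied by a linear size: the derivative bound 16(100 \<delta>)^2
  \<delta> over length 2, times the sum 32 \<delta> of two moduli. This is why the increment is
  quartic.\<close>

lemma profile_increment: "\<bar>(cmod (profile u 2 \<xi>))\<^sup>2 - (cmod (profile u 0 \<xi>))\<^sup>2\<bar> \<le> 1024 * (100 * \<delta>)\<^sup>2 * \<delta>\<^sup>2"
proof -
  let ?\<alpha> = "\<lambda>t. fourier (a.V t) \<xi>"
  have "norm (?\<alpha> 2 - ?\<alpha> 0) \<le> (16 * (100 * \<delta>)\<^sup>2 * \<delta>) * 2 - (16 * (100 * \<delta>)\<^sup>2 * \<delta>) * 0"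
  proof (rule differentiable_bound_general)
    fix t :: real assume t: "0 < t" "t < 2"
    show "(?\<alpha> has_vector_derivative - fourier (a.n t) \<xi>) (at t)" by (rule alpha_derivative[OF good_all t])
    show "norm (- fourier (a.n t) \<xi>) \<le> 16 * (100 * \<delta>)\<^sup>2 * \<delta>" using n_bound(3)[OF good_all t] by simp
    show "((\<lambda>t. (16 * (100 * \<delta>)\<^sup>2 * \<delta>) * t) has_vector_derivative 16 * (100 * \<delta>)\<^sup>2 * \<delta>) (at t)"
      unfolding has_real_derivative_iff_has_vector_derivative[symmetric] by (auto intro!: derivative_eq_intros)
  qed (auto intro!: alpha_continuous continuous_intros)
  then have d: "norm (?\<alpha> 2 - ?\<alpha> 0) \<le> 32 * (100 * \<delta>)\<^sup>2 * \<delta>" by simp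
  have e: "cmod (?\<alpha> 2) \<le> 16 * \<delta>" "cmod (?\<alpha> 0) \<le> 16 * \<delta>"
    using alpha_early[OF good_all, of 2 2] alpha_early[OF good_all, of 0 0] by auto
  have "(cmod (?\<alpha> 2))\<^sup>2 - (cmod (?\<alpha> 0))\<^sup>2 = (cmod (?\<alpha> 2) - cmod (?\<alpha> 0)) * (cmod (?\<alpha> 2) + cmod (?\<alpha> 0))"
    by (simp add: power2_eq_square algebra_simps)
  then have "\<bar>(cmod (?\<alpha> 2))\<^sup>2 - (cmod (?\<alpha> 0))\<^sup>2\<bar> = \<bar>cmod (?\<alpha> 2) - cmod (?\<alpha> 0)\<bar> * (cmod (?\<alpha> 2) + cmod (?\<alpha> 0))"
    by (simp add: abs_mult)
  also have "\<dots> \<le> (32 * (100 * \<delta>)\<^sup>2 * \<delta>) * (32 * \<delta>)"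
    using d e \<delta> norm_triangle_ineq3[of "?\<alpha> 2" "?\<alpha> 0"] by (intro mult_mono) auto
  finally show ?thesis by (simp add: profile_eq power2_eq_square)
qed

lemma remainder_bound:
  assumes "1 \<le> t"
  shows "cmod (profile u t \<xi>) * cmod (remainder v u t \<xi>) \<le> 480 * (100 * \<delta>) ^ 3 * \<delta> * t powr (- 29 / 24)"
proof -
  interpret f: nls_small v u \<delta> by (rule small_flip)
  have "remainder v u t \<xi> = complex_of_real (1 / t * (cmod (fourier (b.V t) \<xi>))\<^sup>2) * fourier (a.V t) \<xi> - fourier (a.n t) \<xi>"
    by (simp only: remainder_def profile_eq f.profile_eq a.n_def)
  then have "cmod (profile u t \<xi>) * cmod (remainder v u t \<xi>) \<le> (200 * \<delta>) * (240 * (100 * \<delta>)\<^sup>2 * \<delta> * t powr (- 29 / 24))"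
    unfolding profile_eq using alpha_remainder[OF good_all assms, of "t + 1"] \<delta> by (intro mult_mono) auto
  also have "\<dots> = 480 * (100 * \<delta>) ^ 3 * \<delta> * t powr (- 29 / 24)" by (simp add: power2_eq_square power3_eq_cube)
  finally show ?thesis .
qed

end

section \<open>The integral over large times, the data and the conclusion\<close>

lemma integral_powr_tail_bound:
  fixes f :: "real \<Rightarrow> real"
  assumes c: "0 \<le> c" and f: "\<And>t. 2 \<le> t \<Longrightarrow> \<bar>f t\<bar> \<le> c * t powr (- 29 / 24)"
  shows "\<bar>LINT t:{2..}|lborel. f t\<bar> \<le> 24 / 5 * c"
proof (cases "set_integrable lborel {2..} f")
  case True
  let ?F = "\<lambda>t::real. - (24 / 5 * c) * t powr (- 5 / 24)"
  have "ennreal (norm (LINT t:{2..}|lborel. f t)) \<le> (\<integral>\<^sup>+t. norm (indicator {2..} t *\<^sub>R f t) \<partial>lborel)"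
    unfolding set_lebesgue_integral_def using True unfolding set_integrable_def by (rule integral_norm_bound_ennreal)
  also have "\<dots> \<le> (\<integral>\<^sup>+t. ennreal (c * t powr (- 29 / 24)) * indicator {2..} t \<partial>lborel)"
    using f by (intro nn_integral_mono) (auto simp: indicator_def intro!: ennreal_leI)
  also have "\<dots> = ennreal (0 - ?F 2)"
  proof (rule nn_integral_FTC_atLeast)
    show "(?F \<longlongrightarrow> 0) at_top" by real_asymp
    show "(?F has_real_derivative c * t powr (- 29 / 24)) (at t)" if "2 \<le> t" for t
      using that by (auto intro!: derivative_eq_intros simp: field_simps)
  qed (use c in auto)
  also have "\<dots> \<le> ennreal (24 / 5 * c)"
  proof (rule ennreal_leI)
    have "2 powr (- 5 / 24) \<le> 2 powr (0::real)" by (rule powr_mono) auto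
    then have "24 / 5 * c * 2 powr (- 5 / 24) \<le> 24 / 5 * c * 1" using c by (intro mult_left_mono) auto
    then show "0 - ?F 2 \<le> 24 / 5 * c" by simp
  qed
  finally show ?thesis using c by simp
next
  \<comment> \<open>A nonintegrable function has integral 0 by convention, so the bound is
    trivial.\<close>
  case False
  then show ?thesis using c unfolding set_integrable_def set_lebesgue_integral_def by (simp add: not_integrable_integral_eq)
qed

context nls_small
begin

text \<open>Two increments over [0,2] and the integral of \<open>rho\<close>, each of order
  \<delta>^4. The factor 1920 is 2 * (480 + 480), from the two products inside
  \<open>rho\<close>.\<close>

lemma m_fun_bound:
  "\<bar>m_fun u v \<xi> - ((cmod (profile u 0 \<xi>))\<^sup>2 - (cmod (profile v 0 \<xi>))\<^sup>2)\<bar> \<le> 10 ^ 10 * \<delta> ^ 4"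
proof -
  interpret f: nls_small v u \<delta> by (rule small_flip)
  let ?I = "LINT t:{2..}|lborel. rho u v t \<xi>"
  have "\<bar>?I\<bar> \<le> 24 / 5 * (1920 * (100 * \<delta>) ^ 3 * \<delta>)"
  proof (rule integral_powr_tail_bound)
    fix t :: real assume t: "2 \<le> t"
    let ?P = "cnj (profile u t \<xi>) * remainder v u t \<xi>" and ?Q = "cnj (profile v t \<xi>) * remainder u v t \<xi>"
    have "\<bar>rho u v t \<xi>\<bar> \<le> 2 * cmod (?P - ?Q)"
      unfolding rho_def using abs_Re_le_cmod[of "?P - ?Q"] by (simp add: abs_mult)
    also have "\<dots> \<le> 2 * (cmod ?P + cmod ?Q)" using norm_triangle_ineq4[of ?P ?Q] by simp
    also have "\<dots> \<le> 2 * (480 * (100 * \<delta>) ^ 3 * \<delta> * t powr (- 29 / 24) + 480 * (100 * \<delta>) ^ 3 * \<delta> * t powr (- 29 / 24))"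
      unfolding norm_mult complex_mod_cnj using t
      by (intro mult_left_mono add_mono remainder_bound f.remainder_bound) auto
    also have "\<dots> = 1920 * (100 * \<delta>) ^ 3 * \<delta> * t powr (- 29 / 24)" by simp
    finally show "\<bar>rho u v t \<xi>\<bar> \<le> 1920 * (100 * \<delta>) ^ 3 * \<delta> * t powr (- 29 / 24)" .
  qed (use \<delta> in simp)
  then have "\<bar>m_fun u v \<xi> - ((cmod (profile u 0 \<xi>))\<^sup>2 - (cmod (profile v 0 \<xi>))\<^sup>2)\<bar>
      \<le> 1024 * (100 * \<delta>)\<^sup>2 * \<delta>\<^sup>2 + 1024 * (100 * \<delta>)\<^sup>2 * \<delta>\<^sup>2 + 24 / 5 * (1920 * (100 * \<delta>) ^ 3 * \<delta>)"
    using profile_increment[of \<xi>] f.profile_increment[of \<xi>] unfolding m_fun_def by linarith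
  \<comment> \<open>2 * 1024 * 10^4 + (24/5) * 1920 * 10^6, which is then rounded up to
    10^10.\<close>
  also have "\<dots> = 9236480000 * \<delta> ^ 4"
    by (simp add: power2_eq_square power3_eq_cube power4_eq_xxxx)
  also have "\<dots> \<le> 10 ^ 10 * \<delta> ^ 4" by (intro mult_right_mono) auto
  finally show ?thesis .
qed

end

text \<open>The initial value is prescribed only almost everywhere. The weighted norms scale with
  \<epsilon>, and the last claim holds at every \<xi> because the transform is an integral, blind to
  null sets.\<close>

lemma initial_data_norms:
  assumes \<psi>: "\<psi> \<in> sobolev 1 1" and w: "w \<in> L2" and eq: "AE x in lborel. w x = complex_of_real \<epsilon> * \<psi> x" and \<epsilon>: "0 < \<epsilon>"
  shows "L2_norm w = \<epsilon> * L2_norm \<psi>" "L2_norm (xmul w) = \<epsilon> * L2_norm (xmul \<psi>)"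
    "L2_norm (xmul (fourier_L2 w)) = \<epsilon> * L2_norm (xmul (fourier_L2 \<psi>))"
    "fourier (schroedinger 0 w) \<xi> = complex_of_real \<epsilon> * fourier \<psi> \<xi>"
proof -
  note sb = sobolev_1_1_bounds[OF \<psi>]
  have [measurable]: "w \<in> borel_measurable borel" "\<psi> \<in> borel_measurable borel" "fourier_L2 w \<in> borel_measurable borel"
    "fourier_L2 \<psi> \<in> borel_measurable borel"
    using w sb by (auto intro: L2_measurable fourier_L2_measurable)
  have c: "cmod (complex_of_real \<epsilon>) = \<epsilon>" using \<epsilon> by simp
  have n: "L2_norm f = \<epsilon> * L2_norm g"
    if "AE x in lborel. f x = complex_of_real \<epsilon> * g x" "g \<in> L2" "f \<in> borel_measurable borel" for f g
    using L2_cong(2)[OF L2_cmult[OF that(2)] that(3,1)] L2_norm_cmult[of "complex_of_real \<epsilon>" g] c by simp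
  show "L2_norm w = \<epsilon> * L2_norm \<psi>" by (rule n[OF eq sb(1)]) measurable
  show "L2_norm (xmul w) = \<epsilon> * L2_norm (xmul \<psi>)"
  proof (rule n[OF _ sb(2)])
    show "AE x in lborel. xmul w x = complex_of_real \<epsilon> * xmul \<psi> x" using eq by eventually_elim simp
  qed measurable
  have "fourier_L2 w = fourier_L2 (\<lambda>x. complex_of_real \<epsilon> * \<psi> x)"
    by (rule fourier_L2_cong_AE[OF _ _ eq]) measurable
  then have F: "AE x in lborel. fourier_L2 w x = complex_of_real \<epsilon> * fourier_L2 \<psi> x"
    using fourier_L2_cmult[OF sb(1), of "complex_of_real \<epsilon>"] by simp
  show "L2_norm (xmul (fourier_L2 w)) = \<epsilon> * L2_norm (xmul (fourier_L2 \<psi>))"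
  proof (rule n[OF _ sb(3)])
    show "AE x in lborel. xmul (fourier_L2 w) x = complex_of_real \<epsilon> * xmul (fourier_L2 \<psi>) x"
      using F by eventually_elim simp
  qed measurable
  \<comment> \<open>Even at time 0 the group is an inversion of a transform, hence the identity only
    almost everywhere.\<close>
  have "AE x in lborel. schroedinger 0 w x = w x"
  proof (rule fourier_L2_eqD[OF schroedinger_L2(1)[OF w] w])
    show "AE \<xi> in lborel. fourier_L2 (schroedinger 0 w) \<xi> = fourier_L2 w \<xi>"
      using schroedinger_L2(3)[OF w, of 0] by simp
  qed
  then have "AE x in lborel. schroedinger 0 w x = complex_of_real \<epsilon> * \<psi> x"
    using eq by eventually_elim simp
  then have "fourier (schroedinger 0 w) = fourier (\<lambda>x. complex_of_real \<epsilon> * \<psi> x)"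
    using L2_measurable[OF schroedinger_L2(1)[OF w]] by (intro fourier_cong_AE) auto
  then show "fourier (schroedinger 0 w) \<xi> = complex_of_real \<epsilon> * fourier \<psi> \<xi>"
    by (simp add: fourier_cmult)
qed

theorem theorem2p1:
  fixes \<psi>1 \<psi>2 :: "real \<Rightarrow> complex"
  assumes "\<psi>1 \<in> sobolev 2 0 \<inter> sobolev 1 1"
    and "\<psi>2 \<in> sobolev 2 0 \<inter> sobolev 1 1"
  shows "\<exists>C>0. \<exists>\<epsilon>0>0. \<forall>\<epsilon>. 0 < \<epsilon> \<and> \<epsilon> < \<epsilon>0 \<longrightarrow>
    (\<forall>u1 u2. global_solution (\<lambda>x. complex_of_real \<epsilon> * \<psi>1 x) (\<lambda>x. complex_of_real \<epsilon> * \<psi>2 x) u1 u2 \<longrightarrow>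
      (\<forall>\<xi>. \<bar>m_fun u1 u2 \<xi> - \<epsilon>\<^sup>2 * ((cmod (fourier \<psi>1 \<xi>))\<^sup>2 - (cmod (fourier \<psi>2 \<xi>))\<^sup>2)\<bar>
             \<le> C * \<epsilon> ^ 4))"
proof -
  \<comment> \<open>The summand 1 keeps D positive when both data vanish, since \<delta> =
    \<epsilon> D must be positive and D appears in a denominator.\<close>
  define D where "D = 1 + (L2_norm \<psi>1 + L2_norm (xmul \<psi>1) + L2_norm (xmul (fourier_L2 \<psi>1)))
      + (L2_norm \<psi>2 + L2_norm (xmul \<psi>2) + L2_norm (xmul (fourier_L2 \<psi>2)))"
  have D: "L2_norm \<psi>1 \<le> D" "L2_norm (xmul \<psi>1) \<le> D" "L2_norm (xmul (fourier_L2 \<psi>1)) \<le> D"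
    "L2_norm \<psi>2 \<le> D" "L2_norm (xmul \<psi>2) \<le> D" "L2_norm (xmul (fourier_L2 \<psi>2)) \<le> D" "0 < D"
    unfolding D_def by (simp_all add: add_nonneg_nonneg add_increasing add_increasing2 add_pos_nonneg)
  \<comment> \<open>With \<delta> = \<epsilon> D the quartic bound gives C = 10^10 D^4, and the
    smallness \<delta> \<le> 1/100000 dictates the threshold for \<epsilon>.\<close>
  show ?thesis
  proof (rule exI[of _ "10 ^ 10 * D ^ 4"], rule conjI[rotated],
      rule exI[of _ "1 / (100000 * D)"], rule conjI[rotated], intro allI impI)
    fix \<epsilon> u1 u2 \<xi>
    assume \<epsilon>: "0 < \<epsilon> \<and> \<epsilon> < 1 / (100000 * D)"
      and sol: "global_solution (\<lambda>x. complex_of_real \<epsilon> * \<psi>1 x) (\<lambda>x. complex_of_real \<epsilon> * \<psi>2 x) u1 u2"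
    have e: "0 < \<epsilon>" using \<epsilon> by simp
    have u0: "u1 0 \<in> L2" "u2 0 \<in> L2"
      using sol by (auto simp: global_solution_def continuous_in_sobolev_def sobolev_def)
    have ae: "AE x in lborel. u1 0 x = complex_of_real \<epsilon> * \<psi>1 x" "AE x in lborel. u2 0 x = complex_of_real \<epsilon> * \<psi>2 x"
      using sol by (auto simp: global_solution_def)
    have \<psi>: "\<psi>1 \<in> sobolev 1 1" "\<psi>2 \<in> sobolev 1 1" using assms by auto
    note i1 = initial_data_norms[OF \<psi>(1) u0(1) ae(1) e] and i2 = initial_data_norms[OF \<psi>(2) u0(2) ae(2) e]
    interpret nls_small u1 u2 "\<epsilon> * D"
    proof unfold_locales
      show "0 < \<epsilon> * D" using e D by simp
      show "\<epsilon> * D \<le> 1 / 100000" using \<epsilon> D by (simp add: field_simps)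
    qed (use sol i1 i2 D e in \<open>auto simp: global_solution_def\<close>)
    have "profile u1 0 \<xi> = complex_of_real \<epsilon> * fourier \<psi>1 \<xi>" "profile u2 0 \<xi> = complex_of_real \<epsilon> * fourier \<psi>2 \<xi>"
      using i1(4) i2(4) by (simp_all add: profile_def)
    then have "(cmod (profile u1 0 \<xi>))\<^sup>2 - (cmod (profile u2 0 \<xi>))\<^sup>2 = \<epsilon>\<^sup>2 * ((cmod (fourier \<psi>1 \<xi>))\<^sup>2 - (cmod (fourier \<psi>2 \<xi>))\<^sup>2)"
      by (simp add: norm_mult power_mult_distrib right_diff_distrib)
    then show "\<bar>m_fun u1 u2 \<xi> - \<epsilon>\<^sup>2 * ((cmod (fourier \<psi>1 \<xi>))\<^sup>2 - (cmod (fourier \<psi>2 \<xi>))\<^sup>2)\<bar> \<le> 10 ^ 10 * D ^ 4 * \<epsilon> ^ 4"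
      using m_fun_bound[of \<xi>] by (simp add: power_mult_distrib mult_ac)
  qed (use D in auto)
qed

end
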